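(* Let $q\in\mathbb C\setminus\{0\}$ be not a root of unity and let $j,j',s,s'\in\{0,\frac12,1,\frac32,\dots\}$. The tensor product $R_{jj'}\otimes R_{ss'}$ of the classical type irreducible representations $R_{jj'}$ and $R_{ss'}$ of $U'_q(\mathrm{so}_4)$ (defined, as in the context, by composing the tensor product representation of $\hat U_q(\mathrm{sl}_2)^{\otimes 2,\mathrm{ext}}$ with $\phi$) decomposes into irreducible constituents as $$R_{jj'}\otimes R_{ss'}\;\cong\;\bigoplus_{k=|j-s|}^{j+s}\ \bigoplus_{k'=|j'-s'|}^{j'+s'}R_{kk'},$$ where $k$ runs over $|j-s|,|j-s|+1,\dots,j+s$ and $k'$ over $|j'-s'|,|j'-s'|+1,\dots,j'+s'$.
   Context: Fix a square root $q^{1/2}$ of $q$; for $m\in\frac12\mathbb Z$ put $q^m=(q^{1/2})^{2m}$ and $[m]=\frac{q^m-q^{-m}}{q-q^{-1}}$; $\mathrm i=\sqrt{-1}$. All algebras are complex, unital, associative. $U'_q(\mathrm{so}_4)$ is generated by $I_{21},I_{32},I_{43}$ with defining relations $$I_{21}I_{32}^2-(q+q^{-1})I_{32}I_{21}I_{32}+I_{32}^2I_{21}=-I_{21},\quad I_{32}I_{21}^2-(q+q^{-1})I_{21}I_{32}I_{21}+I_{21}^2I_{32}=-I_{32},$$ $$I_{32}I_{43}^2-(q+q^{-1})I_{43}I_{32}I_{43}+I_{43}^2I_{32}=-I_{32},\quad I_{43}I_{32}^2-(q+q^{-1})I_{32}I_{43}I_{32}+I_{32}^2I_{43}=-I_{43},\quad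 I_{21}I_{43}=I_{43}I_{21}.$$ For $i=1,2$ the $i$-th copy of $U_q(\mathrm{sl}_2)$ is generated by $e_i,f_i,q^{\pm H_i}$ with $q^{H_i}q^{-H_i}=q^{-H_i}q^{H_i}=1$, $q^{H_i}e_i=qe_iq^{H_i}$, $q^{H_i}f_i=q^{-1}f_iq^{H_i}$, $[e_i,f_i]=\frac{q^{2H_i}-q^{-2H_i}}{q-q^{-1}}$, comultiplication $\Delta(q^{\pm H_i})=q^{\pm H_i}\otimes q^{\pm H_i}$, $\Delta(e_i)=e_i\otimes q^{H_i}+q^{-H_i}\otimes e_i$, $\Delta(f_i)=f_i\otimes q^{H_i}+q^{-H_i}\otimes f_i$, and Casimir element $c_i=e_if_i+\frac{q^{2H_i-1}+q^{-2H_i+1}}{(q-q^{-1})^2}$. $\hat U_q(\mathrm{sl}_2)$ is the extension by a central element $x_i$ (automatically invertible) with $q^{-1}x_i^4-c_i(q-q^{-1})^2x_i^2+q=0$. $\hat U_q(\mathrm{sl}_2)^{\otimes 2,\mathrm{ext}}$ is the tensor product of the two copies of $\hat U_q(\mathrm{sl}_2)$ with the inverses of all $q^{r}q^{H_1}q^{\pm H_2}+q^{-r}q^{-H_1}q^{\mp H_2}$, $r\in\mathbb Z$, adjoined. A representation of $U_q(\mathrm{sl}_2)^{\otimes2}$, with operators for $x_1,x_2$ that satisfy the quartic equations and commute with all operators of the representation, extends to $\hat U_q(\mathrm{sl}_2)^{\otimes 2,\mathrm{ext}}$ as soon as the operators $q^{r}q^{H_1}q^{\pm H_2}+q^{-r}q^{-H_1}q^{\mp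 H_2}$ are invertible. $T_l$ ($l\in\frac12\mathbb Z_{\ge0}$) is the representation of $U_q(\mathrm{sl}_2)$ with basis $|l,m\rangle$, $m=-l,\dots,l$: $q^H|l,m\rangle=q^m|l,m\rangle$, $e|l,m\rangle=[l-m]|l,m+1\rangle$, $f|l,m\rangle=[l+m]|l,m-1\rangle$; on it $c$ acts by $\frac{q^{2l+1}+q^{-2l-1}}{(q-q^{-1})^2}$, and it is extended to $\hat U_q(\mathrm{sl}_2)$ by $x\mapsto q^{-l}\cdot\mathrm{id}$. $T_{jj'}=T_j\otimes T_{j'}$ is the resulting representation of $\hat U_q(\mathrm{sl}_2)^{\otimes2,\mathrm{ext}}$ (index-1 generators act on $T_j$, index-2 generators on $T_{j'}$). $T_{jj'}\otimes T_{ss'}$ is the representation in which $e_i,f_i,q^{\pm H_i}$ act through $\Delta$, and $x_1$ (resp. $x_2$) acts as the following solution of $q^{-1}x_i^4-c_i(q-q^{-1})^2x_i^2+q=0$: the operator of $c_i$ is diagonalizable and $x_i$ acts as the scalar $q^{-k}$ on the eigenspace of $c_i$ with eigenvalue $\frac{q^{2k+1}+q^{-2k-1}}{(q-q^{-1})^2}$, $k\in\frac12\mathbb Z_{\ge0}$. $\phi:U'_q(\mathrm{so}_4)\to\hat U_q(\mathrm{sl}_2)^{\otimes2,\mathrm{ext}}$ is the algebra homomorphism with $\phi(I_{21})=\mathrm i\frac{q^{H_1+H_2}-q^{-H_1-H_2}}{q-q^{-1}}$, $\phi(I_{43})=\mathrm i\frac{q^{H_1-H_2}-q^{-H_1+H_2}}{q-q^{-1}}$,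 $$\phi(I_{32})=-\frac{x_1^{-1}q^{-H_2+1}+x_1q^{H_2-1}}{(q^{H_1+H_2-1}+q^{-H_1-H_2+1})(q^{H_1-H_2+1}+q^{-H_1+H_2-1})}\,e_2+\frac{x_1^{-1}q^{H_2+1}+x_1q^{-H_2-1}}{(q^{H_1+H_2+1}+q^{-H_1-H_2-1})(q^{H_1-H_2-1}+q^{-H_1+H_2+1})}\,f_2$$ $$+\frac{x_2^{-1}q^{-H_1+1}+x_2q^{H_1-1}}{(q^{H_1+H_2-1}+q^{-H_1-H_2+1})(q^{H_1-H_2-1}+q^{-H_1+H_2+1})}\,e_1-\frac{x_2^{-1}q^{H_1+1}+x_2q^{-H_1-1}}{(q^{H_1+H_2+1}+q^{-H_1-H_2-1})(q^{H_1-H_2+1}+q^{-H_1+H_2-1})}\,f_1$$ (fractions stand to the left of the generators). Finally $R_{jj'}:=T_{jj'}\circ\phi$ and $R_{jj'}\otimes R_{ss'}:=(T_{jj'}\otimes T_{ss'})\circ\phi$. *)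

theory Defs
  imports
    Complex_Main
    "Jordan_Normal_Form.Gauss_Jordan_Elimination"
    "Jordan_Normal_Form.VS_Connect"
begin

section \<open>Algebras given by generators and relations, and their representations\<close>

text \<open>An algebra presented by generators of type \<open>'g\<close> is given by a set of equations between
  noncommutative polynomial expressions in the generators.\<close>

datatype 'g alg_term =
    Gen 'g
  | Scal complex
  | Add "'g alg_term" "'g alg_term"
  | Mul "'g alg_term" "'g alg_term"

instantiation alg_term :: (type) "{plus, minus, uminus, times, one}"
begin
definition "s + t = Add s t"
definition "s * t = Mul s t"
definition "- t = Mul (Scal (- 1)) (t :: 'a alg_term)"
definition "s - t = Add s (Mul (Scal (- 1)) t)"
definition "1 = Scal 1"
instance ..
end

instance alg_term :: (type) power ..

text \<open>Representations are finite-dimensional and act on the column vectors of length \<open>rdim\<close>.\<close>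

datatype 'g rep = Rep (rdim: nat) (act: "'g \<Rightarrow> complex mat")

primrec eval_term :: "'g rep \<Rightarrow> 'g alg_term \<Rightarrow> complex mat" where
  "eval_term V (Gen g) = act V g"
| "eval_term V (Scal c) = c \<cdot>\<^sub>m 1\<^sub>m (rdim V)"
| "eval_term V (Add s t) = eval_term V s + eval_term V t"
| "eval_term V (Mul s t) = eval_term V s * eval_term V t"

definition is_rep :: "('g alg_term \<times> 'g alg_term) set \<Rightarrow> 'g rep \<Rightarrow> bool" where
  "is_rep rels V \<longleftrightarrow>
     (\<forall>g. act V g \<in> carrier_mat (rdim V) (rdim V)) \<and>
     (\<forall>(s, t) \<in> rels. eval_term V s = eval_term V t)"

definition irreducible_rep :: "('g alg_term \<times> 'g alg_term) set \<Rightarrow> 'g rep \<Rightarrow> bool" where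
  "irreducible_rep rels V \<longleftrightarrow>
     is_rep rels V \<and> rdim V > 0 \<and>
     (\<forall>W. VectorSpace.subspace class_ring W (module_vec TYPE(complex) (rdim V)) \<and>
          (\<forall>g. \<forall>w \<in> W. act V g *\<^sub>v w \<in> W)
        \<longrightarrow> W = {0\<^sub>v (rdim V)} \<or> W = carrier_vec (rdim V))"

definition rep_iso :: "'g rep \<Rightarrow> 'g rep \<Rightarrow> bool" where
  "rep_iso V W \<longleftrightarrow>
     rdim V = rdim W \<and>
     (\<exists>P \<in> carrier_mat (rdim V) (rdim V).
        invertible_mat P \<and> (\<forall>g. P * act V g = act W g * P))"

definition direct_sum_rep :: "'g rep list \<Rightarrow> 'g rep" where
  "direct_sum_rep Vs =
     Rep (\<Sum>V\<leftarrow>Vs. rdim V) (\<lambda>g. diag_block_mat (map (\<lambda>V. act V g) Vs))"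

text \<open>The composition of a representation with the algebra homomorphism given on generators
  by \<open>\<phi>\<close>.\<close>

definition pullback_rep :: "('h \<Rightarrow> 'g alg_term) \<Rightarrow> 'g rep \<Rightarrow> 'h rep" where
  "pullback_rep \<phi> V = Rep (rdim V) (\<lambda>h. eval_term V (\<phi> h))"

text \<open>The matrix of a tensor product of operators; the basis vector \<open>v\<^sub>i \<otimes> w\<^sub>j\<close> has index
  \<open>i * dim W + j\<close>.\<close>

definition kron :: "complex mat \<Rightarrow> complex mat \<Rightarrow> complex mat" where
  "kron A B = mat (dim_row A * dim_row B) (dim_col A * dim_col B)
     (\<lambda>(i, j). A $$ (i div dim_row B, j div dim_col B) * B $$ (i mod dim_row B, j mod dim_col B))"


section \<open>Powers of q and q-numbers\<close>

text \<open>Throughout, \<open>p\<close> is the fixed square root of \<open>q\<close>, so that \<open>q = qpow p 1\<close>. Spins and weights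
  are half-integers, represented as rationals; \<open>qpow\<close> and \<open>qnum\<close> are meant for such arguments
  only.\<close>

definition half_nats :: "rat set" where
  "half_nats = {l. \<exists>n :: nat. l = of_nat n / 2}"

definition qpow :: "complex \<Rightarrow> rat \<Rightarrow> complex" where
  "qpow p m = p powi \<lfloor>2 * m\<rfloor>"

definition qnum :: "complex \<Rightarrow> rat \<Rightarrow> complex" where
  "qnum p m = (qpow p m - qpow p (- m)) / (qpow p 1 - qpow p (- 1))"


section \<open>The algebra \<open>U\<^sub>q(sl\<^sub>2)\<close>\<close>

text \<open>\<open>K_gen\<close> and \<open>Kinv_gen\<close> stand for \<open>q\<^sup>H\<close> and \<open>q\<^sup>-\<^sup>H\<close>.\<close>

datatype sl2_gen = E_gen | F_gen | K_gen | Kinv_gen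

definition sl2_rels :: "complex \<Rightarrow> (sl2_gen alg_term \<times> sl2_gen alg_term) set" where
  "sl2_rels p =
    {(Gen K_gen * Gen Kinv_gen, 1),
     (Gen Kinv_gen * Gen K_gen, 1),
     (Gen K_gen * Gen E_gen, Scal (qpow p 1) * Gen E_gen * Gen K_gen),
     (Gen K_gen * Gen F_gen, Scal (qpow p (- 1)) * Gen F_gen * Gen K_gen),
     (Gen E_gen * Gen F_gen - Gen F_gen * Gen E_gen,
      Scal (1 / (qpow p 1 - qpow p (- 1))) * (Gen K_gen ^ 2 - Gen Kinv_gen ^ 2))}"

definition casimir :: "complex \<Rightarrow> sl2_gen alg_term" where
  "casimir p = Gen E_gen * Gen F_gen +
     Scal (1 / (qpow p 1 - qpow p (- 1)) ^ 2) *
       (Scal (qpow p (- 1)) * Gen K_gen ^ 2 + Scal (qpow p 1) * Gen Kinv_gen ^ 2)"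

text \<open>The comultiplication, as a sum of pure tensors of generators.\<close>

fun comult :: "sl2_gen \<Rightarrow> (sl2_gen \<times> sl2_gen) list" where
  "comult E_gen = [(E_gen, K_gen), (Kinv_gen, E_gen)]"
| "comult F_gen = [(F_gen, K_gen), (Kinv_gen, F_gen)]"
| "comult K_gen = [(K_gen, K_gen)]"
| "comult Kinv_gen = [(Kinv_gen, Kinv_gen)]"

text \<open>The representation \<open>T\<^sub>l\<close>; the basis vector of index \<open>i\<close> is \<open>|l, m\<rangle>\<close> with \<open>m = i - l\<close>.\<close>

definition T_rep :: "complex \<Rightarrow> rat \<Rightarrow> sl2_gen rep" where
  "T_rep p l =
    (let n = nat \<lfloor>2 * l\<rfloor> + 1; wt = (\<lambda>i :: nat. of_nat i - l) in
     Rep n (\<lambda>g. case g of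
         E_gen \<Rightarrow> mat n n (\<lambda>(i, k). if i = k + 1 then qnum p (l - wt k) else 0)
       | F_gen \<Rightarrow> mat n n (\<lambda>(i, k). if k = i + 1 then qnum p (l + wt k) else 0)
       | K_gen \<Rightarrow> mat_diag n (\<lambda>k. qpow p (wt k))
       | Kinv_gen \<Rightarrow> mat_diag n (\<lambda>k. qpow p (- wt k))))"


section \<open>The extended tensor square\<close>

datatype copy = C1 | C2

datatype sign = Plus | Minus

text \<open>\<open>X_gen\<close> stands for \<open>x\<^sub>i\<close>, and \<open>Dinv_gen \<sigma> r\<close> for the adjoined inverse of the element \<open>denom \<sigma> r\<close>
  below. Since \<open>x\<^sub>i\<close> is automatically invertible, adding its inverse to the generators does
  not change the algebra.\<close>

datatype ext_gen = Sl2 copy sl2_gen | X_gen copy | Xinv_gen copy | Dinv_gen sign int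

text \<open>The element \<open>q\<^sup>r q\<^bsup>H1\<^esup> q\<^bsup>\<plusminus>H2\<^esup> + q\<^bsup>-r\<^esup> q\<^bsup>-H1\<^esup> q\<^bsup>\<mp>H2\<^esup>\<close>, which already lives in
  the tensor square of \<open>U\<^sub>q(sl\<^sub>2)\<close>, generated by the pairs of a copy and a generator.\<close>

fun denom :: "complex \<Rightarrow> sign \<Rightarrow> int \<Rightarrow> (copy \<times> sl2_gen) alg_term" where
  "denom p Plus r =
     Scal (qpow p (of_int r)) * Gen (C1, K_gen) * Gen (C2, K_gen) +
     Scal (qpow p (- of_int r)) * Gen (C1, Kinv_gen) * Gen (C2, Kinv_gen)"
| "denom p Minus r =
     Scal (qpow p (of_int r)) * Gen (C1, K_gen) * Gen (C2, Kinv_gen) +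
     Scal (qpow p (- of_int r)) * Gen (C1, Kinv_gen) * Gen (C2, K_gen)"

definition ext_rels :: "complex \<Rightarrow> (ext_gen alg_term \<times> ext_gen alg_term) set" where
  "ext_rels p =
     {(map_alg_term (Sl2 i) s, map_alg_term (Sl2 i) t) | i s t. (s, t) \<in> sl2_rels p} \<union>
     {(Gen (Sl2 C1 g) * Gen (Sl2 C2 h), Gen (Sl2 C2 h) * Gen (Sl2 C1 g)) | g h. True} \<union>
     {(Gen (X_gen i) * Gen (Sl2 k g), Gen (Sl2 k g) * Gen (X_gen i)) | i k g. True} \<union>
     {(Gen (X_gen C1) * Gen (X_gen C2), Gen (X_gen C2) * Gen (X_gen C1))} \<union>
     {(Scal (qpow p (- 1)) * Gen (X_gen i) ^ 4
         - map_alg_term (Sl2 i) (casimir p) * Scal ((qpow p 1 - qpow p (- 1)) ^ 2) * Gen (X_gen i) ^ 2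
         + Scal (qpow p 1),
       Scal 0) | i. True} \<union>
     {(Gen (X_gen i) * Gen (Xinv_gen i), 1) | i. True} \<union>
     {(Gen (Xinv_gen i) * Gen (X_gen i), 1) | i. True} \<union>
     {(map_alg_term (\<lambda>(i, g). Sl2 i g) (denom p \<sigma> r) * Gen (Dinv_gen \<sigma> r), 1) | \<sigma> r. True} \<union>
     {(Gen (Dinv_gen \<sigma> r) * map_alg_term (\<lambda>(i, g). Sl2 i g) (denom p \<sigma> r), 1) | \<sigma> r. True}"

text \<open>The extension of a representation of the tensor square of \<open>U\<^sub>q(sl\<^sub>2)\<close> by given operators
  for \<open>x\<^sub>1, x\<^sub>2\<close>; the remaining generators act as the inverse matrices.\<close>

definition extend_rep ::
    "complex \<Rightarrow> (copy \<times> sl2_gen) rep \<Rightarrow> (copy \<Rightarrow> complex mat) \<Rightarrow> ext_gen rep" where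
  "extend_rep p V x = Rep (rdim V) (\<lambda>g. case g of
       Sl2 i h \<Rightarrow> act V (i, h)
     | X_gen i \<Rightarrow> x i
     | Xinv_gen i \<Rightarrow> the (mat_inverse (x i))
     | Dinv_gen \<sigma> r \<Rightarrow> the (mat_inverse (eval_term V (denom p \<sigma> r))))"

definition TT_rep :: "complex \<Rightarrow> rat \<Rightarrow> rat \<Rightarrow> ext_gen rep" where
  "TT_rep p j j' =
    (let V = T_rep p j; W = T_rep p j'; n = rdim V * rdim W in
     extend_rep p
       (Rep n (\<lambda>(i, g). case i of
           C1 \<Rightarrow> kron (act V g) (1\<^sub>m (rdim W))
         | C2 \<Rightarrow> kron (1\<^sub>m (rdim V)) (act W g)))
       (\<lambda>i. case i of
           C1 \<Rightarrow> qpow p (- j) \<cdot>\<^sub>m 1\<^sub>m n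
         | C2 \<Rightarrow> qpow p (- j') \<cdot>\<^sub>m 1\<^sub>m n))"

text \<open>The operator acting as \<open>q\<^bsup>-k\<^esup>\<close> on the eigenspace of \<open>C\<close> for the eigenvalue by which the
  Casimir element acts on \<open>T\<^sub>k\<close>, for all \<open>k\<close>. It is unique if \<open>C\<close> is diagonalizable with
  eigenvalues of this form.\<close>

definition casimir_root :: "complex \<Rightarrow> nat \<Rightarrow> complex mat \<Rightarrow> complex mat" where
  "casimir_root p n C = (THE A. A \<in> carrier_mat n n \<and>
     (\<forall>k \<in> half_nats. \<forall>v \<in> carrier_vec n.
        C *\<^sub>v v = ((qpow p (2 * k + 1) + qpow p (- 2 * k - 1)) / (qpow p 1 - qpow p (- 1)) ^ 2) \<cdot>\<^sub>v v
        \<longrightarrow> A *\<^sub>v v = qpow p (- k) \<cdot>\<^sub>v v))"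

definition tensor_rep :: "complex \<Rightarrow> ext_gen rep \<Rightarrow> ext_gen rep \<Rightarrow> ext_gen rep" where
  "tensor_rep p V W =
    (let n = rdim V * rdim W;
         U = Rep n (\<lambda>(i, g).
               foldr (\<lambda>(a, b) M. kron (act V (Sl2 i a)) (act W (Sl2 i b)) + M) (comult g) (0\<^sub>m n n))
     in extend_rep p U (\<lambda>i. casimir_root p n (eval_term U (map_alg_term (Pair i) (casimir p)))))"


section \<open>The algebra \<open>U'\<^sub>q(so\<^sub>4)\<close>\<close>

datatype so4_gen = I21 | I32 | I43

definition so4_rels :: "complex \<Rightarrow> (so4_gen alg_term \<times> so4_gen alg_term) set" where
  "so4_rels p =
    (let serre = (\<lambda>a b. (Gen a * Gen b ^ 2
           - Scal (qpow p 1 + qpow p (- 1)) * Gen b * Gen a * Gen b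
           + Gen b ^ 2 * Gen a, - Gen a))
     in {serre I21 I32, serre I32 I21, serre I32 I43, serre I43 I32,
         (Gen I21 * Gen I43, Gen I43 * Gen I21)})"

fun phi :: "complex \<Rightarrow> so4_gen \<Rightarrow> ext_gen alg_term" where
  "phi p I21 = Scal (\<i> / (qpow p 1 - qpow p (- 1))) *
     (Gen (Sl2 C1 K_gen) * Gen (Sl2 C2 K_gen) - Gen (Sl2 C1 Kinv_gen) * Gen (Sl2 C2 Kinv_gen))"
| "phi p I43 = Scal (\<i> / (qpow p 1 - qpow p (- 1))) *
     (Gen (Sl2 C1 K_gen) * Gen (Sl2 C2 Kinv_gen) - Gen (Sl2 C1 Kinv_gen) * Gen (Sl2 C2 K_gen))"
| "phi p I32 =
     - ((Gen (Xinv_gen C1) * (Scal (qpow p 1) * Gen (Sl2 C2 Kinv_gen))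
           + Gen (X_gen C1) * (Scal (qpow p (- 1)) * Gen (Sl2 C2 K_gen)))
         * Gen (Dinv_gen Plus (- 1)) * Gen (Dinv_gen Minus 1) * Gen (Sl2 C2 E_gen))
     + (Gen (Xinv_gen C1) * (Scal (qpow p 1) * Gen (Sl2 C2 K_gen))
           + Gen (X_gen C1) * (Scal (qpow p (- 1)) * Gen (Sl2 C2 Kinv_gen)))
         * Gen (Dinv_gen Plus 1) * Gen (Dinv_gen Minus (- 1)) * Gen (Sl2 C2 F_gen)
     + (Gen (Xinv_gen C2) * (Scal (qpow p 1) * Gen (Sl2 C1 Kinv_gen))
           + Gen (X_gen C2) * (Scal (qpow p (- 1)) * Gen (Sl2 C1 K_gen)))
         * Gen (Dinv_gen Plus (- 1)) * Gen (Dinv_gen Minus (- 1)) * Gen (Sl2 C1 E_gen)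
     - (Gen (Xinv_gen C2) * (Scal (qpow p 1) * Gen (Sl2 C1 K_gen))
           + Gen (X_gen C2) * (Scal (qpow p (- 1)) * Gen (Sl2 C1 Kinv_gen)))
         * Gen (Dinv_gen Plus 1) * Gen (Dinv_gen Minus 1) * Gen (Sl2 C1 F_gen)"

definition R_rep :: "complex \<Rightarrow> rat \<Rightarrow> rat \<Rightarrow> so4_gen rep" where
  "R_rep p j j' = pullback_rep (phi p) (TT_rep p j j')"

text \<open>\<open>U'\<^sub>q(so\<^sub>4)\<close> carries no comultiplication here: the tensor product is formed on the level of
  the extended algebra and then pulled back.\<close>

definition R_tensor_rep :: "complex \<Rightarrow> rat \<Rightarrow> rat \<Rightarrow> rat \<Rightarrow> rat \<Rightarrow> so4_gen rep" where
  "R_tensor_rep p j j' s s' =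
     pullback_rep (phi p) (tensor_rep p (TT_rep p j j') (TT_rep p s s'))"

text \<open>The list \<open>|j - s|, |j - s| + 1, \<dots>, j + s\<close>.\<close>

definition spin_range :: "rat \<Rightarrow> rat \<Rightarrow> rat list" where
  "spin_range j s =
     map (\<lambda>i. \<bar>j - s\<bar> + of_nat i) [0..<nat \<lfloor>j + s - \<bar>j - s\<bar>\<rfloor> + 1]"

end

theory Submission
  imports Defs
begin

text \<open>
  For \<open>k\<close> in the Clebsch-Gordan range the space \<open>T\<^sub>j \<otimes> T\<^sub>s\<close> contains an explicit lowest weight vector
  of weight \<open>-k\<close>, and the raising operator turns it into an intertwiner \<open>P\<^sub>k\<close> from \<open>T\<^sub>k\<close>; the chain
  of weights stops after \<open>2k\<close> steps because a finite-dimensional space has finitely many weights.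
  After a permutation of the tensor factors, \<open>P\<^sub>k \<otimes> P\<^sub>k'\<close> intertwines \<open>T\<^sub>k \<otimes> T\<^sub>k'\<close> with
  \<open>T\<^sub>j\<^sub>j' \<otimes> T\<^sub>s\<^sub>s'\<close>. These blocks are independent, since the two Casimir elements separate them,
  and they fill the space by a dimension count. Hence the Casimir elements are diagonalizable, \<open>x\<^sub>i\<close> is
  well defined and acts on each block by the right scalar, and the denominators are invertible, so that
  the blocks also intertwine the representations of the extended algebra and their pullbacks along
  \<open>\<phi>\<close>. All relations can therefore be checked on the single blocks.

  On a block, \<open>I\<^sub>2\<^sub>1\<close> and \<open>I\<^sub>4\<^sub>3\<close> are diagonal and separate the weights, while \<open>I\<^sub>3\<^sub>2\<close> is a nearest
  neighbour operator on the weight lattice whose coefficients vanish only at the border. This gives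
  irreducibility, and it reduces the Serre relations to one rational identity.
\<close>

section \<open>Kronecker products\<close>

text \<open>Neither complete reducibility of modules over \<open>U_q(sl_2)\<close> nor the
  homomorphism property of \<open>phi\<close> is presupposed. The obstacle is that
  \<open>casimir_root\<close> is a definite description and \<open>the (mat_inverse _)\<close> is a
  total function: nothing can be said about the operators of \<open>x_i\<close> and of the adjoined
  inverses before a complete eigenbasis of the Casimir elements is at hand. Therefore the blocks are
  built for the two copies of \<open>sl_2\<close> alone, where no such operator occurs, and the
  extended algebra enters only afterwards.

  Since \<open>q\<close> is not a root of unity, the Casimir eigenvalue determines the spin and no
  denominator has a zero eigenvalue. On a block \<open>x_i\<close> is a scalar, so each numerator in
  \<open>phi\<close> becomes a single sum \<open>ch\<close> of a power of \<open>p\<close> and its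
  inverse. In the square of \<open>I32\<close>, all displacements on the weight lattice other than
  the return to the starting point cancel, either by a three-term recurrence for
  \<open>q\<close>-numbers or because two paths carry opposite contributions. The rational identity
  is the coefficient of that return.\<close>

lemma dim_kron [simp]:
  "dim_row (kron A B) = dim_row A * dim_row B"
  "dim_col (kron A B) = dim_col A * dim_col B"
  by (simp_all add: kron_def)

lemma kron_carrier:
  "A \<in> carrier_mat a b \<Longrightarrow> B \<in> carrier_mat c d \<Longrightarrow> kron A B \<in> carrier_mat (a * c) (b * d)"
  by (auto simp: kron_def)

lemma index_kron:
  "i < dim_row A * dim_row B \<Longrightarrow> j < dim_col A * dim_col B \<Longrightarrow>
    kron A B $$ (i, j) =
      A $$ (i div dim_row B, j div dim_col B) * B $$ (i mod dim_row B, j mod dim_col B)"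
  by (simp add: kron_def)

lemma div_mod_less_of_less_mult:
  fixes i a b :: nat
  assumes "i < a * b"
  shows "i div b < a" "i mod b < b"
  using assms by (auto simp: less_mult_imp_div_less intro!: mod_less_divisor gr0I)

lemma pair_index_less:
  fixes a b n m :: nat
  assumes "a < n" "b < m"
  shows "a * m + b < n * m"
proof -
  have "a * m + b < (a + 1) * m" using assms by simp
  also have "\<dots> \<le> n * m" using assms by (intro mult_right_mono) auto
  finally show ?thesis .
qed

lemma sum_pair_index:
  fixes f :: "nat \<Rightarrow> 'a :: comm_monoid_add"
  shows "(\<Sum>r<n * m. f r) = (\<Sum>a<n. \<Sum>b<m. f (a * m + b))"
proof -
  have "(\<Sum>r<n * m. f r) = (\<Sum>a<n. sum f {a * m..<a * m + m})"
    by (rule sum.nat_group[symmetric])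
  also have "\<dots> = (\<Sum>a<n. \<Sum>b<m. f (a * m + b))"
  proof (rule sum.cong[OF refl])
    fix a
    show "sum f {a * m..<a * m + m} = (\<Sum>b<m. f (a * m + b))"
      using sum.shift_bounds_nat_ivl[of f 0 "a * m" m]
      by (simp add: lessThan_atLeast0 add.commute)
  qed
  finally show ?thesis .
qed

lemma index_mult_mat_sum:
  assumes "A \<in> carrier_mat n m" "B \<in> carrier_mat m k" "i < n" "j < k"
  shows "(A * B) $$ (i, j) = (\<Sum>r<m. A $$ (i, r) * B $$ (r, j))"
  using assms by (auto simp: scalar_prod_def lessThan_atLeast0 intro!: sum.cong)

lemma index_mult_mat_vec_sum:
  assumes "A \<in> carrier_mat n m" "v \<in> carrier_vec m" "i < n"
  shows "(A *\<^sub>v v) $ i = (\<Sum>r<m. A $$ (i, r) * v $ r)"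
  using assms by (auto simp: scalar_prod_def lessThan_atLeast0 intro!: sum.cong)

lemma kron_mult:
  assumes A: "A \<in> carrier_mat a b" and B: "B \<in> carrier_mat a' b'"
    and C: "C \<in> carrier_mat b c" and D: "D \<in> carrier_mat b' c'"
  shows "kron A B * kron C D = kron (A * C) (B * D)"
proof (rule eq_matI)
  fix i j assume "i < dim_row (kron (A * C) (B * D))" "j < dim_col (kron (A * C) (B * D))"
  hence i: "i < a * a'" and j: "j < c * c'" using assms by auto
  note i' = div_mod_less_of_less_mult[OF i] and j' = div_mod_less_of_less_mult[OF j]
  have "(kron A B * kron C D) $$ (i, j) = (\<Sum>r<b * b'. kron A B $$ (i, r) * kron C D $$ (r, j))"
    by (rule index_mult_mat_sum[OF kron_carrier[OF A B] kron_carrier[OF C D] i j])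
  also have "\<dots> = (\<Sum>x<b. \<Sum>y<b'. kron A B $$ (i, x * b' + y) * kron C D $$ (x * b' + y, j))"
    by (rule sum_pair_index)
  also have "\<dots> = (\<Sum>x<b. \<Sum>y<b'. (A $$ (i div a', x) * C $$ (x, j div c')) *
        (B $$ (i mod a', y) * D $$ (y, j mod c')))"
    using assms i j by (intro sum.cong refl) (auto simp: index_kron pair_index_less)
  also have "\<dots> = (A * C) $$ (i div a', j div c') * (B * D) $$ (i mod a', j mod c')"
    by (simp add: index_mult_mat_sum[OF A C i'(1) j'(1)] index_mult_mat_sum[OF B D i'(2) j'(2)]
        sum_product)
  also have "\<dots> = kron (A * C) (B * D) $$ (i, j)"
    using assms i j by (subst index_kron) auto
  finally show "(kron A B * kron C D) $$ (i, j) = kron (A * C) (B * D) $$ (i, j)" .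
qed (use assms in auto)

lemma kron_add_left:
  assumes "A \<in> carrier_mat a b" "A' \<in> carrier_mat a b" "B \<in> carrier_mat c d"
  shows "kron (A + A') B = kron A B + kron A' B"
  using assms by (intro eq_matI) (auto simp: index_kron div_mod_less_of_less_mult distrib_right)

lemma kron_add_right:
  assumes "A \<in> carrier_mat a b" "B \<in> carrier_mat c d" "B' \<in> carrier_mat c d"
  shows "kron A (B + B') = kron A B + kron A B'"
  using assms by (intro eq_matI) (auto simp: index_kron div_mod_less_of_less_mult distrib_left)

lemma kron_smult_left: "kron (x \<cdot>\<^sub>m A) B = x \<cdot>\<^sub>m kron A B"
  by (intro eq_matI) (auto simp: index_kron div_mod_less_of_less_mult)

lemma kron_smult_right: "kron A (x \<cdot>\<^sub>m B) = x \<cdot>\<^sub>m kron A B"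
  by (intro eq_matI) (auto simp: index_kron div_mod_less_of_less_mult)

lemma kron_mat_diag:
  "kron (mat_diag n f) (mat_diag m g) = mat_diag (n * m) (\<lambda>i. f (i div m) * g (i mod m))"
proof (rule eq_matI)
  fix i j assume "i < dim_row (mat_diag (n * m) (\<lambda>i. f (i div m) * g (i mod m)))"
    "j < dim_col (mat_diag (n * m) (\<lambda>i. f (i div m) * g (i mod m)))"
  hence ij: "i < n * m" "j < n * m" by (auto simp: mat_diag_def)
  have "i = j \<longleftrightarrow> i div m = j div m \<and> i mod m = j mod m"
    by (metis div_mult_mod_eq)
  thus "kron (mat_diag n f) (mat_diag m g) $$ (i, j) =
      mat_diag (n * m) (\<lambda>i. f (i div m) * g (i mod m)) $$ (i, j)"
    using ij by (auto simp: mat_diag_def index_kron div_mod_less_of_less_mult)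
qed (auto simp: mat_diag_def)

lemma kron_one: "kron (1\<^sub>m n) (1\<^sub>m m) = 1\<^sub>m (n * m)"
  using kron_mat_diag[of n "\<lambda>_. 1" m "\<lambda>_. 1"] by simp

text \<open>Columns of distinct weights have disjoint supports, so the intertwiners below have this
  property. It implies injectivity and is inherited by Kronecker products.\<close>

definition separated_columns :: "complex mat \<Rightarrow> bool" where
  "separated_columns A \<longleftrightarrow> (\<forall>j < dim_col A. \<exists>i < dim_row A.
     A $$ (i, j) \<noteq> 0 \<and> (\<forall>j' < dim_col A. j' \<noteq> j \<longrightarrow> A $$ (i, j') = 0))"

lemma separated_columns_injective:
  assumes A: "A \<in> carrier_mat n m" "separated_columns A"
    and v: "v \<in> carrier_vec m" "A *\<^sub>v v = 0\<^sub>v n"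
  shows "v = 0\<^sub>v m"
proof (rule eq_vecI)
  fix j assume "j < dim_vec (0\<^sub>v m :: complex vec)"
  hence j: "j < m" by simp
  then obtain i where i: "i < n" "A $$ (i, j) \<noteq> 0" "\<And>j'. j' < m \<Longrightarrow> j' \<noteq> j \<Longrightarrow> A $$ (i, j') = 0"
    using A unfolding separated_columns_def by auto
  have "0 = (A *\<^sub>v v) $ i" using v(2) i(1) by simp
  also have "\<dots> = (\<Sum>r<m. A $$ (i, r) * v $ r)" by (rule index_mult_mat_vec_sum[OF A(1) v(1) i(1)])
  also have "\<dots> = (\<Sum>r<m. if r = j then A $$ (i, j) * v $ j else 0)"
    using i(3) by (intro sum.cong) auto
  finally show "v $ j = 0\<^sub>v m $ j" using i j by simp
qed (use v in auto)

text \<open>The row isolating a column of the product is the pair of rows isolating the two factors,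
  because any other column differs in at least one of its two factor indices.\<close>

lemma kron_separated_columns:
  assumes A: "A \<in> carrier_mat a b" "separated_columns A" and B: "B \<in> carrier_mat c d" "separated_columns B"
  shows "separated_columns (kron A B)"
  unfolding separated_columns_def
proof (intro allI impI)
  fix j assume "j < dim_col (kron A B)"
  hence j: "j < b * d" using A B by simp
  note j' = div_mod_less_of_less_mult[OF j]
  obtain i where i: "i < a" "A $$ (i, j div d) \<noteq> 0" "\<And>k. k < b \<Longrightarrow> k \<noteq> j div d \<Longrightarrow> A $$ (i, k) = 0"
    using A j'(1) unfolding separated_columns_def by auto
  obtain l where l: "l < c" "B $$ (l, j mod d) \<noteq> 0" "\<And>k. k < d \<Longrightarrow> k \<noteq> j mod d \<Longrightarrow> B $$ (l, k) = 0"
    using B j'(2) unfolding separated_columns_def by auto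
  have il: "i * c + l < a * c" by (rule pair_index_less[OF i(1) l(1)])
  have entry: "kron A B $$ (i * c + l, k) = A $$ (i, k div d) * B $$ (l, k mod d)" if "k < b * d" for k
    using A B il l(1) that by (subst index_kron) auto
  have "kron A B $$ (i * c + l, k) = 0" if "k < b * d" "k \<noteq> j" for k
  proof -
    have "k div d \<noteq> j div d \<or> k mod d \<noteq> j mod d" using that(2) by (metis div_mult_mod_eq)
    thus ?thesis using entry[OF that(1)] i(3) l(3) div_mod_less_of_less_mult[OF that(1)] by auto
  qed
  thus "\<exists>i<dim_row (kron A B). kron A B $$ (i, j) \<noteq> 0 \<and>
      (\<forall>j'<dim_col (kron A B). j' \<noteq> j \<longrightarrow> kron A B $$ (i, j') = 0)"
    using A B il entry[OF j] i(2) l(2) by (intro exI[of _ "i * c + l"]) auto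
qed


section \<open>The permutation of tensor factors\<close>

text \<open>The index of \<open>u \<otimes> u' \<otimes> w \<otimes> w'\<close> is sent to the index of \<open>u \<otimes> w \<otimes> u' \<otimes> w'\<close>.\<close>

definition middle_swap :: "nat \<Rightarrow> nat \<Rightarrow> nat \<Rightarrow> nat \<Rightarrow> nat" where
  "middle_swap b c d r = ((r div (c * d) div b) * c + r mod (c * d) div d) * (b * d)
      + ((r div (c * d)) mod b * d + r mod (c * d) mod d)"

text \<open>The columns carry the grouped order
  \<open>u \<otimes> w \<otimes> u' \<otimes> w'\<close>, so that the Kronecker product of two
  intertwiners, one for each copy of \<open>sl_2\<close>, can be composed on the right. The rows
  carry the order used by \<open>tensor_rep\<close>.\<close>

definition middle_swap_mat :: "nat \<Rightarrow> nat \<Rightarrow> nat \<Rightarrow> nat \<Rightarrow> complex mat" where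
  "middle_swap_mat a b c d = mat ((a * b) * (c * d)) ((a * c) * (b * d))
     (\<lambda>(i, j). if j = middle_swap b c d i then 1 else 0)"

lemma middle_swap_mat_carrier:
  "middle_swap_mat a b c d \<in> carrier_mat ((a * b) * (c * d)) ((a * c) * (b * d))"
  by (simp add: middle_swap_mat_def)

lemma middle_swap_less:
  assumes "r < (a * b) * (c * d)"
  shows "middle_swap b c d r < (a * c) * (b * d)"
  using div_mod_less_of_less_mult[OF assms]
  unfolding middle_swap_def by (intro pair_index_less) (auto dest: div_mod_less_of_less_mult)

text \<open>Exchanging the inner factors twice changes nothing, but after the first exchange their
  sizes \<open>b\<close> and \<open>c\<close> have traded places. This inverse turns right
  multiplication by the permutation matrix into an index substitution.\<close>

lemma middle_swap_middle_swap:
  assumes "r < (a * b) * (c * d)"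
  shows "middle_swap c b d (middle_swap b c d r) = r"
proof -
  note r = div_mod_less_of_less_mult[OF assms]
  note r1 = div_mod_less_of_less_mult[OF r(1)] and r2 = div_mod_less_of_less_mult[OF r(2)]
  have l: "(r div (c * d)) mod b * d + r mod (c * d) mod d < b * d"
    by (rule pair_index_less[OF r1(2) r2(2)])
  have "r mod (c * d) div d * d + r mod (c * d) mod d = r mod (c * d)"
    "r div (c * d) div b * b + r div (c * d) mod b = r div (c * d)"
    "r div (c * d) * (c * d) + r mod (c * d) = r"
    by (rule div_mult_mod_eq)+
  thus ?thesis
    using l r1 r2 by (simp add: middle_swap_def[of c] middle_swap_def[of b])
qed

lemma middle_swap_mat_mult:
  assumes Y: "Y \<in> carrier_mat ((a * c) * (b * d)) m" and r: "r < (a * b) * (c * d)" and j: "j < m"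
  shows "(middle_swap_mat a b c d * Y) $$ (r, j) = Y $$ (middle_swap b c d r, j)"
proof -
  have "(middle_swap_mat a b c d * Y) $$ (r, j) =
      (\<Sum>x<(a * c) * (b * d). middle_swap_mat a b c d $$ (r, x) * Y $$ (x, j))"
    by (rule index_mult_mat_sum[OF middle_swap_mat_carrier Y r j])
  also have "\<dots> = (\<Sum>x<(a * c) * (b * d). if x = middle_swap b c d r then Y $$ (x, j) else 0)"
    using r by (intro sum.cong) (auto simp: middle_swap_mat_def)
  also have "\<dots> = Y $$ (middle_swap b c d r, j)"
    using middle_swap_less[OF r] by simp
  finally show ?thesis .
qed

lemma mult_middle_swap_mat:
  assumes Y: "Y \<in> carrier_mat m ((a * b) * (c * d))" and r: "r < m" and j: "j < (a * c) * (b * d)"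
  shows "(Y * middle_swap_mat a b c d) $$ (r, j) = Y $$ (r, middle_swap c b d j)"
proof -
  have "(Y * middle_swap_mat a b c d) $$ (r, j) =
      (\<Sum>x<(a * b) * (c * d). Y $$ (r, x) * middle_swap_mat a b c d $$ (x, j))"
    by (rule index_mult_mat_sum[OF Y middle_swap_mat_carrier r j])
  also have "\<dots> = (\<Sum>x<(a * b) * (c * d). if x = middle_swap c b d j then Y $$ (r, x) else 0)"
  proof (rule sum.cong[OF refl])
    fix x assume "x \<in> {..<(a * b) * (c * d)}"
    hence x: "x < (a * b) * (c * d)" by simp
    have "j = middle_swap b c d x \<longleftrightarrow> x = middle_swap c b d j"
      using middle_swap_middle_swap[OF x] middle_swap_middle_swap[OF j] by auto
    thus "Y $$ (r, x) * middle_swap_mat a b c d $$ (x, j) =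
        (if x = middle_swap c b d j then Y $$ (r, x) else 0)"
      using x j by (simp add: middle_swap_mat_def)
  qed
  also have "\<dots> = Y $$ (r, middle_swap c b d j)"
    using middle_swap_less[OF j] by simp
  finally show ?thesis .
qed

lemma middle_swap_div_mod:
  assumes "r < (a * b) * (c * d)"
  shows "middle_swap b c d r div (b * d) div c = r div (c * d) div b"
    "middle_swap b c d r div (b * d) mod c = r mod (c * d) div d"
    "middle_swap b c d r mod (b * d) div d = r div (c * d) mod b"
    "middle_swap b c d r mod (b * d) mod d = r mod (c * d) mod d"
proof -
  note r = div_mod_less_of_less_mult[OF assms]
  note r1 = div_mod_less_of_less_mult[OF r(1)] and r2 = div_mod_less_of_less_mult[OF r(2)]
  have l: "(r div (c * d)) mod b * d + r mod (c * d) mod d < b * d"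
    by (rule pair_index_less[OF r1(2) r2(2)])
  show "middle_swap b c d r div (b * d) div c = r div (c * d) div b"
    "middle_swap b c d r div (b * d) mod c = r mod (c * d) div d"
    "middle_swap b c d r mod (b * d) div d = r div (c * d) mod b"
    "middle_swap b c d r mod (b * d) mod d = r mod (c * d) mod d"
    using l r1 r2 by (simp_all add: middle_swap_def)
qed

lemma kron_middle_swap:
  assumes A: "A \<in> carrier_mat a a" and B: "B \<in> carrier_mat b b"
    and C: "C \<in> carrier_mat c c" and D: "D \<in> carrier_mat d d"
  shows "kron (kron A B) (kron C D) * middle_swap_mat a b c d =
    middle_swap_mat a b c d * kron (kron A C) (kron B D)"
proof (rule eq_matI)
  fix i j assume "i < dim_row (middle_swap_mat a b c d * kron (kron A C) (kron B D))"
    "j < dim_col (middle_swap_mat a b c d * kron (kron A C) (kron B D))"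
  hence i: "i < (a * b) * (c * d)" and j: "j < (a * c) * (b * d)"
    using assms by (auto simp: middle_swap_mat_def)
  have AB: "kron (kron A B) (kron C D) \<in> carrier_mat ((a * b) * (c * d)) ((a * b) * (c * d))"
    and AC: "kron (kron A C) (kron B D) \<in> carrier_mat ((a * c) * (b * d)) ((a * c) * (b * d))"
    using assms by (auto intro!: kron_carrier)
  note i1 = middle_swap_less[OF i] and j1 = middle_swap_less[OF j]
  note bounds = div_mod_less_of_less_mult[OF i] div_mod_less_of_less_mult[OF j]
    div_mod_less_of_less_mult[OF i1] div_mod_less_of_less_mult[OF j1]
  show "(kron (kron A B) (kron C D) * middle_swap_mat a b c d) $$ (i, j) =
      (middle_swap_mat a b c d * kron (kron A C) (kron B D)) $$ (i, j)"
    unfolding mult_middle_swap_mat[OF AB i j] middle_swap_mat_mult[OF AC i j]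
    using A B C D i j i1 j1 bounds
    by (simp add: index_kron middle_swap_div_mod[OF i] middle_swap_div_mod[OF j])
qed (use assms in \<open>auto simp: middle_swap_mat_def\<close>)

text \<open>The product has the rows of \<open>Y\<close> in another order.\<close>

lemma middle_swap_mat_mult_separated_columns:
  assumes Y: "Y \<in> carrier_mat ((a * c) * (b * d)) m" "separated_columns Y"
  shows "separated_columns (middle_swap_mat a b c d * Y)"
  unfolding separated_columns_def
proof (intro allI impI)
  fix j assume "j < dim_col (middle_swap_mat a b c d * Y)"
  hence j: "j < m" using Y by simp
  obtain i where i: "i < (a * c) * (b * d)" "Y $$ (i, j) \<noteq> 0" "\<And>j'. j' < m \<Longrightarrow> j' \<noteq> j \<Longrightarrow> Y $$ (i, j') = 0"
    using Y j unfolding separated_columns_def by auto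
  have i': "middle_swap c b d i < (a * b) * (c * d)" by (rule middle_swap_less[OF i(1)])
  have "(middle_swap_mat a b c d * Y) $$ (middle_swap c b d i, k) = Y $$ (i, k)" if "k < m" for k
    using middle_swap_mat_mult[OF Y(1) i' that] middle_swap_middle_swap[OF i(1)] by simp
  thus "\<exists>i<dim_row (middle_swap_mat a b c d * Y). (middle_swap_mat a b c d * Y) $$ (i, j) \<noteq> 0 \<and>
      (\<forall>j'<dim_col (middle_swap_mat a b c d * Y). j' \<noteq> j \<longrightarrow> (middle_swap_mat a b c d * Y) $$ (i, j') = 0)"
    using i i' j Y middle_swap_mat_carrier[of a b c d] by (intro exI[of _ "middle_swap c b d i"]) auto
qed


section \<open>Intertwiners\<close>

definition intertwines :: "'g rep \<Rightarrow> 'g rep \<Rightarrow> complex mat \<Rightarrow> bool" where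
  "intertwines V W B \<longleftrightarrow> B \<in> carrier_mat (rdim V) (rdim W) \<and>
     (\<forall>g. act V g * B = B * act W g)"

definition matrix_rep :: "'g rep \<Rightarrow> bool" where
  "matrix_rep V \<longleftrightarrow> (\<forall>g. act V g \<in> carrier_mat (rdim V) (rdim V))"

lemma eval_term_carrier:
  "matrix_rep V \<Longrightarrow> eval_term V t \<in> carrier_mat (rdim V) (rdim V)"
  by (induction t) (auto simp: matrix_rep_def)

lemma smult_one_mult:
  "A \<in> carrier_mat n m \<Longrightarrow> (x \<cdot>\<^sub>m 1\<^sub>m n) * A = x \<cdot>\<^sub>m (A :: complex mat)"
  "A \<in> carrier_mat n m \<Longrightarrow> A * (x \<cdot>\<^sub>m 1\<^sub>m m) = x \<cdot>\<^sub>m (A :: complex mat)"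
   apply (simp add: mult_smult_assoc_mat[of "1\<^sub>m n" n n])
  apply (simp add: mult_smult_distrib[of A n m "1\<^sub>m m" m])
  done

text \<open>\<open>B\<close> passes through a product one factor at a time, so the generators
  decide. The lemma is applied to the Casimir elements, the denominators, the images under
  \<open>phi\<close> and both sides of the defining relations.\<close>

lemma eval_term_intertwines:
  assumes V: "matrix_rep V" and W: "matrix_rep W" and B: "intertwines V W B"
  shows "eval_term V t * B = B * eval_term W t"
proof -
  have B': "B \<in> carrier_mat (rdim V) (rdim W)" using B by (simp add: intertwines_def)
  note c = eval_term_carrier[OF V] eval_term_carrier[OF W]
  show ?thesis
  proof (induction t)
    case (Gen g)
    thus ?case using B by (simp add: intertwines_def)
  next
    case (Scal x)
    thus ?case using B' by (simp add: smult_one_mult)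
  next
    case (Add s t)
    thus ?case using B'
      by (simp add: add_mult_distrib_mat[OF c(1) c(1) B'] mult_add_distrib_mat[OF B' c(2) c(2)])
  next
    case (Mul s t)
    thus ?case
      by (simp add: assoc_mult_mat[OF c(1) c(1) B'] assoc_mult_mat[OF B' c(2) c(2), symmetric])
        (simp add: assoc_mult_mat[OF c(1) B' c(2)] flip: assoc_mult_mat[OF c(1) B' c(2)])
  qed
qed

lemma pullback_rep_matrix_rep: "matrix_rep V \<Longrightarrow> matrix_rep (pullback_rep \<phi> V)"
  unfolding matrix_rep_def[of "pullback_rep \<phi> V"]
  by (simp add: pullback_rep_def eval_term_carrier)

lemma pullback_rep_intertwines:
  "matrix_rep V \<Longrightarrow> matrix_rep W \<Longrightarrow> intertwines V W B \<Longrightarrow>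
    intertwines (pullback_rep \<phi> V) (pullback_rep \<phi> W) B"
  using eval_term_intertwines[of V W B] by (simp add: intertwines_def pullback_rep_def)

lemma eval_map_alg_term:
  "eval_term V (map_alg_term f t) = eval_term (Rep (rdim V) (\<lambda>g. act V (f g))) t"
  by (induction t) auto


section \<open>Horizontal concatenation of matrices\<close>

text \<open>The lower half consists of zero rows. In this encoding the recursion runs parallel to
  that of \<open>diag_block_mat\<close>, and the rules for multiplying block matrices apply.\<close>

fun hcat :: "nat \<Rightarrow> complex mat list \<Rightarrow> complex mat" where
  "hcat n [] = 0\<^sub>m n 0"
| "hcat n (B # Bs) =
     four_block_mat B (hcat n Bs) (0\<^sub>m 0 (dim_col B)) (0\<^sub>m 0 (dim_col (hcat n Bs)))"

lemma hcat_carrier: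
  "(\<And>x. x \<in> set xs \<Longrightarrow> B x \<in> carrier_mat n (d x)) \<Longrightarrow>
    hcat n (map B xs) \<in> carrier_mat n (sum_list (map d xs))"
proof (induction xs)
  case (Cons x xs)
  hence "hcat n (map B xs) \<in> carrier_mat n (sum_list (map d xs))" "B x \<in> carrier_mat n (d x)"
    by auto
  thus ?case by (auto intro!: four_block_carrier_mat[of _ n "d x" _ 0])
qed auto

lemma mult_hcat:
  assumes A: "A \<in> carrier_mat n n"
    and B: "\<And>x. x \<in> set xs \<Longrightarrow> B x \<in> carrier_mat n (d x)"
    and W: "\<And>x. x \<in> set xs \<Longrightarrow> W x \<in> carrier_mat (d x) (d x)"
    and AB: "\<And>x. x \<in> set xs \<Longrightarrow> A * B x = B x * W x"
  shows "A * hcat n (map B xs) = hcat n (map B xs) * diag_block_mat (map W xs)"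
  using B W AB
proof (induction xs)
  case Nil
  thus ?case using A by (auto intro!: eq_matI)
next
  case (Cons x xs)
  define m where "m = sum_list (map d xs)"
  define H where "H = hcat n (map B xs)"
  define D where "D = diag_block_mat (map W xs)"
  have H: "H \<in> carrier_mat n m"
    unfolding H_def m_def using Cons.prems(1) by (intro hcat_carrier) auto
  have dims: "map dim_row (map W xs) = map d xs" "map dim_col (map W xs) = map d xs"
    using carrier_matD[OF Cons.prems(2)] by simp_all
  have D: "D \<in> carrier_mat m m"
    unfolding D_def m_def by (intro carrier_matI) (simp_all only: dim_diag_block_mat dims)
  have Bx: "B x \<in> carrier_mat n (d x)" and Wx: "W x \<in> carrier_mat (d x) (d x)"
    and ABx: "A * B x = B x * W x" using Cons.prems by auto
  have IH: "A * H = H * D" unfolding H_def D_def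
    by (rule Cons.IH) (use Cons.prems in auto)
  \<comment> \<open>\<open>A\<close> is padded with empty blocks to make block multiplication
    applicable.\<close>
  have A': "A = four_block_mat A (0\<^sub>m n 0) (0\<^sub>m 0 n) (0\<^sub>m 0 0)"
    using A by (auto intro!: eq_matI)
  have h: "hcat n (map B (x # xs)) = four_block_mat (B x) H (0\<^sub>m 0 (d x)) (0\<^sub>m 0 m)"
    using Bx H by (simp add: H_def)
  have dd: "diag_block_mat (map W (x # xs)) = four_block_mat (W x) (0\<^sub>m (d x) m) (0\<^sub>m m (d x)) D"
    using Wx D by (simp add: D_def Let_def)
  have "A * hcat n (map B (x # xs)) =
      four_block_mat A (0\<^sub>m n 0) (0\<^sub>m 0 n) (0\<^sub>m 0 0) * four_block_mat (B x) H (0\<^sub>m 0 (d x)) (0\<^sub>m 0 m)"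
    unfolding h using A' by simp
  also have "\<dots> = four_block_mat (A * B x) (A * H) (0\<^sub>m 0 (d x)) (0\<^sub>m 0 m)"
    using A Bx H by (subst mult_four_block_mat) (auto intro!: cong_four_block_mat)
  also have "\<dots> = four_block_mat (B x * W x) (H * D) (0\<^sub>m 0 (d x)) (0\<^sub>m 0 m)"
    unfolding ABx IH ..
  also have "\<dots> = four_block_mat (B x) H (0\<^sub>m 0 (d x)) (0\<^sub>m 0 m) *
      four_block_mat (W x) (0\<^sub>m (d x) m) (0\<^sub>m m (d x)) D"
    using A Bx H Wx D by (subst mult_four_block_mat) (auto intro!: cong_four_block_mat)
  finally show ?case unfolding h dd .
qed

lemma col_hcat:
  assumes "\<And>x. x \<in> set xs \<Longrightarrow> B x \<in> carrier_mat n (d x)" "c < sum_list (map d xs)"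
  shows "\<exists>x \<in> set xs. \<exists>c' < d x. col (hcat n (map B xs)) c = col (B x) c'"
  using assms
proof (induction xs arbitrary: c)
  case (Cons x xs)
  define m where "m = sum_list (map d xs)"
  define H where "H = hcat n (map B xs)"
  have H: "H \<in> carrier_mat n m"
    unfolding H_def m_def using Cons.prems(1) by (intro hcat_carrier) auto
  have Bx: "B x \<in> carrier_mat n (d x)" using Cons.prems by auto
  have h: "hcat n (map B (x # xs)) = four_block_mat (B x) H (0\<^sub>m 0 (d x)) (0\<^sub>m 0 m)"
    using Bx H by (simp add: H_def)
  show ?case
  proof (cases "c < d x")
    case True
    have "col (hcat n (map B (x # xs))) c = col (B x) c"
      unfolding h using True Bx H by (intro eq_vecI) auto
    thus ?thesis using True by auto
  next
    case False
    hence c: "c - d x < m" using Cons.prems(2) by (auto simp: m_def)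
    have "col (hcat n (map B (x # xs))) c = col H (c - d x)"
      unfolding h using False c Bx H by (intro eq_vecI) auto
    moreover obtain y c' where "y \<in> set xs" "c' < d y" "col H (c - d x) = col (B y) c'"
      using Cons.IH[of "c - d x"] Cons.prems(1) c unfolding H_def m_def by auto
    ultimately show ?thesis by auto
  qed
qed auto

text \<open>The coordinate vector is cut into one piece \<open>y x\<close> per block. Distinct
  labels allow the pieces to be indexed by them, and the entrywise form replaces a sum of vectors by
  a sum over a set.\<close>

lemma hcat_mult_vec:
  assumes "distinct xs" "\<And>x. x \<in> set xs \<Longrightarrow> B x \<in> carrier_mat n (d x)"
    "v \<in> carrier_vec (sum_list (map d xs))"
  shows "\<exists>y. (\<forall>x \<in> set xs. y x \<in> carrier_vec (d x)) \<and>
    (\<forall>r<n. (hcat n (map B xs) *\<^sub>v v) $ r = (\<Sum>x \<in> set xs. (B x *\<^sub>v y x) $ r)) \<and>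
    ((\<forall>x \<in> set xs. y x = 0\<^sub>v (d x)) \<longrightarrow> v = 0\<^sub>v (sum_list (map d xs)))"
  using assms
proof (induction xs arbitrary: v)
  case Nil
  thus ?case by (auto simp: scalar_prod_def)
next
  case (Cons x xs)
  define m where "m = sum_list (map d xs)"
  define H where "H = hcat n (map B xs)"
  have H: "H \<in> carrier_mat n m"
    unfolding H_def m_def using Cons.prems(2) by (intro hcat_carrier) auto
  have Bx: "B x \<in> carrier_mat n (d x)" using Cons.prems by auto
  have h: "hcat n (map B (x # xs)) = four_block_mat (B x) H (0\<^sub>m 0 (d x)) (0\<^sub>m 0 m)"
    using Bx H by (simp add: H_def)
  define a where "a = vec_first v (d x)"
  define b where "b = vec_last v m"
  have v: "v = a @\<^sub>v b"
    using Cons.prems(3) unfolding a_def b_def m_def by (simp add: vec_first_last_append)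
  have a: "a \<in> carrier_vec (d x)" and b: "b \<in> carrier_vec m" by (auto simp: a_def b_def)
  have mv: "hcat n (map B (x # xs)) *\<^sub>v v = (B x *\<^sub>v a + H *\<^sub>v b) @\<^sub>v (0\<^sub>m 0 (d x) *\<^sub>v a + 0\<^sub>m 0 m *\<^sub>v b)"
    unfolding h v by (rule four_block_mat_mult_vec[OF Bx H _ _ a b]) auto
  obtain y where y: "\<forall>x \<in> set xs. y x \<in> carrier_vec (d x)"
    "\<forall>r<n. (H *\<^sub>v b) $ r = (\<Sum>x \<in> set xs. (B x *\<^sub>v y x) $ r)"
    "(\<forall>x \<in> set xs. y x = 0\<^sub>v (d x)) \<longrightarrow> b = 0\<^sub>v m"
    using Cons.IH[of b] Cons.prems b unfolding H_def m_def by auto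
  define y' where "y' = y(x := a)"
  have "x \<notin> set xs" using Cons.prems by auto
  hence sum: "(\<Sum>z \<in> set xs. (B z *\<^sub>v y' z) $ r) = (\<Sum>z \<in> set xs. (B z *\<^sub>v y z) $ r)" for r
    by (intro sum.cong) (auto simp: y'_def)
  have "\<forall>z \<in> set (x # xs). y' z \<in> carrier_vec (d z)" using y a by (auto simp: y'_def)
  moreover have "\<forall>r<n. (hcat n (map B (x # xs)) *\<^sub>v v) $ r =
      (\<Sum>z \<in> set (x # xs). (B z *\<^sub>v y' z) $ r)"
    unfolding mv using \<open>x \<notin> set xs\<close> y(2) Bx H a b sum by (simp add: y'_def[THEN fun_cong, of x])
  moreover have "(\<forall>z \<in> set (x # xs). y' z = 0\<^sub>v (d z)) \<longrightarrow> v = 0\<^sub>v (sum_list (map d (x # xs)))"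
  proof
    assume 0: "\<forall>z \<in> set (x # xs). y' z = 0\<^sub>v (d z)"
    hence "a = 0\<^sub>v (d x)" by (simp add: y'_def)
    moreover have "y z = 0\<^sub>v (d z)" if "z \<in> set xs" for z
      using 0 that \<open>x \<notin> set xs\<close> by (auto simp: y'_def split: if_splits)
    hence "b = 0\<^sub>v m" using y(3) by blast
    ultimately show "v = 0\<^sub>v (sum_list (map d (x # xs)))"
      unfolding v by (auto simp: m_def intro!: eq_vecI)
  qed
  ultimately show ?case by blast
qed


section \<open>Eigenvectors and inverses\<close>

lemma mult_mat_diag_vec:
  fixes v :: "complex vec"
  assumes "v \<in> carrier_vec n" "i < n"
  shows "(mat_diag n f *\<^sub>v v) $ i = f i * v $ i"
proof -
  have "(mat_diag n f *\<^sub>v v) $ i = (\<Sum>r<n. if r = i then f r * v $ r else 0)"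
    unfolding index_mult_mat_vec_sum[OF mat_diag_dim assms]
    using assms(2) by (intro sum.cong) (auto simp: mat_diag_def)
  thus ?thesis using assms by simp
qed

text \<open>Applying \<open>Z - z k\<close> to the vanishing sum removes the term \<open>k\<close>
  and multiplies every other term by the nonzero factor \<open>z i - z k\<close>, which leaves a
  shorter vanishing sum of eigenvectors.\<close>

lemma eigenvectors_independent:
  fixes Z :: "nat \<Rightarrow> nat \<Rightarrow> complex"
  assumes "finite I" "inj_on z I"
    and "\<And>i r. i \<in> I \<Longrightarrow> r < n \<Longrightarrow> (\<Sum>c<n. Z r c * w i c) = z i * w i r"
    and "\<And>r. r < n \<Longrightarrow> (\<Sum>i \<in> I. w i r) = 0"
  shows "\<forall>i \<in> I. \<forall>r<n. w i r = 0"
  using assms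
proof (induction I arbitrary: w rule: finite_induct)
  case (insert k I)
  define w' where "w' = (\<lambda>i r. (z i - z k) * w i r)"
  have "\<forall>i \<in> I. \<forall>r<n. w' i r = 0"
  proof (rule insert.IH)
    show "inj_on z I" using insert.prems by auto
    show "(\<Sum>c<n. Z r c * w' i c) = z i * w' i r" if "i \<in> I" "r < n" for i r
    proof -
      have "(\<Sum>c<n. Z r c * w' i c) = (z i - z k) * (\<Sum>c<n. Z r c * w i c)"
        by (simp add: w'_def sum_distrib_left mult_ac)
      thus ?thesis using insert.prems(2)[of i r] that by (simp add: w'_def)
    qed
    show "(\<Sum>i \<in> I. w' i r) = 0" if r: "r < n" for r
    proof -
      have "(\<Sum>i \<in> insert k I. z i * w i r) = (\<Sum>i \<in> insert k I. \<Sum>c<n. Z r c * w i c)"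
        using insert.prems(2) r by (intro sum.cong) auto
      also have "\<dots> = (\<Sum>c<n. Z r c * (\<Sum>i \<in> insert k I. w i c))"
        by (subst sum.swap) (simp add: sum_distrib_left)
      also have "\<dots> = 0" using insert.prems(3) by simp
      finally have 1: "(\<Sum>i \<in> insert k I. z i * w i r) = 0" .
      have "(\<Sum>i \<in> insert k I. (z i - z k) * w i r) =
          (\<Sum>i \<in> insert k I. z i * w i r) - z k * (\<Sum>i \<in> insert k I. w i r)"
        by (simp only: left_diff_distrib sum_subtractf sum_distrib_left)
      also have "\<dots> = 0" using 1 insert.prems(3)[OF r] by simp
      finally show ?thesis using insert.hyps by (simp add: w'_def)
    qed
  qed
  moreover have "z i \<noteq> z k" if "i \<in> I" for i
    using insert.prems(1) insert.hyps(2) that by (auto simp: inj_on_def)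
  ultimately have I: "\<forall>i \<in> I. \<forall>r<n. w i r = 0" by (auto simp: w'_def)
  have "w k r = 0" if "r < n" for r
    using insert.prems(3)[OF that] I insert.hyps that by simp
  with I show ?case by auto
qed auto

lemma injective_mat_inverse:
  fixes A :: "complex mat"
  assumes A: "A \<in> carrier_mat n n"
    and inj: "\<And>v. v \<in> carrier_vec n \<Longrightarrow> A *\<^sub>v v = 0\<^sub>v n \<Longrightarrow> v = 0\<^sub>v n"
  obtains B where "B \<in> carrier_mat n n" "A * B = 1\<^sub>m n" "B * A = 1\<^sub>m n"
proof -
  have "det A \<noteq> 0" using inj det_0_iff_vec_prod_zero[OF A] by auto
  hence "A \<in> Units (ring_mat TYPE(complex) n ())" by (rule det_non_zero_imp_unit[OF A])
  with that show thesis by (auto simp: Units_def ring_mat_def)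
qed

lemma the_mat_inverse:
  fixes A :: "complex mat"
  assumes A: "A \<in> carrier_mat n n" and B: "B \<in> carrier_mat n n" and "A * B = 1\<^sub>m n" "B * A = 1\<^sub>m n"
  shows "the (mat_inverse A) = B"
proof -
  have "A \<in> Units (ring_mat TYPE(complex) n ())"
    using assms by (auto simp: Units_def ring_mat_def)
  then obtain C where C: "mat_inverse A = Some C"
    using mat_inverse(1)[OF A, of "()"] by (cases "mat_inverse A") auto
  have C': "A * C = 1\<^sub>m n" "C \<in> carrier_mat n n" using mat_inverse(2)[OF A C] by auto
  have "C = (B * A) * C" using assms C' by simp
  also have "\<dots> = B * (A * C)" using assoc_mult_mat[OF B A C'(2)] by simp
  also have "\<dots> = B" using C' B by simp
  finally show ?thesis using C by simp
qed

lemma mat_inverse_mat_diag: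
  fixes f :: "nat \<Rightarrow> complex"
  assumes "\<And>i. i < n \<Longrightarrow> f i \<noteq> 0"
  shows "the (mat_inverse (mat_diag n f)) = mat_diag n (\<lambda>i. 1 / f i)"
proof (rule the_mat_inverse)
  show "mat_diag n f * mat_diag n (\<lambda>i. 1 / f i) = 1\<^sub>m n"
    "mat_diag n (\<lambda>i. 1 / f i) * mat_diag n f = 1\<^sub>m n"
    unfolding mat_diag_diag using assms by (auto simp: mat_diag_def intro!: eq_matI)
qed auto

lemma mult_eigenbasis:
  fixes M Q :: "complex mat"
  assumes M: "M \<in> carrier_mat n n" and Q: "Q \<in> carrier_mat n m"
    and ev: "\<And>c. c < m \<Longrightarrow> M *\<^sub>v col Q c = f c \<cdot>\<^sub>v col Q c"
  shows "M * Q = Q * mat_diag m f"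
proof (rule eq_matI)
  fix i j assume "i < dim_row (Q * mat_diag m f)" "j < dim_col (Q * mat_diag m f)"
  hence ij: "i < n" "j < m" using Q by (auto simp: mat_diag_def)
  have "(M * Q) $$ (i, j) = (M *\<^sub>v col Q j) $ i" using ij M Q by simp
  also have "\<dots> = f j * Q $$ (i, j)" using ij M Q by (subst ev) auto
  finally show "(M * Q) $$ (i, j) = (Q * mat_diag m f) $$ (i, j)"
    using ij Q by (simp add: mat_diag_mult_right[OF Q])
qed (use M Q in \<open>auto simp: mat_diag_def\<close>)

text \<open>In the coordinates given by \<open>Q\<close> the matrix is diagonal without a zero
  entry, hence injective. This serves both the operators of \<open>x_i\<close> and the
  denominators.\<close>

lemma mat_inverse_eigenbasis:
  fixes M Q :: "complex mat"
  assumes M: "M \<in> carrier_mat n n" and Q: "Q \<in> carrier_mat n n"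
    and Q': "Q' \<in> carrier_mat n n" "Q * Q' = 1\<^sub>m n" "Q' * Q = 1\<^sub>m n"
    and ev: "\<And>c. c < n \<Longrightarrow> \<exists>x. x \<noteq> 0 \<and> M *\<^sub>v col Q c = x \<cdot>\<^sub>v col Q c"
  shows "the (mat_inverse M) \<in> carrier_mat n n"
    "M * the (mat_inverse M) = 1\<^sub>m n" "the (mat_inverse M) * M = 1\<^sub>m n"
proof -
  have "\<forall>c. \<exists>x. c < n \<longrightarrow> x \<noteq> 0 \<and> M *\<^sub>v col Q c = x \<cdot>\<^sub>v col Q c" using ev by auto
  then obtain f where f: "\<And>c. c < n \<Longrightarrow> f c \<noteq> 0 \<and> M *\<^sub>v col Q c = f c \<cdot>\<^sub>v col Q c" by metis
  have MQ: "M * Q = Q * mat_diag n f" using f by (intro mult_eigenbasis[OF M Q]) auto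
  obtain N where N: "N \<in> carrier_mat n n" "M * N = 1\<^sub>m n" "N * M = 1\<^sub>m n"
  proof (rule injective_mat_inverse[OF M])
    fix v assume v: "v \<in> carrier_vec n" and 0: "M *\<^sub>v v = 0\<^sub>v n"
    define u where "u = Q' *\<^sub>v v"
    have u: "u \<in> carrier_vec n" using Q' v by (auto simp: u_def)
    have Qu: "Q *\<^sub>v u = v" using Q Q' v by (simp add: u_def flip: assoc_mult_mat_vec[of _ n n _ n])
    have "mat_diag n f *\<^sub>v u = (Q' * (Q * mat_diag n f)) *\<^sub>v u"
      using Q Q' assoc_mult_mat[of Q' n n Q n "mat_diag n f" n] left_mult_one_mat[of "mat_diag n f" n n]
      by simp
    also have "\<dots> = Q' *\<^sub>v (M *\<^sub>v (Q *\<^sub>v u))"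
      unfolding MQ[symmetric] using M Q Q' u by (simp add: assoc_mult_mat_vec[of _ n n _ n])
    also have "\<dots> = 0\<^sub>v n" using Qu 0 Q' by (auto intro!: eq_vecI)
    finally have D: "mat_diag n f *\<^sub>v u = 0\<^sub>v n" .
    have "u $ i = 0" if i: "i < n" for i
      using mult_mat_diag_vec[OF u i, of f] D f[OF i] i by simp
    hence "u = 0\<^sub>v n" using u by (intro eq_vecI) auto
    thus "v = 0\<^sub>v n" using Qu Q by (auto intro!: eq_vecI)
  qed auto
  have "the (mat_inverse M) = N" by (rule the_mat_inverse[OF M N])
  thus "the (mat_inverse M) \<in> carrier_mat n n"
    "M * the (mat_inverse M) = 1\<^sub>m n" "the (mat_inverse M) * M = 1\<^sub>m n" using N by auto
qed

lemma inverse_intertwines: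
  fixes M :: "complex mat"
  assumes M: "M \<in> carrier_mat n n" "M' \<in> carrier_mat n n" "M' * M = 1\<^sub>m n"
    and N: "N \<in> carrier_mat m m" "N' \<in> carrier_mat m m" "N * N' = 1\<^sub>m m"
    and B: "B \<in> carrier_mat n m" "M * B = B * N"
  shows "M' * B = B * N'"
proof -
  have "M' * B = M' * (B * (N * N'))" using M N B by simp
  also have "\<dots> = M' * (M * B * N')" using M N B by (simp add: assoc_mult_mat[of B n m N m N' m])
  also have "\<dots> = (M' * M) * (B * N')"
    using assoc_mult_mat[OF M(1) B(1) N(2)] assoc_mult_mat[OF M(2) M(1), of "B * N'" m] N B by simp
  also have "\<dots> = B * N'" using M N B by simp
  finally show ?thesis .
qed


section \<open>Powers of \<open>q\<close> and the Casimir roots\<close>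

text \<open>From here on spins and weights are doubled: a natural number \<open>n\<close> stands for the spin \<open>n / 2\<close>, and
  half-integral powers of \<open>q\<close> are integral powers of \<open>p\<close>.\<close>

locale generic_q =
  fixes p :: complex
  assumes p_nonzero [simp]: "p \<noteq> 0"
    and p_power_ne_1: "n > 0 \<Longrightarrow> p ^ n \<noteq> 1"
begin

lemma powi_eq_1_iff: "p powi z = 1 \<longleftrightarrow> z = 0"
proof
  assume 1: "p powi z = 1"
  have "p ^ nat \<bar>z\<bar> = 1"
  proof (cases "z \<ge> 0")
    case True
    thus ?thesis using 1 by (simp add: power_int_def)
  next
    case False
    hence "p powi (- z) = 1" using 1 by (simp add: power_int_minus)
    thus ?thesis using False by (simp add: power_int_def)
  qed
  thus "z = 0" using p_power_ne_1[of "nat \<bar>z\<bar>"] by (cases "z = 0") auto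
qed auto

lemma powi_eq_iff: "p powi a = p powi b \<longleftrightarrow> a = b"
proof
  assume "p powi a = p powi b"
  hence "p powi (a - b) = 1" by (simp add: power_int_diff)
  thus "a = b" by (simp add: powi_eq_1_iff)
qed auto

text \<open>If the sum vanished, squaring would give \<open>p powi (2 * a) = p powi (2 * b)\<close>,
  hence \<open>a = b\<close> and \<open>2 * p powi a = 0\<close>. All denominators in
  \<open>phi\<close> have eigenvalues of this form.\<close>

lemma powi_add_powi_nonzero: "p powi a + p powi b \<noteq> 0"
proof
  assume 0: "p powi a + p powi b = 0"
  hence "p powi a = - (p powi b)" by (simp add: eq_neg_iff_add_eq_0)
  hence "(p powi a) ^ 2 = (p powi b) ^ 2" by simp
  hence "p powi (2 * a) = p powi (2 * b)" by (simp add: power_int_mult mult.commute)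
  hence "a = b" by (simp add: powi_eq_iff)
  thus False using 0 by simp
qed

definition q :: complex where "q = p ^ 2"

lemma q_nonzero [simp]: "q \<noteq> 0" by (simp add: q_def)

lemma powi_even: "p powi (2 * z) = q powi z"
  by (simp add: q_def power_int_mult)

lemma q_powi_eq_iff: "q powi a = q powi b \<longleftrightarrow> a = b"
  unfolding powi_even[symmetric] powi_eq_iff by simp

lemma q_powi_double: "q powi (2 * z) = q powi z * q powi z"
  using power_int_add[of q z z] by (simp flip: mult_2)

lemma qpow_of_int: "qpow p (of_int z) = q powi z"
proof -
  have "2 * (of_int z :: rat) = of_int (2 * z)" by simp
  thus ?thesis unfolding qpow_def powi_even[symmetric] by (simp only: floor_of_int)
qed

lemma qpow_1 [simp]: "qpow p 1 = q" "qpow p (- 1) = inverse q"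
  using qpow_of_int[of 1] qpow_of_int[of "- 1"] by (simp_all add: power_int_minus)

lemma qpow_half: "qpow p (of_int z / 2) = p powi z"
  unfolding qpow_def by simp

definition qd :: complex where "qd = q - inverse q"

lemma qd_nonzero [simp]: "qd \<noteq> 0"
  using q_powi_eq_iff[of 1 "- 1"] by (simp add: qd_def power_int_minus)

definition qn :: "int \<Rightarrow> complex" where "qn z = (q powi z - q powi (- z)) / qd"

lemma qnum_of_int: "qnum p (of_int z) = qn z"
  using qpow_of_int[of z] qpow_of_int[of "- z"] by (simp add: qnum_def qn_def qd_def)

lemma qn_0 [simp]: "qn 0 = 0" by (simp add: qn_def)

lemma qn_eq_0_iff: "qn z = 0 \<longleftrightarrow> z = 0"
  by (simp add: qn_def q_powi_eq_iff)

lemma qn_minus: "qn (- z) = - qn z"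
  by (simp add: qn_def field_simps)

text \<open>This is the relation for \<open>[e, f]\<close> on the basis vector with index
  \<open>i\<close> in the representation of spin \<open>n / 2\<close>. With \<open>q powi i\<close>
  and \<open>q powi n\<close> as independent variables it is an identity of rational
  functions.\<close>

lemma qn_commutator: "qn (n - i + 1) * qn i - qn (i + 1) * qn (n - i) = qn (2 * i - n)"
proof -
  define U V where "U = q powi i" and "V = q powi n"
  have nz: "U \<noteq> 0" "V \<noteq> 0" "q \<noteq> 0" by (simp_all add: U_def V_def)
  have e: "q powi (n - i + 1) = V * q / U" "q powi (- (n - i + 1)) = U / (V * q)"
    "q powi (i + 1) = U * q" "q powi (- (i + 1)) = 1 / (U * q)"
    "q powi (n - i) = V / U" "q powi (- (n - i)) = U / V"
    "q powi i = U" "q powi (- i) = 1 / U"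
    "q powi (2 * i - n) = U ^ 2 / V" "q powi (- (2 * i - n)) = V / U ^ 2"
    by (simp_all add: U_def V_def power_int_add power_int_diff power_int_minus power2_eq_square
        q_powi_double divide_simps)
  have 1: "(V * q / U - U / (V * q)) * (U - 1 / U) - (U * q - 1 / (U * q)) * (V / U - U / V) =
      qd * (U ^ 2 / V - V / U ^ 2)"
    unfolding qd_def using nz by (simp add: field_simps eval_nat_numeral)
  have "a / qd * (b / qd) - c / qd * (d / qd) = t / qd" if "a * b - c * d = qd * t" for a b c d t
  proof -
    have "a / qd * (b / qd) - c / qd * (d / qd) = (a * b - c * d) / (qd * qd)"
      by (simp add: diff_divide_distrib)
    thus ?thesis using that by simp
  qed
  from this[OF 1] show ?thesis unfolding qn_def e .
qed

definition cas :: "int \<Rightarrow> complex" where "cas n = (q powi (n + 1) + q powi (- n - 1)) / qd ^ 2"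

text \<open>\<open>x + 1/x\<close> takes each value only at \<open>x\<close> and \<open>1/x\<close>,
  and the second case would make a positive power of \<open>q\<close> equal to 1. The restriction to
  naturals matters: \<open>cas\<close> is invariant under \<open>n\<close> to
  \<open>- n - 2\<close>.\<close>

lemma cas_eq_iff: "cas (int m) = cas (int n) \<longleftrightarrow> m = n"
proof
  assume "cas (int m) = cas (int n)"
  hence "q powi (int m + 1) + inverse (q powi (int m + 1)) =
      q powi (int n + 1) + inverse (q powi (int n + 1))"
    unfolding cas_def power_int_minus[symmetric] by simp
  moreover have "q powi (int m + 1) \<noteq> 0" "q powi (int n + 1) \<noteq> 0" by simp_all
  moreover have "x = y \<or> x * y = 1" if "x + inverse x = y + inverse y" "x \<noteq> 0" "y \<noteq> 0" for x y :: complex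
  proof -
    have "(x - y) * (x * y - 1) = 0" using that by (simp add: field_simps) algebra
    thus ?thesis by simp
  qed
  ultimately consider "q powi (int m + 1) = q powi (int n + 1)"
    | "q powi (int m + 1) * q powi (int n + 1) = 1" by blast
  thus "m = n"
  proof cases
    case 2
    hence "q powi (int m + 1 + (int n + 1)) = q powi 0" by (subst power_int_add) auto
    thus ?thesis by (simp only: q_powi_eq_iff)
  qed (simp add: q_powi_eq_iff)
qed auto

text \<open>An eigenbasis whose eigenvalues are all of Casimir type makes the definite description
  in \<open>casimir_root\<close> meaningful; existence comes from conjugating a diagonal matrix by
  \<open>Q\<close>.\<close>

lemma casimir_root_eigenvector:
  assumes C: "C \<in> carrier_mat N N" and Q: "Q \<in> carrier_mat N N"
    and Q': "Q' \<in> carrier_mat N N" "Q * Q' = 1\<^sub>m N" "Q' * Q = 1\<^sub>m N"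
    and ev: "\<And>c. c < N \<Longrightarrow> \<exists>n. C *\<^sub>v col Q c = cas (int n) \<cdot>\<^sub>v col Q c"
  shows "casimir_root p N C \<in> carrier_mat N N"
    and "v \<in> carrier_vec N \<Longrightarrow> C *\<^sub>v v = cas (int n) \<cdot>\<^sub>v v \<Longrightarrow>
      casimir_root p N C *\<^sub>v v = p powi (- int n) \<cdot>\<^sub>v v"
proof -
  define good where "good A \<longleftrightarrow> A \<in> carrier_mat N N \<and>
     (\<forall>k \<in> half_nats. \<forall>v \<in> carrier_vec N.
        C *\<^sub>v v = ((qpow p (2 * k + 1) + qpow p (- 2 * k - 1)) / (qpow p 1 - qpow p (- 1)) ^ 2) \<cdot>\<^sub>v v
        \<longrightarrow> A *\<^sub>v v = qpow p (- k) \<cdot>\<^sub>v v)" for A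
  have half: "qpow p (- (of_nat n / 2)) = p powi (- int n)" for n
    using qpow_half[of "- int n"] by simp
  have good_iff: "good A \<longleftrightarrow> A \<in> carrier_mat N N \<and> (\<forall>n. \<forall>v \<in> carrier_vec N.
      C *\<^sub>v v = cas (int n) \<cdot>\<^sub>v v \<longrightarrow> A *\<^sub>v v = p powi (- int n) \<cdot>\<^sub>v v)" for A
  proof -
    have h: "half_nats = range (\<lambda>n. of_nat n / 2)" by (auto simp: half_nats_def)
    have "qpow p (of_nat n + 1) = q powi (int n + 1)"
      "qpow p (- of_nat n - 1) = q powi (- int n - 1)" for n
      using qpow_of_int[of "int n + 1"] qpow_of_int[of "- int n - 1"] by simp_all
    thus ?thesis unfolding good_def h by (simp add: cas_def qd_def half)
  qed
  have "\<forall>c. \<exists>n. c < N \<longrightarrow> C *\<^sub>v col Q c = cas (int n) \<cdot>\<^sub>v col Q c" using ev by blast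
  then obtain f where f: "\<And>c. c < N \<Longrightarrow> C *\<^sub>v col Q c = cas (int (f c)) \<cdot>\<^sub>v col Q c" by metis
  have CQ: "C * Q = Q * mat_diag N (\<lambda>c. cas (int (f c)))" by (rule mult_eigenbasis[OF C Q f])
  define X where "X = mat_diag N (\<lambda>c. p powi (- int (f c)))"
  define A where "A = Q * X * Q'"
  have X: "X \<in> carrier_mat N N" and A: "A \<in> carrier_mat N N" using Q Q' by (auto simp: A_def X_def)
  have "good A"
    unfolding good_iff
  proof (intro conjI allI ballI impI A)
    fix n v assume v: "v \<in> carrier_vec N" and Cv: "C *\<^sub>v v = cas (int n) \<cdot>\<^sub>v v"
    \<comment> \<open>The eigenvector \<open>v\<close> need not be a column of \<open>Q\<close>. Its
      coordinates \<open>u\<close> live only on columns with label \<open>n\<close>, because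
      \<open>cas\<close> is injective on labels.\<close>
    define u where "u = Q' *\<^sub>v v"
    have u: "u \<in> carrier_vec N" using Q' v by (auto simp: u_def)
    have Qu: "Q *\<^sub>v u = v" using Q Q' v by (simp add: u_def flip: assoc_mult_mat_vec[of _ N N _ N])
    let ?D = "mat_diag N (\<lambda>c. cas (int (f c)))"
    have "?D *\<^sub>v u = (Q' * (Q * ?D)) *\<^sub>v u"
      using Q Q' assoc_mult_mat[of Q' N N Q N ?D N] left_mult_one_mat[of ?D N N] by simp
    also have "\<dots> = Q' *\<^sub>v (C *\<^sub>v (Q *\<^sub>v u))"
      unfolding CQ[symmetric] using C Q Q' u by (simp add: assoc_mult_mat_vec[of _ N N _ N])
    also have "\<dots> = cas (int n) \<cdot>\<^sub>v u"
      using Qu Cv Q' v by (simp add: u_def mult_mat_vec[of _ N N])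
    finally have D: "?D *\<^sub>v u = cas (int n) \<cdot>\<^sub>v u" .
    have "X *\<^sub>v u = p powi (- int n) \<cdot>\<^sub>v u"
    proof (rule eq_vecI)
      fix i assume "i < dim_vec (p powi (- int n) \<cdot>\<^sub>v u)"
      hence i: "i < N" using u by simp
      have "cas (int n) * u $ i = cas (int (f i)) * u $ i"
        using mult_mat_diag_vec[OF u i, of "\<lambda>c. cas (int (f c))"] D i u by simp
      hence "f i = n \<or> u $ i = 0" using cas_eq_iff by auto
      thus "(X *\<^sub>v u) $ i = (p powi (- int n) \<cdot>\<^sub>v u) $ i"
        using mult_mat_diag_vec[OF u i] i u by (auto simp: X_def)
    qed (use u X in auto)
    hence "Q *\<^sub>v (X *\<^sub>v u) = p powi (- int n) \<cdot>\<^sub>v v"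
      using Q u Qu by (simp add: mult_mat_vec[of _ N N])
    thus "A *\<^sub>v v = p powi (- int n) \<cdot>\<^sub>v v"
      using Q Q' X v by (simp add: A_def u_def assoc_mult_mat_vec[of _ N N _ N])
  qed
  \<comment> \<open>A matrix with the defining property is prescribed on every column of
    \<open>Q\<close>, hence on the whole space.\<close>
  moreover have "A1 = A" if "good A1" for A1
  proof -
    have A1: "A1 \<in> carrier_mat N N" using that good_iff by auto
    have "A1 * Q = Q * X" if "good A1" "A1 \<in> carrier_mat N N" for A1
      unfolding X_def
    proof (rule mult_eigenbasis[OF that(2) Q])
      fix c assume c: "c < N"
      have "col Q c \<in> carrier_vec N" using Q c by auto
      thus "A1 *\<^sub>v col Q c = p powi (- int (f c)) \<cdot>\<^sub>v col Q c"
        using that(1) f[OF c] unfolding good_iff by blast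
    qed
    hence "A1 * Q = Q * X" using that A1 by blast
    hence "A1 * Q * Q' = A" by (simp add: A_def)
    thus ?thesis using A1 Q Q' by simp
  qed
  ultimately have "good (THE A. good A)" by (metis the_equality)
  moreover have "(THE A. good A) = casimir_root p N C"
    unfolding casimir_root_def good_def ..
  ultimately have "good (casimir_root p N C)" by simp
  thus "casimir_root p N C \<in> carrier_mat N N"
    "v \<in> carrier_vec N \<Longrightarrow> C *\<^sub>v v = cas (int n) \<cdot>\<^sub>v v \<Longrightarrow>
      casimir_root p N C *\<^sub>v v = p powi (- int n) \<cdot>\<^sub>v v"
    unfolding good_iff by auto
qed


section \<open>The representations \<open>T\<^sub>l\<close> and their tensor products\<close>

definition Emat :: "nat \<Rightarrow> complex mat" where
  "Emat n = mat (n + 1) (n + 1) (\<lambda>(i, k). if i = k + 1 then qn (int n - int k) else 0)"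
definition Fmat :: "nat \<Rightarrow> complex mat" where
  "Fmat n = mat (n + 1) (n + 1) (\<lambda>(i, k). if k = i + 1 then qn (int k) else 0)"
definition Kmat :: "nat \<Rightarrow> complex mat" where
  "Kmat n = mat_diag (n + 1) (\<lambda>k. p powi (2 * int k - int n))"
definition Lmat :: "nat \<Rightarrow> complex mat" where
  "Lmat n = mat_diag (n + 1) (\<lambda>k. p powi (int n - 2 * int k))"

definition Tmat :: "nat \<Rightarrow> sl2_gen \<Rightarrow> complex mat" where
  "Tmat n g = (case g of E_gen \<Rightarrow> Emat n | F_gen \<Rightarrow> Fmat n | K_gen \<Rightarrow> Kmat n | Kinv_gen \<Rightarrow> Lmat n)"

lemma Tmat_simps [simp]:
  "Tmat n E_gen = Emat n" "Tmat n F_gen = Fmat n" "Tmat n K_gen = Kmat n" "Tmat n Kinv_gen = Lmat n"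
  by (simp_all add: Tmat_def)

lemma Tmat_carrier [simp]:
  "Emat n \<in> carrier_mat (Suc n) (Suc n)" "Fmat n \<in> carrier_mat (Suc n) (Suc n)"
  "Kmat n \<in> carrier_mat (Suc n) (Suc n)" "Lmat n \<in> carrier_mat (Suc n) (Suc n)"
  "Tmat n g \<in> carrier_mat (Suc n) (Suc n)"
  by (cases g; simp add: Emat_def Fmat_def Kmat_def Lmat_def mat_diag_def)+

lemma T_rep_half: "T_rep p (of_nat n / 2) = Rep (Suc n) (Tmat n)"
proof -
  have 1: "nat \<lfloor>2 * (of_nat n / 2 :: rat)\<rfloor> + 1 = Suc n" by simp
  have E: "qnum p (of_nat n / 2 - (of_nat k - of_nat n / 2)) = qn (int n - int k)" for k
  proof -
    have "of_nat n / 2 - (of_nat k - of_nat n / 2 :: rat) = of_int (int n - int k)" by simp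
    thus ?thesis by (simp only: qnum_of_int)
  qed
  have F: "qnum p (of_nat n / 2 + (of_nat k - of_nat n / 2)) = qn (int k)" for k
    using qnum_of_int[of "int k"] by simp
  have K: "qpow p (of_nat k - of_nat n / 2) = p powi (2 * int k - int n)" for k
    using qpow_half[of "2 * int k - int n"] by (simp add: field_simps)
  have L: "qpow p (- (of_nat k - of_nat n / 2)) = p powi (int n - 2 * int k)" for k
  proof -
    have "- (of_nat k - of_nat n / 2 :: rat) = of_int (int n - 2 * int k) / 2"
      by (simp add: field_simps)
    thus ?thesis by (simp only: qpow_half)
  qed
  show ?thesis
    unfolding T_rep_def Let_def 1 E F K L
    by (auto simp: Tmat_def Emat_def Fmat_def Kmat_def Lmat_def fun_eq_iff split: sl2_gen.splits)
qed

lemma Emat_Fmat: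
  "Emat n * Fmat n = mat_diag (Suc n) (\<lambda>i. qn (int n - int i + 1) * qn (int i))"
proof (rule eq_matI)
  fix i k assume "i < dim_row (mat_diag (Suc n) (\<lambda>i. qn (int n - int i + 1) * qn (int i)))"
    "k < dim_col (mat_diag (Suc n) (\<lambda>i. qn (int n - int i + 1) * qn (int i)))"
  hence ik: "i < Suc n" "k < Suc n" by (auto simp: mat_diag_def)
  have "(Emat n * Fmat n) $$ (i, k) = (\<Sum>r<Suc n. Emat n $$ (i, r) * Fmat n $$ (r, k))"
    by (rule index_mult_mat_sum) (use ik in auto)
  also have "\<dots> = (\<Sum>r<Suc n. if r = i - 1 then
      (if i > 0 \<and> i = k then qn (int n - int i + 1) * qn (int i) else 0) else 0)"
    using ik by (intro sum.cong) (auto simp: Emat_def Fmat_def of_nat_diff)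
  also have "\<dots> = mat_diag (Suc n) (\<lambda>i. qn (int n - int i + 1) * qn (int i)) $$ (i, k)"
    using ik by (auto simp: mat_diag_def)
  finally show "(Emat n * Fmat n) $$ (i, k) =
      mat_diag (Suc n) (\<lambda>i. qn (int n - int i + 1) * qn (int i)) $$ (i, k)" .
qed (auto simp: mat_diag_def Emat_def Fmat_def)

lemma Fmat_Emat:
  "Fmat n * Emat n = mat_diag (Suc n) (\<lambda>i. qn (int i + 1) * qn (int n - int i))"
proof (rule eq_matI)
  fix i k assume "i < dim_row (mat_diag (Suc n) (\<lambda>i. qn (int i + 1) * qn (int n - int i)))"
    "k < dim_col (mat_diag (Suc n) (\<lambda>i. qn (int i + 1) * qn (int n - int i)))"
  hence ik: "i < Suc n" "k < Suc n" by (auto simp: mat_diag_def)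
  have "(Fmat n * Emat n) $$ (i, k) = (\<Sum>r<Suc n. Fmat n $$ (i, r) * Emat n $$ (r, k))"
    by (rule index_mult_mat_sum) (use ik in auto)
  also have "\<dots> = (\<Sum>r<Suc n. if r = Suc i then
      (if i = k then qn (int i + 1) * qn (int n - int i) else 0) else 0)"
    using ik by (intro sum.cong) (auto simp: Emat_def Fmat_def add.commute)
  also have "\<dots> = mat_diag (Suc n) (\<lambda>i. qn (int i + 1) * qn (int n - int i)) $$ (i, k)"
    using ik by (cases "i = n") (auto simp: mat_diag_def)
  finally show "(Fmat n * Emat n) $$ (i, k) =
      mat_diag (Suc n) (\<lambda>i. qn (int i + 1) * qn (int n - int i)) $$ (i, k)" .
qed (auto simp: mat_diag_def Emat_def Fmat_def)

lemma Kmat_Lmat: "Kmat n * Lmat n = 1\<^sub>m (Suc n)" "Lmat n * Kmat n = 1\<^sub>m (Suc n)"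
  by (simp_all add: Kmat_def Lmat_def flip: power_int_add)

lemma Kmat_Kmat: "Kmat n * Kmat n = mat_diag (Suc n) (\<lambda>i. q powi (2 * int i - int n))"
  unfolding Kmat_def mat_diag_diag
  by (simp flip: power_int_add powi_even)

lemma Lmat_Lmat: "Lmat n * Lmat n = mat_diag (Suc n) (\<lambda>i. q powi (int n - 2 * int i))"
  unfolding Lmat_def mat_diag_diag
  by (simp flip: power_int_add powi_even)

lemma Kmat_Emat: "Kmat n * Emat n = q \<cdot>\<^sub>m (Emat n * Kmat n)"
proof -
  have "p powi (2 + 2 * int k - int n) = q * p powi (2 * int k - int n)" for k
    by (simp add: q_def power_int_add power_int_diff field_simps)
  thus ?thesis
    unfolding Kmat_def Suc_eq_plus1[symmetric]
    by (subst mat_diag_mult_left[of _ _ "Suc n"], simp, subst mat_diag_mult_right[of _ "Suc n"])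
       (auto simp: Emat_def intro!: eq_matI)
qed

lemma Kmat_Fmat: "Kmat n * Fmat n = inverse q \<cdot>\<^sub>m (Fmat n * Kmat n)"
proof -
  have "p powi (2 + 2 * int k - int n) = q * p powi (2 * int k - int n)" for k
    by (simp add: q_def power_int_add power_int_diff field_simps)
  thus ?thesis
    unfolding Kmat_def Suc_eq_plus1[symmetric]
    by (subst mat_diag_mult_left[of _ _ "Suc n"], simp, subst mat_diag_mult_right[of _ "Suc n"])
       (auto simp: Fmat_def intro!: eq_matI)
qed

lemma one_smult_mat: "(1 :: complex) \<cdot>\<^sub>m A = A"
  by (intro eq_matI) auto

lemma smult_one_mat_diag: "x \<cdot>\<^sub>m 1\<^sub>m n = mat_diag n (\<lambda>_. x :: complex)"
  unfolding mat_diag_def by (intro eq_matI) auto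

lemma mat_diag_add: "mat_diag n f + mat_diag n g = mat_diag n (\<lambda>i. f i + g i :: complex)"
  unfolding mat_diag_def by (intro eq_matI) auto

lemma mat_diag_cong: "(\<And>i. i < n \<Longrightarrow> f i = g i) \<Longrightarrow> mat_diag n f = mat_diag n g"
  unfolding mat_diag_def by (intro eq_matI) auto

text \<open>The recursion of \<open>power\<close> ends in the unit, so an evaluated square carries a
  trailing identity matrix, which has to be removed separately.\<close>

lemma alg_term_power2: "t ^ 2 = Mul t (Mul t (Scal 1))"
  by (simp add: power2_eq_square numeral_2_eq_2 times_alg_term_def one_alg_term_def)

lemmas alg_term_ops = plus_alg_term_def minus_alg_term_def uminus_alg_term_def times_alg_term_def
  one_alg_term_def alg_term_power2

lemma KL_squares:
  "Kmat n * (Kmat n * (1 \<cdot>\<^sub>m 1\<^sub>m (Suc n))) = Kmat n * Kmat n"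
  "Lmat n * (Lmat n * (1 \<cdot>\<^sub>m 1\<^sub>m (Suc n))) = Lmat n * Lmat n"
  by (simp_all add: one_smult_mat right_mult_one_mat[of _ "Suc n" "Suc n"])

lemma T_rep_is_rep: "is_rep (sl2_rels p) (Rep (Suc n) (Tmat n))"
  unfolding is_rep_def
proof (intro conjI allI)
  have EF: "Emat n * Fmat n + - 1 \<cdot>\<^sub>m 1\<^sub>m (Suc n) * (Fmat n * Emat n) =
      (1 / (q - inverse q)) \<cdot>\<^sub>m 1\<^sub>m (Suc n) * (Kmat n * Kmat n + - 1 \<cdot>\<^sub>m 1\<^sub>m (Suc n) * (Lmat n * Lmat n))"
    unfolding Emat_Fmat Fmat_Emat Kmat_Kmat Lmat_Lmat smult_one_mat_diag mat_diag_diag mat_diag_add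
  proof (rule mat_diag_cong)
    fix i
    show "qn (int n - int i + 1) * qn (int i) + - 1 * (qn (int i + 1) * qn (int n - int i)) =
        1 / (q - inverse q) * (q powi (2 * int i - int n) + - 1 * q powi (int n - 2 * int i))"
      using qn_commutator[of "int n" "int i"] by (simp add: qn_def[of "2 * int i - int n"] qd_def)
  qed
  show "\<forall>(s, t)\<in>sl2_rels p. eval_term (Rep (Suc n) (Tmat n)) s = eval_term (Rep (Suc n) (Tmat n)) t"
    unfolding sl2_rels_def alg_term_ops
    by (simp add: Kmat_Lmat KL_squares EF Kmat_Emat Kmat_Fmat smult_one_mult[of _ "Suc n" "Suc n"]
        mult_smult_assoc_mat[of _ "Suc n" "Suc n" _ "Suc n"] one_smult_mat
        left_mult_one_mat[of _ "Suc n" "Suc n"] right_mult_one_mat[of _ "Suc n" "Suc n"] del: One_nat_def)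
qed auto

lemma casimir_T_rep: "eval_term (Rep (Suc n) (Tmat n)) (casimir p) = cas (int n) \<cdot>\<^sub>m 1\<^sub>m (Suc n)"
proof -
  have "eval_term (Rep (Suc n) (Tmat n)) (casimir p) =
      Emat n * Fmat n + (1 / qd ^ 2) \<cdot>\<^sub>m 1\<^sub>m (Suc n) *
        (q powi (- 1) \<cdot>\<^sub>m 1\<^sub>m (Suc n) * (Kmat n * Kmat n) + q \<cdot>\<^sub>m 1\<^sub>m (Suc n) * (Lmat n * Lmat n))"
    unfolding casimir_def alg_term_ops by (simp add: KL_squares qd_def power_int_minus)
  also have "\<dots> = cas (int n) \<cdot>\<^sub>m 1\<^sub>m (Suc n)"
    unfolding Emat_Fmat Kmat_Kmat Lmat_Lmat smult_one_mat_diag mat_diag_diag mat_diag_add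
  proof (rule mat_diag_cong)
    fix i
    define U V where "U = q powi int i" and "V = q powi int n"
    have nz: "U \<noteq> 0" "V \<noteq> 0" "q \<noteq> 0" by (simp_all add: U_def V_def)
    have e: "q powi (int n - int i + 1) = V * q / U" "q powi (- (int n - int i + 1)) = U / (V * q)"
      "q powi (int n + 1) = V * q" "q powi (- int n - 1) = 1 / (V * q)"
      "q powi int i = U" "q powi (- int i) = 1 / U" "q powi (- 1) = 1 / q"
      "q powi (2 * int i - int n) = U ^ 2 / V" "q powi (int n - 2 * int i) = V / U ^ 2"
      by (simp_all add: U_def V_def power_int_add power_int_diff power_int_minus power2_eq_square
          q_powi_double divide_simps)
    have "(V * q / U - U / (V * q)) * (U - 1 / U) + (1 / q * (U ^ 2 / V) + q * (V / U ^ 2)) =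
        V * q + 1 / (V * q)"
      using nz by (simp add: field_simps eval_nat_numeral)
    thus "qn (int n - int i + 1) * qn (int i) + 1 / qd ^ 2 *
        (q powi (- 1) * q powi (2 * int i - int n) + q * q powi (int n - 2 * int i)) = cas (int n)"
      unfolding qn_def cas_def e
      by (simp add: power2_eq_square add_divide_distrib[symmetric])
  qed
  finally show ?thesis .
qed

end

text \<open>Dimensions are kept in the form \<open>Suc n * Suc m\<close>.\<close>

declare mult_Suc [simp del] mult_Suc_right [simp del]

lemma smult_mat_mult_vec:
  fixes A :: "complex mat"
  assumes "A \<in> carrier_mat n m" "v \<in> carrier_vec m"
  shows "(x \<cdot>\<^sub>m A) *\<^sub>v v = x \<cdot>\<^sub>v (A *\<^sub>v v)"
  using assms by (intro eq_vecI) auto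

lemma kron_mult_vec:
  assumes A: "A \<in> carrier_mat n n'" and B: "B \<in> carrier_mat m m'" and v: "v \<in> carrier_vec (n' * m')"
    and ac: "a < n" "c < m"
  shows "(kron A B *\<^sub>v v) $ (a * m + c) =
    (\<Sum>a'<n'. \<Sum>c'<m'. A $$ (a, a') * B $$ (c, c') * v $ (a' * m' + c'))"
  unfolding index_mult_mat_vec_sum[OF kron_carrier[OF A B] v pair_index_less[OF ac]] sum_pair_index
  using A B ac by (intro sum.cong) (auto simp: index_kron pair_index_less)

context generic_q
begin

section \<open>The coproduct action on a product of two spin representations\<close>

definition Hmat :: "nat \<Rightarrow> complex mat" where
  "Hmat n = mat_diag (Suc n) (\<lambda>i. qn (2 * int i - int n))"

lemma Hmat_carrier [simp]: "Hmat n \<in> carrier_mat (Suc n) (Suc n)"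
  by (simp add: Hmat_def)

lemma Emat_Fmat_commutator: "Emat n * Fmat n = Fmat n * Emat n + Hmat n"
  unfolding Emat_Fmat Fmat_Emat Hmat_def mat_diag_add
  by (rule mat_diag_cong) (simp flip: qn_commutator)

definition Dmat :: "nat \<Rightarrow> nat \<Rightarrow> sl2_gen \<Rightarrow> complex mat" where
  "Dmat n m g = (case g of
       E_gen \<Rightarrow> kron (Emat n) (Kmat m) + kron (Lmat n) (Emat m)
     | F_gen \<Rightarrow> kron (Fmat n) (Kmat m) + kron (Lmat n) (Fmat m)
     | K_gen \<Rightarrow> kron (Kmat n) (Kmat m)
     | Kinv_gen \<Rightarrow> kron (Lmat n) (Lmat m))"

lemma Dmat_simps [simp]:
  "Dmat n m E_gen = kron (Emat n) (Kmat m) + kron (Lmat n) (Emat m)"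
  "Dmat n m F_gen = kron (Fmat n) (Kmat m) + kron (Lmat n) (Fmat m)"
  "Dmat n m K_gen = kron (Kmat n) (Kmat m)"
  "Dmat n m Kinv_gen = kron (Lmat n) (Lmat m)"
  by (simp_all add: Dmat_def)

lemma Dmat_carrier: "Dmat n m g \<in> carrier_mat (Suc n * Suc m) (Suc n * Suc m)"
proof -
  have k: "kron (Tmat n a) (Tmat m b) \<in> carrier_mat (Suc n * Suc m) (Suc n * Suc m)" for a b
    by (rule kron_carrier) auto
  show ?thesis
    using k[of E_gen K_gen] k[of Kinv_gen E_gen] k[of F_gen K_gen] k[of Kinv_gen F_gen]
      k[of K_gen K_gen] k[of Kinv_gen Kinv_gen]
    by (cases g) auto
qed

lemma Dmat_K_diag: "Dmat n m K_gen = mat_diag (Suc n * Suc m)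
    (\<lambda>r. p powi (2 * int (r div Suc m) - int n) * p powi (2 * int (r mod Suc m) - int m))"
  by (simp add: Kmat_def kron_mat_diag)

lemma Dmat_K_inverse: "Dmat n m Kinv_gen * Dmat n m K_gen = 1\<^sub>m (Suc n * Suc m)"
  by (simp add: kron_mult[of _ "Suc n" "Suc n" _ "Suc m" "Suc m" _ "Suc n" _ "Suc m"] Kmat_Lmat
      kron_one del: mult_Suc mult_Suc_right)

lemma Lmat_Emat: "Lmat n * Emat n = inverse q \<cdot>\<^sub>m (Emat n * Lmat n)"
proof -
  have "p powi (int n - (2 + 2 * int k)) = inverse q * p powi (int n - 2 * int k)" for k
    by (simp add: q_def power_int_add power_int_diff field_simps)
  thus ?thesis
    unfolding Lmat_def Suc_eq_plus1[symmetric]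
    by (subst mat_diag_mult_left[of _ _ "Suc n"], simp, subst mat_diag_mult_right[of _ "Suc n"])
       (auto simp: Emat_def intro!: eq_matI)
qed

lemma Lmat_Fmat: "Lmat n * Fmat n = q \<cdot>\<^sub>m (Fmat n * Lmat n)"
proof -
  have "p powi (int n - (2 + 2 * int k)) = inverse q * p powi (int n - 2 * int k)" for k
    by (simp add: q_def power_int_add power_int_diff field_simps)
  thus ?thesis
    unfolding Lmat_def Suc_eq_plus1[symmetric]
    by (subst mat_diag_mult_left[of _ _ "Suc n"], simp, subst mat_diag_mult_right[of _ "Suc n"])
       (auto simp: Fmat_def intro!: eq_matI)
qed

lemma dim_Tmat [simp]:
  "dim_row (Emat n) = Suc n" "dim_col (Emat n) = Suc n"
  "dim_row (Fmat n) = Suc n" "dim_col (Fmat n) = Suc n"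
  "dim_row (Kmat n) = Suc n" "dim_col (Kmat n) = Suc n"
  "dim_row (Lmat n) = Suc n" "dim_col (Lmat n) = Suc n"
  "dim_row (Tmat n g) = Suc n" "dim_col (Tmat n g) = Suc n"
  by (simp_all add: carrier_matD[OF Tmat_carrier(1)] carrier_matD[OF Tmat_carrier(2)]
      carrier_matD[OF Tmat_carrier(3)] carrier_matD[OF Tmat_carrier(4)] carrier_matD[OF Tmat_carrier(5)])

lemma kron_mult_dim:
  "dim_col A = dim_row C \<Longrightarrow> dim_col B = dim_row D \<Longrightarrow> kron A B * kron C D = kron (A * C) (B * D)"
  by (rule kron_mult[of A "dim_row A" "dim_row C" B "dim_row B" "dim_row D" C "dim_col C" D "dim_col D"]) auto

lemma kron_T_carrier:
  assumes "A \<in> carrier_mat (Suc n) (Suc n)" "B \<in> carrier_mat (Suc m) (Suc m)"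
  shows "kron A B \<in> carrier_mat (Suc n * Suc m) (Suc n * Suc m)"
  using assms by (rule kron_carrier)

lemma T_mult_carrier:
  "A \<in> carrier_mat (Suc n) (Suc n) \<Longrightarrow> B \<in> carrier_mat (Suc n) (Suc n) \<Longrightarrow>
    A * B \<in> carrier_mat (Suc n) (Suc n)"
  by simp

lemma Dmat_K_E: "Dmat n m K_gen * Dmat n m E_gen = q \<cdot>\<^sub>m (Dmat n m E_gen * Dmat n m K_gen)"
proof -
  let ?N = "Suc n * Suc m"
  have c: "kron (Kmat n) (Kmat m) \<in> carrier_mat ?N ?N" "kron (Emat n) (Kmat m) \<in> carrier_mat ?N ?N"
    "kron (Lmat n) (Emat m) \<in> carrier_mat ?N ?N"
    "kron (Emat n * Kmat n) (Kmat m * Kmat m) \<in> carrier_mat ?N ?N"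
    "kron (1\<^sub>m (Suc n)) (Emat m * Kmat m) \<in> carrier_mat ?N ?N"
    by (auto intro!: kron_T_carrier T_mult_carrier)
  have "Dmat n m K_gen * Dmat n m E_gen =
      kron (Kmat n * Emat n) (Kmat m * Kmat m) + kron (Kmat n * Lmat n) (Kmat m * Emat m)"
    using mult_add_distrib_mat[OF c(1,2,3)] by (simp add: kron_mult_dim)
  also have "\<dots> = q \<cdot>\<^sub>m kron (Emat n * Kmat n) (Kmat m * Kmat m) + q \<cdot>\<^sub>m kron (1\<^sub>m (Suc n)) (Emat m * Kmat m)"
    by (simp add: Kmat_Emat Kmat_Lmat kron_smult_left kron_smult_right)
  also have "\<dots> = q \<cdot>\<^sub>m (Dmat n m E_gen * Dmat n m K_gen)"
    using add_mult_distrib_mat[OF c(2,3,1)] add_smult_distrib_left_mat[OF c(4,5)]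
    by (simp add: kron_mult_dim Kmat_Lmat)
  finally show ?thesis .
qed

lemma mult_add_add_mat:
  fixes A B C D :: "complex mat"
  assumes "A \<in> carrier_mat N N" "B \<in> carrier_mat N N" "C \<in> carrier_mat N N" "D \<in> carrier_mat N N"
  shows "(A + B) * (C + D) = A * C + A * D + (B * C + B * D)"
proof -
  have "(A + B) * (C + D) = A * (C + D) + B * (C + D)"
    using assms by (intro add_mult_distrib_mat[of _ N N]) auto
  thus ?thesis using assms by (simp add: mult_add_distrib_mat[of _ N N C N D])
qed

lemma qn_add: "qn (a + b) = qn a * q powi b + q powi (- a) * qn b"
  using power_int_minus[of q "a + b"]
  by (simp add: qn_def power_int_add power_int_minus field_simps)

text \<open>The mixed terms agree in both orders: moving \<open>Lmat\<close> past
  \<open>Fmat\<close> and \<open>Kmat\<close> past \<open>Emat\<close> costs the same factor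
  \<open>q\<close>, and in the other pair both moves cost its inverse. The diagonal rest is
  assembled by the addition rule \<open>qn_add\<close>.\<close>

lemma Dmat_E_F: "Dmat n m E_gen * Dmat n m F_gen = Dmat n m F_gen * Dmat n m E_gen +
    mat_diag (Suc n * Suc m)
      (\<lambda>r. qn ((2 * int (r div Suc m) - int n) + (2 * int (r mod Suc m) - int m)))"
proof -
  let ?N = "Suc n * Suc m"
  let ?H = "mat_diag ?N (\<lambda>r. qn ((2 * int (r div Suc m) - int n) + (2 * int (r mod Suc m) - int m)))"
  let ?KK = "Kmat m * Kmat m" and ?LL = "Lmat n * Lmat n"
  have c: "kron (Emat n) (Kmat m) \<in> carrier_mat ?N ?N" "kron (Lmat n) (Emat m) \<in> carrier_mat ?N ?N"
    "kron (Fmat n) (Kmat m) \<in> carrier_mat ?N ?N" "kron (Lmat n) (Fmat m) \<in> carrier_mat ?N ?N"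
    by (auto intro!: kron_T_carrier)
  have c2: "kron (Fmat n * Emat n) ?KK \<in> carrier_mat ?N ?N" "kron (Hmat n) ?KK \<in> carrier_mat ?N ?N"
    "kron (Emat n * Lmat n) (Kmat m * Fmat m) \<in> carrier_mat ?N ?N"
    "kron (Lmat n * Fmat n) (Emat m * Kmat m) \<in> carrier_mat ?N ?N"
    "kron ?LL (Fmat m * Emat m) \<in> carrier_mat ?N ?N" "kron ?LL (Hmat m) \<in> carrier_mat ?N ?N"
    by (auto intro!: kron_T_carrier T_mult_carrier)
  have cross: "kron (Fmat n * Lmat n) (Kmat m * Emat m) = kron (Lmat n * Fmat n) (Emat m * Kmat m)"
    "kron (Lmat n * Emat n) (Fmat m * Kmat m) = kron (Emat n * Lmat n) (Kmat m * Fmat m)"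
    by (simp_all add: Lmat_Fmat Lmat_Emat Kmat_Emat Kmat_Fmat kron_smult_left kron_smult_right)
  have H: "kron (Hmat n) ?KK + kron ?LL (Hmat m) = ?H"
    unfolding Hmat_def Kmat_Kmat Lmat_Lmat kron_mat_diag mat_diag_add
    by (rule mat_diag_cong) (simp add: qn_add minus_diff_eq)
  have "Dmat n m E_gen * Dmat n m F_gen =
      kron (Emat n * Fmat n) ?KK + kron (Emat n * Lmat n) (Kmat m * Fmat m)
      + (kron (Lmat n * Fmat n) (Emat m * Kmat m) + kron ?LL (Emat m * Fmat m))"
    unfolding Dmat_simps mult_add_add_mat[OF c] by (simp add: kron_mult_dim)
  also have "kron (Emat n * Fmat n) ?KK = kron (Fmat n * Emat n) ?KK + kron (Hmat n) ?KK"
    unfolding Emat_Fmat_commutator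
    by (rule kron_add_left[of _ "Suc n" "Suc n" _ _ "Suc m" "Suc m"]) (auto intro!: T_mult_carrier)
  also have "kron ?LL (Emat m * Fmat m) = kron ?LL (Fmat m * Emat m) + kron ?LL (Hmat m)"
    unfolding Emat_Fmat_commutator
    by (rule kron_add_right[of _ "Suc n" "Suc n" _ "Suc m" "Suc m"]) (auto intro!: T_mult_carrier)
  also have "kron (Fmat n * Emat n) ?KK + kron (Hmat n) ?KK + kron (Emat n * Lmat n) (Kmat m * Fmat m)
      + (kron (Lmat n * Fmat n) (Emat m * Kmat m) + (kron ?LL (Fmat m * Emat m) + kron ?LL (Hmat m))) =
      (kron (Fmat n * Emat n) ?KK + kron (Lmat n * Fmat n) (Emat m * Kmat m)
        + (kron (Emat n * Lmat n) (Kmat m * Fmat m) + kron ?LL (Fmat m * Emat m)))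
      + (kron (Hmat n) ?KK + kron ?LL (Hmat m))"
    using carrier_matD[OF c2(1)] carrier_matD[OF c2(2)] carrier_matD[OF c2(3)]
      carrier_matD[OF c2(4)] carrier_matD[OF c2(5)] carrier_matD[OF c2(6)]
    by (intro eq_matI) (simp_all add: ac_simps)
  also have "\<dots> = Dmat n m F_gen * Dmat n m E_gen + ?H"
    unfolding H Dmat_simps mult_add_add_mat[OF c(3,4,1,2)] cross[symmetric] by (simp add: kron_mult_dim)
  finally show ?thesis .
qed

text \<open>Passage from a lowest weight vector to a copy of the representation of spin
  \<open>l / 2\<close>. Since \<open>K\<close> is diagonal with integral exponents
  \<open>\<kappa>\<close>, a weight vector is supported on the rows with its own exponent; this
  yields both the end of the chain and the separated columns.\<close>

lemma lowest_weight_intertwiner: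
  assumes E: "E \<in> carrier_mat N N" and F: "F \<in> carrier_mat N N" and L: "L \<in> carrier_mat N N"
    and K: "K = mat_diag N (\<lambda>r. p powi \<kappa> r)"
    and LK: "L * K = 1\<^sub>m N" and KE: "K * E = q \<cdot>\<^sub>m (E * K)"
    and EF: "E * F = F * E + mat_diag N (\<lambda>r. qn (\<kappa> r))"
    and v: "v \<in> carrier_vec N" "v \<noteq> 0\<^sub>v N" and Fv: "F *\<^sub>v v = 0\<^sub>v N"
    and Kv: "K *\<^sub>v v = p powi (- int l) \<cdot>\<^sub>v v"
  shows "\<exists>P \<in> carrier_mat N (Suc l). separated_columns P \<and>
    E * P = P * Emat l \<and> F * P = P * Fmat l \<and> K * P = P * Kmat l \<and> L * P = P * Lmat l"
proof -
  define w where "w = rec_nat v (\<lambda>_ u. E *\<^sub>v u)"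
  have w0: "w 0 = v" and wS: "w (Suc i) = E *\<^sub>v w i" for i by (simp_all add: w_def)
  have w: "w i \<in> carrier_vec N" for i using v E by (induction i) (auto simp: w0 wS)
  have K': "K \<in> carrier_mat N N" by (simp add: K)
  have Kw: "K *\<^sub>v w i = p powi (2 * int i - int l) \<cdot>\<^sub>v w i" for i
  proof (induction i)
    case 0
    thus ?case using Kv by (simp add: w0)
  next
    case (Suc i)
    have "K *\<^sub>v w (Suc i) = (K * E) *\<^sub>v w i" using K' E w by (simp add: wS)
    also have "\<dots> = q \<cdot>\<^sub>v (E *\<^sub>v (K *\<^sub>v w i))"
      unfolding KE using K' E w by (simp add: smult_mat_mult_vec[of _ N N] assoc_mult_mat_vec[of _ N N _ N])
    also have "\<dots> = (q * p powi (2 * int i - int l)) \<cdot>\<^sub>v w (Suc i)"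
      unfolding Suc.IH using E w by (simp add: mult_mat_vec[OF E] wS smult_smult_assoc)
    also have "q * p powi (2 * int i - int l) = p powi (2 * int (Suc i) - int l)"
      by (simp add: q_def power_int_add power_int_diff field_simps)
    finally show ?case .
  qed
  have weight: "w i $ r = 0 \<or> \<kappa> r = 2 * int i - int l" if "r < N" for i r
  proof -
    have "p powi (2 * int i - int l) * w i $ r = p powi \<kappa> r * w i $ r"
      using mult_mat_diag_vec[OF w that, of "\<lambda>r. p powi \<kappa> r" i] Kw[of i] w[of i] that by (simp add: K)
    thus ?thesis by (auto simp: powi_eq_iff)
  qed
  \<comment> \<open>Moving \<open>F\<close> past \<open>E\<close> subtracts the eigenvalue of the
    commutator, and \<open>qn_commutator\<close> gives the accumulated sum this closed form.\<close>
  have Fw: "F *\<^sub>v w (Suc i) = (qn (int i + 1) * qn (int l - int i)) \<cdot>\<^sub>v w i" for i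
  proof -
    have FE: "F *\<^sub>v w (Suc i) = E *\<^sub>v (F *\<^sub>v w i) - qn (2 * int i - int l) \<cdot>\<^sub>v w i" for i
    proof (rule eq_vecI)
      let ?H = "mat_diag N (\<lambda>r. qn (\<kappa> r))"
      fix r assume "r < dim_vec (E *\<^sub>v (F *\<^sub>v w i) - qn (2 * int i - int l) \<cdot>\<^sub>v w i)"
      hence r: "r < N" using w[of i] by simp
      have "E *\<^sub>v (F *\<^sub>v w i) = (F * E + ?H) *\<^sub>v w i"
        unfolding EF[symmetric] using E F w by (simp add: assoc_mult_mat_vec[of _ N N _ N])
      also have "\<dots> = F *\<^sub>v w (Suc i) + ?H *\<^sub>v w i"
        using E F w by (simp add: wS add_mult_distrib_mat_vec[of _ N N] assoc_mult_mat_vec[of _ N N _ N])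
      finally have "(E *\<^sub>v (F *\<^sub>v w i)) $ r = (F *\<^sub>v w (Suc i)) $ r + qn (\<kappa> r) * w i $ r"
        using r F w[of i] mult_mat_diag_vec[OF w r] by (simp add: mat_diag_def)
      moreover have "qn (\<kappa> r) * w i $ r = qn (2 * int i - int l) * w i $ r"
        using weight[OF r, of i] by auto
      ultimately show "(F *\<^sub>v w (Suc i)) $ r =
          (E *\<^sub>v (F *\<^sub>v w i) - qn (2 * int i - int l) \<cdot>\<^sub>v w i) $ r"
        using r w[of i] E by simp
    qed (use F w[of i] in auto)
    show ?thesis
    proof (induction i)
      case 0
      have 1: "qn 1 * qn (int l) = - qn (- int l)"
        using qn_commutator[of "int l" 0] by (simp add: qn_minus)
      have "E *\<^sub>v 0\<^sub>v N = 0\<^sub>v N" using E by (auto intro!: eq_vecI)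
      thus ?case unfolding FE w0 Fv using v 1 by (auto intro!: eq_vecI)
    next
      case (Suc i)
      let ?x = "qn (int i + 1) * qn (int l - int i)"
      have 1: "qn (int (Suc i) + 1) * qn (int l - int (Suc i)) = ?x - qn (2 * int (Suc i) - int l)"
        using qn_commutator[of "int l" "int (Suc i)"] by (simp add: algebra_simps)
      have "E *\<^sub>v (F *\<^sub>v w (Suc i)) = ?x \<cdot>\<^sub>v w (Suc i)"
        unfolding Suc.IH using mult_mat_vec[OF E w] by (simp add: wS)
      thus ?case unfolding FE[of "Suc i"] 1 using w[of "Suc i"]
        by (auto intro!: eq_vecI simp: left_diff_distrib)
    qed
  qed
  \<comment> \<open>Otherwise no \<open>w i\<close> vanishes, by \<open>Fw\<close>, and \<open>K\<close> has infinitely many eigenvalues.\<close>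
  have top: "w (Suc l) = 0\<^sub>v N"
  proof (rule ccontr)
    assume ne: "w (Suc l) \<noteq> 0\<^sub>v N"
    have nz: "w (Suc l + i) \<noteq> 0\<^sub>v N" for i
    proof (induction i)
      case (Suc i)
      show ?case
      proof
        assume "w (Suc l + Suc i) = 0\<^sub>v N"
        hence "F *\<^sub>v w (Suc (Suc l + i)) = 0\<^sub>v N" using F by (auto intro!: eq_vecI)
        moreover have "qn (int (Suc l + i) + 1) * qn (int l - int (Suc l + i)) \<noteq> 0"
          by (auto simp: qn_eq_0_iff)
        ultimately have "w (Suc l + i) = 0\<^sub>v N"
          using Fw[of "Suc l + i"] w[of "Suc l + i"] by (simp add: vec_eq_iff)
        with Suc show False by simp
      qed
    qed (use ne in auto)
    have "2 * int (Suc l + i) - int l \<in> \<kappa> ` {..<N}" for i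
    proof -
      obtain r where "r < N" "w (Suc l + i) $ r \<noteq> 0"
        using nz[of i] w[of "Suc l + i"] by (metis carrier_vecD eq_vecI index_zero_vec)
      hence "r < N" "\<kappa> r = 2 * int (Suc l + i) - int l" using weight by blast+
      thus ?thesis by (metis imageI lessThan_iff)
    qed
    hence "range (\<lambda>i. 2 * int (Suc l + i) - int l) \<subseteq> \<kappa> ` {..<N}" by blast
    hence "finite (range (\<lambda>i. 2 * int (Suc l + i) - int l))" by (rule finite_subset) simp
    moreover have "inj (\<lambda>i. 2 * int (Suc l + i) - int l)" by (auto simp: inj_def)
    ultimately show False using finite_imageD by blast
  qed
  \<comment> \<open>In the model, \<open>i\<close> applications of \<open>E\<close> to the basis
    vector of index 0 give \<open>c i\<close> times the basis vector of index \<open>i\<close>;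
    dividing by \<open>c i\<close> matches the two chains. \<open>c\<close> vanishes only beyond
    \<open>l\<close>, where there is no column.\<close>
  define c where "c i = (\<Prod>j<i. qn (int l - int j))" for i
  have c_nz: "c i \<noteq> 0" if "i \<le> l" for i
    using that by (auto simp: c_def qn_eq_0_iff)
  have cS: "c (Suc i) = c i * qn (int l - int i)" for i by (simp add: c_def)
  define P where "P = mat N (Suc l) (\<lambda>(r, i). w i $ r / c i)"
  have P: "P \<in> carrier_mat N (Suc l)" by (simp add: P_def)
  have MP: "(M * P) $$ (r, i) = (M *\<^sub>v w i) $ r / c i"
    if M: "M \<in> carrier_mat N N" and ri: "r < N" "i < Suc l" for M r i
    unfolding index_mult_mat_sum[OF M P ri] index_mult_mat_vec_sum[OF M w ri(1)] sum_divide_distrib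
    using ri by (intro sum.cong) (auto simp: P_def)
  have diagP: "M * P = P * mat_diag (Suc l) f"
    if M: "M \<in> carrier_mat N N" and Mw: "\<And>i. M *\<^sub>v w i = f i \<cdot>\<^sub>v w i" for M f
  proof (rule eq_matI)
    fix r i assume "r < dim_row (P * mat_diag (Suc l) f)" "i < dim_col (P * mat_diag (Suc l) f)"
    hence ri: "r < N" "i < Suc l" using P by (auto simp: mat_diag_def)
    show "(M * P) $$ (r, i) = (P * mat_diag (Suc l) f) $$ (r, i)"
      unfolding MP[OF M ri] mat_diag_mult_right[OF P] using ri w[of i] by (simp add: Mw P_def)
  qed (use M P in \<open>auto simp: mat_diag_def\<close>)
  have "E * P = P * Emat l"
  proof (rule eq_matI)
    fix r i assume "r < dim_row (P * Emat l)" "i < dim_col (P * Emat l)"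
    hence ri: "r < N" "i < Suc l" using P by (auto simp: Emat_def)
    have "(P * Emat l) $$ (r, i) = (\<Sum>k<Suc l. P $$ (r, k) * Emat l $$ (k, i))"
      by (rule index_mult_mat_sum[OF P _ ri]) simp
    also have "\<dots> = (\<Sum>k<Suc l. if k = Suc i then w (Suc i) $ r / c (Suc i) * qn (int l - int i) else 0)"
      using ri by (intro sum.cong) (auto simp: P_def Emat_def)
    also have "\<dots> = w (Suc i) $ r / c i"
    proof (cases "i = l")
      case True
      thus ?thesis using top ri by simp
    next
      case False
      hence "qn (int l - int i) \<noteq> 0" by (simp add: qn_eq_0_iff)
      thus ?thesis using False ri by (simp add: cS del: sum.lessThan_Suc)
    qed
    finally show "(E * P) $$ (r, i) = (P * Emat l) $$ (r, i)" by (simp add: MP[OF E ri] wS)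
  qed (use E P in \<open>auto simp: Emat_def\<close>)
  moreover have "F * P = P * Fmat l"
  proof (rule eq_matI)
    fix r i assume "r < dim_row (P * Fmat l)" "i < dim_col (P * Fmat l)"
    hence ri: "r < N" "i < Suc l" using P by (auto simp: Fmat_def)
    have sum: "(P * Fmat l) $$ (r, i) = (\<Sum>k<Suc l. P $$ (r, k) * Fmat l $$ (k, i))"
      by (rule index_mult_mat_sum[OF P _ ri]) simp
    show "(F * P) $$ (r, i) = (P * Fmat l) $$ (r, i)"
    proof (cases i)
      case 0
      have "(P * Fmat l) $$ (r, i) = 0"
        unfolding sum using ri 0 by (intro sum.neutral) (auto simp: Fmat_def)
      moreover have "(F * P) $$ (r, i) = 0" unfolding MP[OF F ri] using 0 ri Fv by (simp add: w0)
      ultimately show ?thesis by simp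
    next
      case (Suc i')
      have "(P * Fmat l) $$ (r, i) = (\<Sum>k<Suc l. if k = i' then w i' $ r / c i' * qn (int i) else 0)"
        unfolding sum using ri Suc by (intro sum.cong) (auto simp: P_def Fmat_def)
      also have "\<dots> = w i' $ r / c i' * qn (int i)" using ri Suc by simp
      also have "\<dots> = (F *\<^sub>v w i) $ r / c i"
        using c_nz[of i] ri w[of i'] unfolding Suc Fw cS by (simp add: add.commute)
      finally show ?thesis by (simp add: MP[OF F ri])
    qed
  qed (use F P in \<open>auto simp: Fmat_def\<close>)
  moreover have "K * P = P * Kmat l"
    unfolding Kmat_def Suc_eq_plus1[symmetric] by (rule diagP[OF K' Kw])
  moreover have "L * P = P * Lmat l"
    unfolding Lmat_def Suc_eq_plus1[symmetric]
  proof (rule diagP[OF L])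
    fix i
    have "w i = (L * K) *\<^sub>v w i" using LK w by simp
    also have "\<dots> = p powi (2 * int i - int l) \<cdot>\<^sub>v (L *\<^sub>v w i)"
      using L K' w by (simp add: Kw mult_mat_vec[OF L])
    finally have "w i = p powi (2 * int i - int l) \<cdot>\<^sub>v (L *\<^sub>v w i)" .
    hence "p powi (int l - 2 * int i) \<cdot>\<^sub>v w i =
        p powi (int l - 2 * int i) \<cdot>\<^sub>v (p powi (2 * int i - int l) \<cdot>\<^sub>v (L *\<^sub>v w i))" by (rule arg_cong)
    hence "p powi (int l - 2 * int i) \<cdot>\<^sub>v w i =
        (p powi (int l - 2 * int i) * p powi (2 * int i - int l)) \<cdot>\<^sub>v (L *\<^sub>v w i)"
      by (simp only: smult_smult_assoc)
    also have "p powi (int l - 2 * int i) * p powi (2 * int i - int l) = 1"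
      by (simp flip: power_int_add)
    finally show "L *\<^sub>v w i = p powi (int l - 2 * int i) \<cdot>\<^sub>v w i" by simp
  qed
  moreover have "separated_columns P"
  proof -
    have "\<exists>r<N. P $$ (r, i) \<noteq> 0 \<and> (\<forall>k<Suc l. k \<noteq> i \<longrightarrow> P $$ (r, k) = 0)" if i: "i < Suc l" for i
    proof -
      have "w i \<noteq> 0\<^sub>v N" using i
      proof (induction i)
        case (Suc i)
        have "qn (int i + 1) * qn (int l - int i) \<noteq> 0" using Suc.prems by (simp add: qn_eq_0_iff)
        moreover have "F *\<^sub>v 0\<^sub>v N = 0\<^sub>v N" using F by (auto intro!: eq_vecI)
        ultimately have "w i = 0\<^sub>v N" if "w (Suc i) = 0\<^sub>v N"
          using Fw[of i, unfolded that] w[of i] by (simp add: vec_eq_iff)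
        thus ?case using Suc by auto
      qed (simp add: w0 v)
      then obtain r where r: "r < N" "w i $ r \<noteq> 0"
        using w[of i] by (metis carrier_vecD eq_vecI index_zero_vec)
      have "w k $ r = 0" if "k \<noteq> i" for k
        using weight[OF r(1), of i] weight[OF r(1), of k] r(2) that by auto
      thus ?thesis using r i c_nz[of i] by (intro exI[of _ r]) (auto simp: P_def)
    qed
    thus ?thesis unfolding separated_columns_def using P by auto
  qed
  ultimately show ?thesis using P by blast
qed

text \<open>\<open>d\<close> counts the steps above the bottom weight of the product. The vector is
  a combination of the products of index \<open>(a, d - a)\<close>, and the two bounds on
  \<open>d\<close> ensure that all of these exist.\<close>

lemma tensor_lowest_vector:
  assumes d: "d \<le> n" "d \<le> m"
  shows "\<exists>v \<in> carrier_vec (Suc n * Suc m). v \<noteq> 0\<^sub>v (Suc n * Suc m) \<and>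
    Dmat n m F_gen *\<^sub>v v = 0\<^sub>v (Suc n * Suc m) \<and>
    Dmat n m K_gen *\<^sub>v v = p powi (- int (n + m - 2 * d)) \<cdot>\<^sub>v v"
proof -
  let ?M = "Suc m" and ?N = "Suc n * Suc m"
  \<comment> \<open>The coefficient of index \<open>(a, d - 1 - a)\<close> in \<open>F v\<close>
    involves \<open>p powi (n - 2 * a)\<close> and \<open>p powi (2 * (d - 1 - a) - m)\<close>.
    Their quotient \<open>t\<close> is the same for every \<open>a\<close>.\<close>
  define t where "t = p powi (int n + int m - 2 * int d + 2)"
  \<comment> \<open>\<open>\<alpha> a\<close> is the coefficient of \<open>|a\<rangle> \<otimes> |d - a\<rangle>\<close>; the recursion is the condition \<open>F v = 0\<close>.\<close>
  define \<alpha> where "\<alpha> a = (\<Prod>b<a. - (t * qn (int d - int b) / qn (int b + 1)))" for a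
  have \<alpha>_Suc: "qn (int a + 1) * \<alpha> (Suc a) = - (t * qn (int d - int a) * \<alpha> a)" for a
  proof -
    have "qn (int a + 1) \<noteq> 0" by (simp add: qn_eq_0_iff)
    thus ?thesis by (simp add: \<alpha>_def)
  qed
  define v where "v = vec ?N (\<lambda>r. if r div ?M + r mod ?M = d then \<alpha> (r div ?M) else 0)"
  have v: "v \<in> carrier_vec ?N" by (simp add: v_def)
  have v_index: "v $ (a * ?M + c) = (if a + c = d then \<alpha> a else 0)" if "a < Suc n" "c < Suc m" for a c
    using pair_index_less[OF that] that by (simp add: v_def)
  have "0 * ?M + d < ?N" using d by (intro pair_index_less) auto
  moreover have "v $ (0 * ?M + d) = 1" using v_index[of 0 d] d by (simp add: \<alpha>_def)
  ultimately have "v \<noteq> 0\<^sub>v ?N" by (metis index_zero_vec(1) zero_neq_one)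
  moreover have "Dmat n m F_gen *\<^sub>v v = 0\<^sub>v ?N"
  proof (rule eq_vecI)
    fix r assume "r < dim_vec (0\<^sub>v ?N :: complex vec)"
    hence "r < ?N" by simp
    then obtain a c where r: "r = a * ?M + c" and ac: "a < Suc n" "c < Suc m"
      using div_mod_less_of_less_mult[of r "Suc n" ?M] by (metis div_mult_mod_eq)
    have 1: "(kron (Fmat n) (Kmat m) *\<^sub>v v) $ r =
        (if Suc a + c = d then qn (int a + 1) * p powi (2 * int c - int m) * \<alpha> (Suc a) else 0)"
    proof -
      have "(kron (Fmat n) (Kmat m) *\<^sub>v v) $ r =
          (\<Sum>a'<Suc n. \<Sum>c'<Suc m. Fmat n $$ (a, a') * Kmat m $$ (c, c') * v $ (a' * ?M + c'))"
        unfolding r by (rule kron_mult_vec[OF Tmat_carrier(2,3) v ac])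
      also have "\<dots> = (\<Sum>a'<Suc n. \<Sum>c'<Suc m. if c' = c then (if a' = Suc a then
          qn (int a + 1) * p powi (2 * int c - int m) * v $ (a' * ?M + c') else 0) else 0)"
        using ac by (intro sum.cong refl) (auto simp: Fmat_def Kmat_def mat_diag_def add.commute)
      also have "\<dots> = (if Suc a < Suc n then
          qn (int a + 1) * p powi (2 * int c - int m) * v $ (Suc a * ?M + c) else 0)"
        using ac by (simp del: sum.lessThan_Suc)
      also have "\<dots> = (if Suc a + c = d then qn (int a + 1) * p powi (2 * int c - int m) * \<alpha> (Suc a) else 0)"
        using v_index[of "Suc a" c] ac d by auto
      finally show ?thesis .
    qed
    have 2: "(kron (Lmat n) (Fmat m) *\<^sub>v v) $ r =
        (if Suc a + c = d then p powi (int n - 2 * int a) * qn (int c + 1) * \<alpha> a else 0)"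
    proof -
      have "(kron (Lmat n) (Fmat m) *\<^sub>v v) $ r =
          (\<Sum>a'<Suc n. \<Sum>c'<Suc m. Lmat n $$ (a, a') * Fmat m $$ (c, c') * v $ (a' * ?M + c'))"
        unfolding r by (rule kron_mult_vec[OF Tmat_carrier(4,2) v ac])
      also have "\<dots> = (\<Sum>a'<Suc n. \<Sum>c'<Suc m. if c' = Suc c then (if a' = a then
          p powi (int n - 2 * int a) * qn (int c + 1) * v $ (a' * ?M + c') else 0) else 0)"
        using ac by (intro sum.cong refl) (auto simp: Fmat_def Lmat_def mat_diag_def add.commute)
      also have "\<dots> = (if Suc c < Suc m then
          p powi (int n - 2 * int a) * qn (int c + 1) * v $ (a * ?M + Suc c) else 0)"
        using ac by (simp del: sum.lessThan_Suc)
      also have "\<dots> = (if Suc a + c = d then p powi (int n - 2 * int a) * qn (int c + 1) * \<alpha> a else 0)"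
        using v_index[of a "Suc c"] ac d by auto
      finally show ?thesis .
    qed
    have 3: "qn (int a + 1) * p powi (2 * int c - int m) * \<alpha> (Suc a) +
        p powi (int n - 2 * int a) * qn (int c + 1) * \<alpha> a = 0" if "Suc a + c = d"
    proof -
      have d': "int d = int a + 1 + int c" using that by simp
      let ?x = "p powi (2 * int c - int m)"
      have xt: "?x * t = p powi (int n - 2 * int a)"
        unfolding t_def d' by (simp flip: power_int_add)
      have "qn (int a + 1) * ?x * \<alpha> (Suc a) = ?x * (qn (int a + 1) * \<alpha> (Suc a))" by (simp add: mult_ac)
      also have "\<dots> = ?x * - (t * qn (int d - int a) * \<alpha> a)" by (simp only: \<alpha>_Suc)
      also have "\<dots> = - ((?x * t) * qn (int d - int a) * \<alpha> a)" by (simp only: mult_minus_right mult.assoc)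
      also have "\<dots> = - (p powi (int n - 2 * int a) * qn (int c + 1) * \<alpha> a)"
        using d' by (simp add: xt add.commute)
      finally have "qn (int a + 1) * ?x * \<alpha> (Suc a) = - (p powi (int n - 2 * int a) * qn (int c + 1) * \<alpha> a)" .
      thus ?thesis by simp
    qed
    have "(Dmat n m F_gen *\<^sub>v v) $ r = (kron (Fmat n) (Kmat m) *\<^sub>v v) $ r + (kron (Lmat n) (Fmat m) *\<^sub>v v) $ r"
      using add_mult_distrib_mat_vec[OF kron_T_carrier kron_T_carrier v, OF Tmat_carrier(2,3,4,2)]
        \<open>r < ?N\<close> carrier_matD[OF kron_T_carrier[OF Tmat_carrier(4,2)], of n m] by simp
    thus "(Dmat n m F_gen *\<^sub>v v) $ r = 0\<^sub>v ?N $ r"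
      using 1 2 3 \<open>r < ?N\<close> by auto
  qed (use Dmat_carrier[of n m F_gen] in auto)
  moreover have "Dmat n m K_gen *\<^sub>v v = p powi (- int (n + m - 2 * d)) \<cdot>\<^sub>v v"
  proof (rule eq_vecI)
    fix r assume "r < dim_vec (p powi (- int (n + m - 2 * d)) \<cdot>\<^sub>v v)"
    hence r: "r < ?N" using v by simp
    have "int (n + m - 2 * d) = int n + int m - 2 * int d" using d by simp
    moreover have "int (r div ?M + r mod ?M) = int (r div ?M) + int (r mod ?M)" by simp
    ultimately have "p powi (2 * int (r div ?M) - int n) * p powi (2 * int (r mod ?M) - int m) =
        p powi (- int (n + m - 2 * d))" if "r div ?M + r mod ?M = d"
      unfolding power_int_add[OF disjI1[OF p_nonzero], symmetric]
      by (intro arg_cong[of _ _ "power_int p"]) (use that in linarith)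
    thus "(Dmat n m K_gen *\<^sub>v v) $ r = (p powi (- int (n + m - 2 * d)) \<cdot>\<^sub>v v) $ r"
      unfolding Dmat_K_diag mult_mat_diag_vec[OF v r] using r by (simp add: v_def del: mult_Suc mult_Suc_right)
  qed (use v Dmat_carrier[of n m K_gen] in auto)
  ultimately show ?thesis using v by blast
qed

lemma tensor_intertwiner:
  assumes d: "d \<le> n" "d \<le> m"
  shows "\<exists>P \<in> carrier_mat (Suc n * Suc m) (Suc (n + m - 2 * d)).
    separated_columns P \<and>
    (\<forall>g. Dmat n m g * P = P * Tmat (n + m - 2 * d) g)"
proof -
  let ?N = "Suc n * Suc m"
  obtain v where v: "v \<in> carrier_vec ?N" "v \<noteq> 0\<^sub>v ?N" "Dmat n m F_gen *\<^sub>v v = 0\<^sub>v ?N"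
    "Dmat n m K_gen *\<^sub>v v = p powi (- int (n + m - 2 * d)) \<cdot>\<^sub>v v"
    using tensor_lowest_vector[OF d] by auto
  have K: "Dmat n m K_gen = mat_diag ?N
      (\<lambda>r. p powi ((2 * int (r div Suc m) - int n) + (2 * int (r mod Suc m) - int m)))"
    unfolding Dmat_K_diag by (simp add: power_int_add)
  obtain P where "P \<in> carrier_mat ?N (Suc (n + m - 2 * d))" "separated_columns P"
    "Dmat n m E_gen * P = P * Emat (n + m - 2 * d)" "Dmat n m F_gen * P = P * Fmat (n + m - 2 * d)"
    "Dmat n m K_gen * P = P * Kmat (n + m - 2 * d)" "Dmat n m Kinv_gen * P = P * Lmat (n + m - 2 * d)"
    using lowest_weight_intertwiner[OF Dmat_carrier Dmat_carrier Dmat_carrier K Dmat_K_inverse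
        Dmat_K_E Dmat_E_F v] by auto
  hence "Dmat n m g * P = P * Tmat (n + m - 2 * d) g" for g by (cases g) simp_all
  thus ?thesis using \<open>P \<in> _\<close> \<open>separated_columns P\<close> by blast
qed

end

section \<open>The Serre relations on the weight lattice\<close>

definition lattice_op ::
    "(int \<Rightarrow> int \<Rightarrow> complex) \<Rightarrow> (int \<Rightarrow> int \<Rightarrow> complex) \<Rightarrow> (int \<Rightarrow> int \<Rightarrow> complex) \<Rightarrow> (int \<Rightarrow> int \<Rightarrow> complex) \<Rightarrow>
      (int \<Rightarrow> int \<Rightarrow> complex) \<Rightarrow> int \<Rightarrow> int \<Rightarrow> complex" where
  "lattice_op G1 G2 G3 G4 f a c =
     G1 a c * f a (c - 1) + G2 a c * f a (c + 1) + G3 a c * f (a - 1) c + G4 a c * f (a + 1) c"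

text \<open>Two steps lead to nine displacements: twice in one of four directions, two perpendicular
  steps (four cases, each by two paths), and back to the start (four paths). Each hypothesis is the
  coefficient of one displacement.\<close>

lemma lattice_op_serre:
  fixes X :: "int \<Rightarrow> int \<Rightarrow> complex"
  assumes "G1 a c * G1 a (c - 1) * (X a c - k * X a (c - 1) + X a (c - 2)) = 0"
    "G2 a c * G2 a (c + 1) * (X a c - k * X a (c + 1) + X a (c + 2)) = 0"
    "G3 a c * G3 (a - 1) c * (X a c - k * X (a - 1) c + X (a - 2) c) = 0"
    "G4 a c * G4 (a + 1) c * (X a c - k * X (a + 1) c + X (a + 2) c) = 0"
    "G1 a c * G3 a (c - 1) * (X a c - k * X a (c - 1) + X (a - 1) (c - 1)) +
     G3 a c * G1 (a - 1) c * (X a c - k * X (a - 1) c + X (a - 1) (c - 1)) = 0"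
    "G1 a c * G4 a (c - 1) * (X a c - k * X a (c - 1) + X (a + 1) (c - 1)) +
     G4 a c * G1 (a + 1) c * (X a c - k * X (a + 1) c + X (a + 1) (c - 1)) = 0"
    "G2 a c * G3 a (c + 1) * (X a c - k * X a (c + 1) + X (a - 1) (c + 1)) +
     G3 a c * G2 (a - 1) c * (X a c - k * X (a - 1) c + X (a - 1) (c + 1)) = 0"
    "G2 a c * G4 a (c + 1) * (X a c - k * X a (c + 1) + X (a + 1) (c + 1)) +
     G4 a c * G2 (a + 1) c * (X a c - k * X (a + 1) c + X (a + 1) (c + 1)) = 0"
    "G1 a c * G2 a (c - 1) * (X a c - k * X a (c - 1) + X a c) +
     G2 a c * G1 a (c + 1) * (X a c - k * X a (c + 1) + X a c) +
     G3 a c * G4 (a - 1) c * (X a c - k * X (a - 1) c + X a c) +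
     G4 a c * G3 (a + 1) c * (X a c - k * X (a + 1) c + X a c) = - X a c"
  defines "T \<equiv> lattice_op G1 G2 G3 G4"
  shows "X a c * T (T f) a c - k * T (\<lambda>a c. X a c * T f a c) a c + T (T (\<lambda>a c. X a c * f a c)) a c =
    - (X a c * f a c)"
proof -
  have "X a c * T (T f) a c - k * T (\<lambda>a c. X a c * T f a c) a c + T (T (\<lambda>a c. X a c * f a c)) a c =
    G1 a c * G1 a (c - 1) * (X a c - k * X a (c - 1) + X a (c - 2)) * f a (c - 2) +
    G2 a c * G2 a (c + 1) * (X a c - k * X a (c + 1) + X a (c + 2)) * f a (c + 2) +
    G3 a c * G3 (a - 1) c * (X a c - k * X (a - 1) c + X (a - 2) c) * f (a - 2) c +
    G4 a c * G4 (a + 1) c * (X a c - k * X (a + 1) c + X (a + 2) c) * f (a + 2) c +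
    (G1 a c * G3 a (c - 1) * (X a c - k * X a (c - 1) + X (a - 1) (c - 1)) +
     G3 a c * G1 (a - 1) c * (X a c - k * X (a - 1) c + X (a - 1) (c - 1))) * f (a - 1) (c - 1) +
    (G1 a c * G4 a (c - 1) * (X a c - k * X a (c - 1) + X (a + 1) (c - 1)) +
     G4 a c * G1 (a + 1) c * (X a c - k * X (a + 1) c + X (a + 1) (c - 1))) * f (a + 1) (c - 1) +
    (G2 a c * G3 a (c + 1) * (X a c - k * X a (c + 1) + X (a - 1) (c + 1)) +
     G3 a c * G2 (a - 1) c * (X a c - k * X (a - 1) c + X (a - 1) (c + 1))) * f (a - 1) (c + 1) +
    (G2 a c * G4 a (c + 1) * (X a c - k * X a (c + 1) + X (a + 1) (c + 1)) +
     G4 a c * G2 (a + 1) c * (X a c - k * X (a + 1) c + X (a + 1) (c + 1))) * f (a + 1) (c + 1) +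
    (G1 a c * G2 a (c - 1) * (X a c - k * X a (c - 1) + X a c) +
     G2 a c * G1 a (c + 1) * (X a c - k * X a (c + 1) + X a c) +
     G3 a c * G4 (a - 1) c * (X a c - k * X (a - 1) c + X a c) +
     G4 a c * G3 (a + 1) c * (X a c - k * X (a + 1) c + X a c)) * f a c"
    unfolding T_def lattice_op_def by (simp add: algebra_simps)
  thus ?thesis using assms(1-9) by simp
qed

text \<open>Here \<open>T\<close> occurs only once in each term, so a quadratic condition on the two
  ends of each edge suffices.\<close>

lemma lattice_op_serre':
  fixes X :: "int \<Rightarrow> int \<Rightarrow> complex"
  assumes "G1 a c * (X a c ^ 2 - k * X a c * X a (c - 1) + X a (c - 1) ^ 2) = - G1 a c"
    "G2 a c * (X a c ^ 2 - k * X a c * X a (c + 1) + X a (c + 1) ^ 2) = - G2 a c"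
    "G3 a c * (X a c ^ 2 - k * X a c * X (a - 1) c + X (a - 1) c ^ 2) = - G3 a c"
    "G4 a c * (X a c ^ 2 - k * X a c * X (a + 1) c + X (a + 1) c ^ 2) = - G4 a c"
  defines "T \<equiv> lattice_op G1 G2 G3 G4"
  shows "T (\<lambda>a c. X a c * (X a c * f a c)) a c - k * (X a c * T (\<lambda>a c. X a c * f a c) a c) +
    X a c * (X a c * T f a c) = - T f a c"
proof -
  have "T (\<lambda>a c. X a c * (X a c * f a c)) a c - k * (X a c * T (\<lambda>a c. X a c * f a c) a c) +
      X a c * (X a c * T f a c) =
    G1 a c * (X a c ^ 2 - k * X a c * X a (c - 1) + X a (c - 1) ^ 2) * f a (c - 1) +
    G2 a c * (X a c ^ 2 - k * X a c * X a (c + 1) + X a (c + 1) ^ 2) * f a (c + 1) +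
    G3 a c * (X a c ^ 2 - k * X a c * X (a - 1) c + X (a - 1) c ^ 2) * f (a - 1) c +
    G4 a c * (X a c ^ 2 - k * X a c * X (a + 1) c + X (a + 1) c ^ 2) * f (a + 1) c"
    unfolding T_def lattice_op_def by (simp add: algebra_simps power2_eq_square)
  also have "\<dots> = - T f a c"
    unfolding assms(1-4) T_def lattice_op_def by simp
  finally show ?thesis .
qed

text \<open>This is \<open>serre_key\<close> below with the denominators cleared, where \<open>\<alpha>, \<beta>, \<mu>, \<nu>\<close> and \<open>r\<close> are the squares
  of \<open>p\<^sup>u, p\<^sup>v, p\<^sup>m, p\<^sup>n\<close> and \<open>q\<close>.\<close>

lemma serre_polynomial_identity:
  fixes \<alpha> \<beta> \<mu> \<nu> r :: complex
  shows "((\<mu>*r*\<alpha> + 1) * (\<nu>*r*\<alpha> - 1) * (\<mu> + \<alpha>) * (\<nu> - \<alpha>) * \<beta>^2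
      - (\<nu>*r + \<beta>) * (\<mu>*r - \<beta>) * (\<nu>*\<beta> + 1) * (\<mu>*\<beta> - 1) * \<alpha>^2) * (\<alpha> + \<beta>*r)
    + ((\<nu>*r*\<beta> + 1) * (\<mu>*r*\<beta> - 1) * (\<nu> + \<beta>) * (\<mu> - \<beta>) * \<alpha>^2
      - (\<mu>*r + \<alpha>) * (\<nu>*r - \<alpha>) * (\<mu>*\<alpha> + 1) * (\<nu>*\<alpha> - 1) * \<beta>^2) * (\<alpha>*r + \<beta>)
    = - (\<alpha>^2*\<beta>^2 - 1) * (\<alpha> + \<beta>) * (r - 1) * \<mu> * \<nu> * (\<alpha>*r + \<beta>) * (\<alpha> + \<beta>*r)"
  by (simp add: algebra_simps power2_eq_square)

context generic_q
begin

text \<open>In undoubled weights, \<open>sh x\<close> is the \<open>q\<close>-number of \<open>x / 2\<close>, and \<open>ch x\<close> is \<open>q\<^bsup>x/2\<^esup> + q\<^bsup>-x/2\<^esup>\<close>.\<close>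

definition ch :: "int \<Rightarrow> complex" where "ch x = p powi x + p powi (- x)"
definition sh :: "int \<Rightarrow> complex" where "sh x = (p powi x - p powi (- x)) / qd"

lemma ch_nonzero [simp]: "ch x \<noteq> 0"
  by (simp add: ch_def powi_add_powi_nonzero)

lemma qn_eq_sh: "qn z = sh (2 * z)"
  using powi_even[of z] powi_even[of "- z"] by (simp add: qn_def sh_def)

text \<open>The difference factors into \<open>p powi x - p powi y\<close> and a multiple of
  \<open>p powi (x + y) + 1\<close>, which is never zero.\<close>

lemma sh_eq_iff: "sh x = sh y \<longleftrightarrow> x = y"
proof
  assume "sh x = sh y"
  hence "p powi x - p powi (- x) = p powi y - p powi (- y)" by (simp add: sh_def)
  hence "(p powi x - p powi y) * (p powi (x + y) + p powi 0) = 0"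
    by (simp add: power_int_minus power_int_add field_simps)
  thus "x = y" using powi_add_powi_nonzero by (simp add: powi_eq_iff del: power_int_0_right)
qed simp

lemma sh_shift:
  "sh x = (p powi x - 1 / p powi x) / qd"
  "sh (x + 2) = (p powi x * q - 1 / (p powi x * q)) / qd"
  "sh (x - 2) = (p powi x / q - q / p powi x) / qd"
  "sh (x + 4) = (p powi x * q * q - 1 / (p powi x * q * q)) / qd"
  "sh (x - 4) = (p powi x / (q * q) - q * q / p powi x) / qd"
  by (simp_all add: sh_def power_int_minus power_int_add power_int_diff q_def field_simps eval_nat_numeral)

lemma sh_serre:
  "sh x ^ 2 - (q + inverse q) * sh x * sh (x + 2) + sh (x + 2) ^ 2 = 1"
  "sh x ^ 2 - (q + inverse q) * sh x * sh (x - 2) + sh (x - 2) ^ 2 = 1"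
proof -
  define X where "X = p powi x"
  have nz: "X \<noteq> 0" "q \<noteq> 0" by (simp_all add: X_def)
  have *: "(a / qd) ^ 2 - (q + inverse q) * (a / qd) * (b / qd) + (b / qd) ^ 2 = 1"
    if "a ^ 2 - (q + inverse q) * a * b + b ^ 2 = qd ^ 2" for a b
  proof -
    have "(a / qd) ^ 2 - (q + inverse q) * (a / qd) * (b / qd) + (b / qd) ^ 2 =
        (a ^ 2 - (q + inverse q) * a * b + b ^ 2) / qd ^ 2"
      by (simp add: add_divide_distrib diff_divide_distrib power2_eq_square)
    thus ?thesis using that by simp
  qed
  show "sh x ^ 2 - (q + inverse q) * sh x * sh (x + 2) + sh (x + 2) ^ 2 = 1"
    unfolding sh_shift(2-5) sh_shift(1)[of x] X_def[symmetric]
    by (rule *) (use nz in \<open>simp add: qd_def field_simps power2_eq_square\<close>)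
  show "sh x ^ 2 - (q + inverse q) * sh x * sh (x - 2) + sh (x - 2) ^ 2 = 1"
    unfolding sh_shift(2-5) sh_shift(1)[of x] X_def[symmetric]
    by (rule *) (use nz in \<open>simp add: qd_def field_simps power2_eq_square\<close>)
qed

text \<open>The weights met on a path are \<open>x, x + 2, x + 4\<close> or
  \<open>x, x + 2, x\<close>, up to sign of the steps. The first kind satisfies a recurrence, the
  second leaves a defect \<open>ch\<close>, which later cancels a denominator.\<close>

lemma sh_recurrence:
  "sh x - (q + inverse q) * sh (x + 2) + sh (x + 4) = 0"
  "sh x - (q + inverse q) * sh (x - 2) + sh (x - 4) = 0"
  "sh x - (q + inverse q) * sh (x + 2) + sh x = - ch (x + 2)"
  "sh x - (q + inverse q) * sh (x - 2) + sh x = ch (x - 2)"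
proof -
  define X where "X = p powi x"
  have nz: "X \<noteq> 0" "q \<noteq> 0" by (simp_all add: X_def)
  have *: "a / qd - (q + inverse q) * (b / qd) + c / qd = d"
    if "a - (q + inverse q) * b + c = qd * d" for a b c d
  proof -
    have "a / qd - (q + inverse q) * (b / qd) + c / qd = (a - (q + inverse q) * b + c) / qd"
      by (simp add: add_divide_distrib diff_divide_distrib)
    thus ?thesis using that by simp
  qed
  have ch: "ch (x + 2) = X * q + 1 / (X * q)" "ch (x - 2) = X / q + q / X"
    by (simp_all add: X_def ch_def power_int_minus power_int_add power_int_diff q_def field_simps)
  show "sh x - (q + inverse q) * sh (x + 2) + sh (x + 4) = 0"
    "sh x - (q + inverse q) * sh (x - 2) + sh (x - 4) = 0"
    "sh x - (q + inverse q) * sh (x + 2) + sh x = - ch (x + 2)"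
    "sh x - (q + inverse q) * sh (x - 2) + sh x = ch (x - 2)"
    unfolding sh_shift(2-5) sh_shift(1)[of x] X_def[symmetric] ch
    by (rule *; use nz in \<open>simp add: qd_def field_simps power2_eq_square\<close>)+
qed

text \<open>Up to the factor \<open>1 / (ch (u + v) * ch (u - v))\<close> this is the coefficient of
  the return to the starting point, with \<open>u\<close> and \<open>v\<close> the doubled weights
  in the two copies. Replacing \<open>v\<close> by \<open>- v\<close> gives the version for the
  other diagonal generator.\<close>

lemma serre_key:
  "(ch (m + 2 + u) * sh (n + 2 + u) * (ch (m - u) * sh (n - u))
     - ch (n + 2 - v) * sh (m + 2 - v) * (ch (n + v) * sh (m + v))) / ch (u - v + 2)
   + (ch (n + 2 + v) * sh (m + 2 + v) * (ch (n - v) * sh (m - v))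
     - ch (m + 2 - u) * sh (n + 2 - u) * (ch (m + u) * sh (n + u))) / ch (u - v - 2)
   = - (sh (u + v) * ch (u + v) * ch (u - v))"
proof -
  define A B W U where "A = p powi u" "B = p powi v" "W = p powi m" "U = p powi n"
  have nz: "A \<noteq> 0" "B \<noteq> 0" "W \<noteq> 0" "U \<noteq> 0" by (simp_all add: A_B_W_U_def)
  define \<alpha> \<beta> \<mu> \<nu> r where "\<alpha> = A ^ 2" "\<beta> = B ^ 2" "\<mu> = W ^ 2" "\<nu> = U ^ 2" "r = q ^ 2"
  note greek = \<alpha>_\<beta>_\<mu>_\<nu>_r_def
  have nz': "\<alpha> \<noteq> 0" "\<beta> \<noteq> 0" "\<mu> \<noteq> 0" "\<nu> \<noteq> 0" "r \<noteq> 0" using nz by (simp_all add: greek)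
  have e: "ch (m + 2 + u) = (\<mu>*r*\<alpha> + 1) / (W*q*A)" "sh (n + 2 + u) = (\<nu>*r*\<alpha> - 1) / (U*q*A*qd)"
    "ch (m - u) = (\<mu> + \<alpha>) / (W*A)" "sh (n - u) = (\<nu> - \<alpha>) / (U*A*qd)"
    "ch (n + 2 - v) = (\<nu>*r + \<beta>) / (U*q*B)" "sh (m + 2 - v) = (\<mu>*r - \<beta>) / (W*q*B*qd)"
    "ch (n + v) = (\<nu>*\<beta> + 1) / (U*B)" "sh (m + v) = (\<mu>*\<beta> - 1) / (W*B*qd)"
    "ch (n + 2 + v) = (\<nu>*r*\<beta> + 1) / (U*q*B)" "sh (m + 2 + v) = (\<mu>*r*\<beta> - 1) / (W*q*B*qd)"
    "ch (n - v) = (\<nu> + \<beta>) / (U*B)" "sh (m - v) = (\<mu> - \<beta>) / (W*B*qd)"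
    "ch (m + 2 - u) = (\<mu>*r + \<alpha>) / (W*q*A)" "sh (n + 2 - u) = (\<nu>*r - \<alpha>) / (U*q*A*qd)"
    "ch (m + u) = (\<mu>*\<alpha> + 1) / (W*A)" "sh (n + u) = (\<nu>*\<alpha> - 1) / (U*A*qd)"
    "ch (u - v + 2) = (\<alpha>*r + \<beta>) / (A*B*q)" "ch (u - v - 2) = (\<alpha> + \<beta>*r) / (A*B*q)"
    "sh (u + v) = (\<alpha>*\<beta> - 1) / (A*B*qd)" "ch (u + v) = (\<alpha>*\<beta> + 1) / (A*B)"
    "ch (u - v) = (\<alpha> + \<beta>) / (A*B)"
    using nz unfolding ch_def sh_def greek A_B_W_U_def
    by (simp_all add: power_int_minus power_int_add power_int_diff q_def field_simps power2_eq_square)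
  have H: "\<alpha>*r + \<beta> \<noteq> 0" "\<alpha> + \<beta>*r \<noteq> 0"
    using ch_nonzero[of "u - v + 2"] ch_nonzero[of "u - v - 2"] unfolding e by auto
  define M1 M2 M3 M4 where
    "M1 = (\<mu>*r*\<alpha> + 1) * (\<nu>*r*\<alpha> - 1) * (\<mu> + \<alpha>) * (\<nu> - \<alpha>)"
    "M2 = (\<nu>*r + \<beta>) * (\<mu>*r - \<beta>) * (\<nu>*\<beta> + 1) * (\<mu>*\<beta> - 1)"
    "M3 = (\<nu>*r*\<beta> + 1) * (\<mu>*r*\<beta> - 1) * (\<nu> + \<beta>) * (\<mu> - \<beta>)"
    "M4 = (\<mu>*r + \<alpha>) * (\<nu>*r - \<alpha>) * (\<mu>*\<alpha> + 1) * (\<nu>*\<alpha> - 1)"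
  note M = M1_M2_M3_M4_def
  have P: "ch (m + 2 + u) * sh (n + 2 + u) * (ch (m - u) * sh (n - u)) = M1 / (\<mu>*\<nu>*r*\<alpha>^2*qd^2)"
    "ch (n + 2 - v) * sh (m + 2 - v) * (ch (n + v) * sh (m + v)) = M2 / (\<mu>*\<nu>*r*\<beta>^2*qd^2)"
    "ch (n + 2 + v) * sh (m + 2 + v) * (ch (n - v) * sh (m - v)) = M3 / (\<mu>*\<nu>*r*\<beta>^2*qd^2)"
    "ch (m + 2 - u) * sh (n + 2 - u) * (ch (m + u) * sh (n + u)) = M4 / (\<mu>*\<nu>*r*\<alpha>^2*qd^2)"
    unfolding e M times_divide_times_eq
    by (rule arg_cong2[of _ _ _ _ "(/)"]; simp add: greek power2_eq_square mult_ac)+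
  \<comment> \<open>The factor common to both fractions once each numerator has been brought to one
    denominator.\<close>
  define c where "c = A*B*q / (\<mu>*\<nu>*r*\<alpha>^2*\<beta>^2*qd^2)"
  have 1: "(M1 / (\<mu>*\<nu>*r*\<alpha>^2*qd^2) - M2 / (\<mu>*\<nu>*r*\<beta>^2*qd^2)) / ((\<alpha>*r + \<beta>) / (A*B*q)) =
      c * ((M1*\<beta>^2 - M2*\<alpha>^2) / (\<alpha>*r + \<beta>))"
  proof -
    have "M1 / (\<mu>*\<nu>*r*\<alpha>^2*qd^2) - M2 / (\<mu>*\<nu>*r*\<beta>^2*qd^2) =
        (M1*\<beta>^2 - M2*\<alpha>^2) / (\<mu>*\<nu>*r*\<alpha>^2*\<beta>^2*qd^2)"
      using nz' by (simp add: diff_divide_distrib mult.assoc)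
    thus ?thesis by (simp add: c_def)
  qed
  have 2: "(M3 / (\<mu>*\<nu>*r*\<beta>^2*qd^2) - M4 / (\<mu>*\<nu>*r*\<alpha>^2*qd^2)) / ((\<alpha> + \<beta>*r) / (A*B*q)) =
      c * ((M3*\<alpha>^2 - M4*\<beta>^2) / (\<alpha> + \<beta>*r))"
  proof -
    have "M3 / (\<mu>*\<nu>*r*\<beta>^2*qd^2) - M4 / (\<mu>*\<nu>*r*\<alpha>^2*qd^2) =
        (M3*\<alpha>^2 - M4*\<beta>^2) / (\<mu>*\<nu>*r*\<alpha>^2*\<beta>^2*qd^2)"
      using nz' by (simp add: diff_divide_distrib mult.assoc)
    thus ?thesis by (simp add: c_def)
  qed
  have "(M1*\<beta>^2 - M2*\<alpha>^2) / (\<alpha>*r + \<beta>) + (M3*\<alpha>^2 - M4*\<beta>^2) / (\<alpha> + \<beta>*r) =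
      ((M1*\<beta>^2 - M2*\<alpha>^2) * (\<alpha> + \<beta>*r) + (M3*\<alpha>^2 - M4*\<beta>^2) * (\<alpha>*r + \<beta>)) / ((\<alpha>*r + \<beta>) * (\<alpha> + \<beta>*r))"
    using H by (simp add: add_divide_distrib)
  also have "(M1*\<beta>^2 - M2*\<alpha>^2) * (\<alpha> + \<beta>*r) + (M3*\<alpha>^2 - M4*\<beta>^2) * (\<alpha>*r + \<beta>) =
      - (\<alpha>^2*\<beta>^2 - 1) * (\<alpha> + \<beta>) * (r - 1) * \<mu> * \<nu> * (\<alpha>*r + \<beta>) * (\<alpha> + \<beta>*r)"
    unfolding M by (rule serre_polynomial_identity)
  also have "\<dots> / ((\<alpha>*r + \<beta>) * (\<alpha> + \<beta>*r)) = - (\<alpha>^2*\<beta>^2 - 1) * (\<alpha> + \<beta>) * (r - 1) * \<mu> * \<nu>"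
    using H by simp
  finally have 3: "(M1*\<beta>^2 - M2*\<alpha>^2) / (\<alpha>*r + \<beta>) + (M3*\<alpha>^2 - M4*\<beta>^2) / (\<alpha> + \<beta>*r) =
      - (\<alpha>^2*\<beta>^2 - 1) * (\<alpha> + \<beta>) * (r - 1) * \<mu> * \<nu>" .
  have rq: "r - 1 = q * qd" by (simp add: greek qd_def field_simps power2_eq_square)
  show ?thesis
    unfolding P e(17-21) 1 2 distrib_left[symmetric] 3 rq
    using nz unfolding c_def greek
    by (simp add: field_simps power2_eq_square)
qed

text \<open>The doubled eigenvalues of \<open>H\<^sub>1 + H\<^sub>2\<close> and \<open>H\<^sub>1 - H\<^sub>2\<close> on the basis vector with indices \<open>a\<close> and \<open>c\<close>.\<close>

definition wplus :: "int \<Rightarrow> int \<Rightarrow> int \<Rightarrow> int \<Rightarrow> int" where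
  "wplus n m a c = (2 * a - n) + (2 * c - m)"
definition wminus :: "int \<Rightarrow> int \<Rightarrow> int \<Rightarrow> int \<Rightarrow> int" where
  "wminus n m a c = (2 * a - n) - (2 * c - m)"

lemma weight_shift [simp]:
  "wplus n m a (c - 1) = wplus n m a c - 2" "wplus n m a (c + 1) = wplus n m a c + 2"
  "wplus n m (a - 1) c = wplus n m a c - 2" "wplus n m (a + 1) c = wplus n m a c + 2"
  "wplus n m a (c - 2) = wplus n m a c - 4" "wplus n m a (c + 2) = wplus n m a c + 4"
  "wplus n m (a - 2) c = wplus n m a c - 4" "wplus n m (a + 2) c = wplus n m a c + 4"
  "wminus n m a (c - 1) = wminus n m a c + 2" "wminus n m a (c + 1) = wminus n m a c - 2"
  "wminus n m (a - 1) c = wminus n m a c - 2" "wminus n m (a + 1) c = wminus n m a c + 2"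
  "wminus n m a (c - 2) = wminus n m a c + 4" "wminus n m a (c + 2) = wminus n m a c - 4"
  "wminus n m (a - 2) c = wminus n m a c - 4" "wminus n m (a + 2) c = wminus n m a c + 4"
  by (simp_all add: wplus_def wminus_def)

text \<open>The coefficients of \<open>\<phi>(I\<^sub>3\<^sub>2)\<close> at the target \<open>(a, c)\<close>, in the order \<open>e\<^sub>2, f\<^sub>2, e\<^sub>1, f\<^sub>1\<close>; the \<open>q\<close>-numbers by
  which the generators act are included.\<close>

definition G1 :: "int \<Rightarrow> int \<Rightarrow> int \<Rightarrow> int \<Rightarrow> complex" where
  "G1 n m a c = - (ch (n + 2 - (2 * c - m)) * sh (m + 2 - (2 * c - m))
      / (ch (wplus n m a c - 2) * ch (wminus n m a c + 2)))"
definition G2 :: "int \<Rightarrow> int \<Rightarrow> int \<Rightarrow> int \<Rightarrow> complex" where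
  "G2 n m a c = ch (n + 2 + (2 * c - m)) * sh (m + 2 + (2 * c - m))
      / (ch (wplus n m a c + 2) * ch (wminus n m a c - 2))"
definition G3 :: "int \<Rightarrow> int \<Rightarrow> int \<Rightarrow> int \<Rightarrow> complex" where
  "G3 n m a c = ch (m + 2 - (2 * a - n)) * sh (n + 2 - (2 * a - n))
      / (ch (wplus n m a c - 2) * ch (wminus n m a c - 2))"
definition G4 :: "int \<Rightarrow> int \<Rightarrow> int \<Rightarrow> int \<Rightarrow> complex" where
  "G4 n m a c = - (ch (m + 2 + (2 * a - n)) * sh (n + 2 + (2 * a - n))
      / (ch (wplus n m a c + 2) * ch (wminus n m a c + 2)))"

definition I32_op where "I32_op n m = lattice_op (G1 n m) (G2 n m) (G3 n m) (G4 n m)"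

section \<open>The Serre relations for the lattice operator of \<open>I32\<close>\<close>

lemma i_sh_recurrence:
  "\<i> * sh x - (q + inverse q) * (\<i> * sh (x + 2)) + \<i> * sh (x + 4) = 0"
  "\<i> * sh x - (q + inverse q) * (\<i> * sh (x - 2)) + \<i> * sh (x - 4) = 0"
  "\<i> * sh x - (q + inverse q) * (\<i> * sh (x + 2)) + \<i> * sh x = - (\<i> * ch (x + 2))"
  "\<i> * sh x - (q + inverse q) * (\<i> * sh (x - 2)) + \<i> * sh x = \<i> * ch (x - 2)"
  using sh_recurrence[of x, THEN arg_cong, of "\<lambda>z. \<i> * z"]
  by (simp_all add: distrib_left right_diff_distrib mult.left_commute[of \<i>])

text \<open>The factor \<open>\<i>\<close> in the diagonal generators turns the value 1 of
  \<open>sh_serre\<close> into the -1 demanded by the sign of the Serre relations.\<close>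

lemma i_sh_serre:
  "(\<i> * sh x) ^ 2 - (q + inverse q) * (\<i> * sh x) * (\<i> * sh (x + 2)) + (\<i> * sh (x + 2)) ^ 2 = - 1"
  "(\<i> * sh x) ^ 2 - (q + inverse q) * (\<i> * sh x) * (\<i> * sh (x - 2)) + (\<i> * sh (x - 2)) ^ 2 = - 1"
proof -
  have *: "(\<i> * a) ^ 2 - k * (\<i> * a) * (\<i> * b) + (\<i> * b) ^ 2 = - (a ^ 2 - k * a * b + b ^ 2)" for a b k
    by (simp add: power_mult_distrib algebra_simps)
  show "(\<i> * sh x) ^ 2 - (q + inverse q) * (\<i> * sh x) * (\<i> * sh (x + 2)) + (\<i> * sh (x + 2)) ^ 2 = - 1"
    "(\<i> * sh x) ^ 2 - (q + inverse q) * (\<i> * sh x) * (\<i> * sh (x - 2)) + (\<i> * sh (x - 2)) ^ 2 = - 1"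
    unfolding * sh_serre by simp_all
qed

lemma I32_op_serre':
  "I32_op n m (\<lambda>a c. (\<i> * sh (wplus n m a c)) * ((\<i> * sh (wplus n m a c)) * f a c)) a c
    - (q + inverse q) * ((\<i> * sh (wplus n m a c)) * I32_op n m (\<lambda>a c. (\<i> * sh (wplus n m a c)) * f a c) a c)
    + (\<i> * sh (wplus n m a c)) * ((\<i> * sh (wplus n m a c)) * I32_op n m f a c) = - I32_op n m f a c"
  "I32_op n m (\<lambda>a c. (\<i> * sh (wminus n m a c)) * ((\<i> * sh (wminus n m a c)) * f a c)) a c
    - (q + inverse q) * ((\<i> * sh (wminus n m a c)) * I32_op n m (\<lambda>a c. (\<i> * sh (wminus n m a c)) * f a c) a c)
    + (\<i> * sh (wminus n m a c)) * ((\<i> * sh (wminus n m a c)) * I32_op n m f a c) = - I32_op n m f a c"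
  unfolding I32_op_def
  by (rule lattice_op_serre'; simp only: weight_shift i_sh_serre mult_minus1_right)+

text \<open>A step changes the weight by 2, which absorbs the summand 2 in the argument. Thus the
  two coefficients along an edge get the paired arguments that occur in
  \<open>serre_key\<close>.\<close>

lemma recentre:
  "k + 2 + (2 * (z - 1) - l) = k + (2 * z - l)" "k + 2 - (2 * (z + 1) - l) = k - (2 * z - l)" for k z l :: int
  by simp_all

lemma G_return_products:
  fixes n m a c :: int
  defines "x \<equiv> wplus n m a c" and "y \<equiv> wminus n m a c" and "u \<equiv> 2 * a - n" and "v \<equiv> 2 * c - m"
  shows "G1 n m a c * G2 n m a (c - 1) = - (ch (n + 2 - v) * sh (m + 2 - v) * (ch (n + v) * sh (m + v)))
      / (ch (x - 2) * ch (y + 2) * (ch x * ch y))"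
    "G2 n m a c * G1 n m a (c + 1) = - (ch (n + 2 + v) * sh (m + 2 + v) * (ch (n - v) * sh (m - v)))
      / (ch (x + 2) * ch (y - 2) * (ch x * ch y))"
    "G3 n m a c * G4 n m (a - 1) c = - (ch (m + 2 - u) * sh (n + 2 - u) * (ch (m + u) * sh (n + u)))
      / (ch (x - 2) * ch (y - 2) * (ch x * ch y))"
    "G4 n m a c * G3 n m (a + 1) c = - (ch (m + 2 + u) * sh (n + 2 + u) * (ch (m - u) * sh (n - u)))
      / (ch (x + 2) * ch (y + 2) * (ch x * ch y))"
  unfolding G1_def G2_def G3_def G4_def weight_shift recentre assms by simp_all

text \<open>Two steps that both raise or both lower \<open>wplus\<close> cancel by the recurrence.
  There remain the pairs \<open>e_2, f_1\<close> and \<open>f_2, e_1\<close> and the closed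
  paths.\<close>

lemma I32_op_serre_plus:
  "(\<i> * sh (wplus n m a c)) * I32_op n m (I32_op n m f) a c
    - (q + inverse q) * I32_op n m (\<lambda>a c. (\<i> * sh (wplus n m a c)) * I32_op n m f a c) a c
    + I32_op n m (I32_op n m (\<lambda>a c. (\<i> * sh (wplus n m a c)) * f a c)) a c
    = - ((\<i> * sh (wplus n m a c)) * f a c)"
proof -
  have e: "x - 2 - 2 = x - 4" "x + 2 + 2 = x + 4" for x :: int by simp_all
  define x y u v where "x = wplus n m a c" "y = wminus n m a c" "u = 2 * a - n" "v = 2 * c - m"
  have xy: "x = u + v" "y = u - v" by (simp_all add: x_y_u_v_def wplus_def wminus_def)
  define M1 M2 M3 M4 where
    "M1 = ch (m + 2 + u) * sh (n + 2 + u) * (ch (m - u) * sh (n - u))"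
    "M2 = ch (n + 2 - v) * sh (m + 2 - v) * (ch (n + v) * sh (m + v))"
    "M3 = ch (n + 2 + v) * sh (m + 2 + v) * (ch (n - v) * sh (m - v))"
    "M4 = ch (m + 2 - u) * sh (n + 2 - u) * (ch (m + u) * sh (n + u))"
  have key: "(M1 - M2) / ch (y + 2) + (M3 - M4) / ch (y - 2) = - (sh x * ch x * ch y)"
    using serre_key[of m u n v] unfolding M1_M2_M3_M4_def xy .
  have ret: "- M2 / (ch (x - 2) * ch (y + 2) * (ch x * ch y)) * (\<i> * ch (x - 2)) +
      - M3 / (ch (x + 2) * ch (y - 2) * (ch x * ch y)) * - (\<i> * ch (x + 2)) +
      - M4 / (ch (x - 2) * ch (y - 2) * (ch x * ch y)) * (\<i> * ch (x - 2)) +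
      - M1 / (ch (x + 2) * ch (y + 2) * (ch x * ch y)) * - (\<i> * ch (x + 2)) = - (\<i> * sh x)"
    (is "?L = _")
  proof -
    have "?L = \<i> * ((M1 - M2) / ch (y + 2) + (M3 - M4) / ch (y - 2)) / (ch x * ch y)"
      by (simp add: add_divide_distrib diff_divide_distrib algebra_simps)
    also have "\<dots> = - (\<i> * sh x)" unfolding key by simp
    finally show ?thesis .
  qed
  show ?thesis
    unfolding I32_op_def
    apply (rule lattice_op_serre; (simp only: weight_shift i_sh_recurrence e add_0_right mult_zero_right
        diff_add_cancel add_diff_cancel)?)
    \<comment> \<open>The numerator of \<open>G1\<close> depends on \<open>c\<close> only and that
      of \<open>G4\<close> on \<open>a\<close> only. Once each defect \<open>ch\<close> has
      cancelled a denominator, the two orders of the steps contribute the same product with opposite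
      signs.\<close>
    subgoal by (simp add: G1_def G4_def)
    subgoal by (simp add: G2_def G3_def)
    subgoal using ret unfolding x_y_u_v_def M1_M2_M3_M4_def G_return_products .
    done
qed

text \<open>On \<open>wminus\<close> the opposite steps are paired differently: the mixed
  displacements that survive the recurrence are those of \<open>e_2, e_1\<close> and of
  \<open>f_2, f_1\<close>.\<close>

lemma I32_op_serre_minus:
  "(\<i> * sh (wminus n m a c)) * I32_op n m (I32_op n m f) a c
    - (q + inverse q) * I32_op n m (\<lambda>a c. (\<i> * sh (wminus n m a c)) * I32_op n m f a c) a c
    + I32_op n m (I32_op n m (\<lambda>a c. (\<i> * sh (wminus n m a c)) * f a c)) a c
    = - ((\<i> * sh (wminus n m a c)) * f a c)"
proof -
  have e: "x - 2 - 2 = x - 4" "x + 2 + 2 = x + 4" for x :: int by simp_all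
  define x y u v where "x = wplus n m a c" "y = wminus n m a c" "u = 2 * a - n" "v = 2 * c - m"
  have xy: "x = u + v" "y = u - v" by (simp_all add: x_y_u_v_def wplus_def wminus_def)
  define M1 M2 M3 M4 where
    "M1 = ch (m + 2 + u) * sh (n + 2 + u) * (ch (m - u) * sh (n - u))"
    "M2 = ch (n + 2 - v) * sh (m + 2 - v) * (ch (n + v) * sh (m + v))"
    "M3 = ch (n + 2 + v) * sh (m + 2 + v) * (ch (n - v) * sh (m - v))"
    "M4 = ch (m + 2 - u) * sh (n + 2 - u) * (ch (m + u) * sh (n + u))"
  have key: "(M1 - M3) / ch (x + 2) + (M2 - M4) / ch (x - 2) = - (sh y * ch y * ch x)"
    using serre_key[of m u n "- v"] unfolding M1_M2_M3_M4_def xy by simp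
  have ret: "- M2 / (ch (x - 2) * ch (y + 2) * (ch x * ch y)) * - (\<i> * ch (y + 2)) +
      - M3 / (ch (x + 2) * ch (y - 2) * (ch x * ch y)) * (\<i> * ch (y - 2)) +
      - M4 / (ch (x - 2) * ch (y - 2) * (ch x * ch y)) * (\<i> * ch (y - 2)) +
      - M1 / (ch (x + 2) * ch (y + 2) * (ch x * ch y)) * - (\<i> * ch (y + 2)) = - (\<i> * sh y)"
    (is "?L = _")
  proof -
    have "?L = \<i> * ((M1 - M3) / ch (x + 2) + (M2 - M4) / ch (x - 2)) / (ch x * ch y)"
      by (simp add: add_divide_distrib diff_divide_distrib algebra_simps)
    also have "\<dots> = - (\<i> * sh y)" unfolding key by simp
    finally show ?thesis .
  qed
  show ?thesis
    unfolding I32_op_def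
    apply (rule lattice_op_serre; (simp only: weight_shift i_sh_recurrence e add_0_right mult_zero_right
        diff_add_cancel add_diff_cancel)?)
    subgoal by (simp add: G1_def G3_def)
    subgoal by (simp add: G2_def G4_def)
    subgoal using ret unfolding x_y_u_v_def M1_M2_M3_M4_def G_return_products .
    done
qed

end

section \<open>The representations of the extended tensor square\<close>

text \<open>Tensoring with an identity respects scalars, sums and products, so relations and the
  Casimir value known for one \<open>sl_2\<close> carry over to each copy.\<close>

lemma eval_term_kron_one_right:
  assumes V: "matrix_rep V"
  shows "eval_term (Rep (rdim V * m) (\<lambda>g. kron (act V g) (1\<^sub>m m))) t = kron (eval_term V t) (1\<^sub>m m)"
proof (induction t)
  case (Scal x)
  show ?case by (simp add: kron_smult_left kron_one)
next
  case (Add s t)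
  thus ?case
    using kron_add_left[OF eval_term_carrier[OF V, of s] eval_term_carrier[OF V, of t] one_carrier_mat]
    by simp
next
  case (Mul s t)
  thus ?case
    using kron_mult[OF eval_term_carrier[OF V, of s] one_carrier_mat eval_term_carrier[OF V, of t] one_carrier_mat]
    by simp
qed simp

lemma eval_term_kron_one_left:
  assumes V: "matrix_rep V"
  shows "eval_term (Rep (n * rdim V) (\<lambda>g. kron (1\<^sub>m n) (act V g))) t = kron (1\<^sub>m n) (eval_term V t)"
proof (induction t)
  case (Scal x)
  show ?case by (simp add: kron_smult_right kron_one)
next
  case (Add s t)
  thus ?case
    using kron_add_right[OF one_carrier_mat eval_term_carrier[OF V, of s] eval_term_carrier[OF V, of t]]
    by simp
next
  case (Mul s t)
  thus ?case
    using kron_mult[OF one_carrier_mat eval_term_carrier[OF V, of s] one_carrier_mat eval_term_carrier[OF V, of t]]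
    by simp
qed simp

lemma kron_one_left_mult_vec:
  assumes B: "B \<in> carrier_mat m m" and v: "v \<in> carrier_vec (n * m)" and ac: "a < n" "c < m"
  shows "(kron (1\<^sub>m n) B *\<^sub>v v) $ (a * m + c) = (\<Sum>c'<m. B $$ (c, c') * v $ (a * m + c'))"
proof -
  have "(kron (1\<^sub>m n) B *\<^sub>v v) $ (a * m + c) =
      (\<Sum>a'<n. \<Sum>c'<m. 1\<^sub>m n $$ (a, a') * B $$ (c, c') * v $ (a' * m + c'))"
    by (rule kron_mult_vec[OF one_carrier_mat B v ac])
  also have "\<dots> = (\<Sum>a'<n. if a' = a then \<Sum>c'<m. B $$ (c, c') * v $ (a * m + c') else 0)"
    using ac by (intro sum.cong) auto
  finally show ?thesis using ac by simp
qed

lemma kron_one_right_mult_vec: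
  assumes A: "A \<in> carrier_mat n n" and v: "v \<in> carrier_vec (n * m)" and ac: "a < n" "c < m"
  shows "(kron A (1\<^sub>m m) *\<^sub>v v) $ (a * m + c) = (\<Sum>a'<n. A $$ (a, a') * v $ (a' * m + c))"
proof -
  have "(kron A (1\<^sub>m m) *\<^sub>v v) $ (a * m + c) =
      (\<Sum>a'<n. \<Sum>c'<m. A $$ (a, a') * 1\<^sub>m m $$ (c, c') * v $ (a' * m + c'))"
    by (rule kron_mult_vec[OF A one_carrier_mat v ac])
  also have "\<dots> = (\<Sum>a'<n. \<Sum>c'<m. if c' = c then A $$ (a, a') * v $ (a' * m + c') else 0)"
    using ac by (intro sum.cong refl) auto
  finally show ?thesis using ac by simp
qed

context generic_q
begin

definition base_rep :: "nat \<Rightarrow> nat \<Rightarrow> (copy \<times> sl2_gen) rep" where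
  "base_rep n m = Rep (Suc n * Suc m) (\<lambda>(i, g). case i of
      C1 \<Rightarrow> kron (Tmat n g) (1\<^sub>m (Suc m))
    | C2 \<Rightarrow> kron (1\<^sub>m (Suc n)) (Tmat m g))"

definition xval :: "nat \<Rightarrow> nat \<Rightarrow> copy \<Rightarrow> complex" where
  "xval n m i = (case i of C1 \<Rightarrow> p powi (- int n) | C2 \<Rightarrow> p powi (- int m))"

lemma xval_nonzero [simp]: "xval n m i \<noteq> 0"
  by (cases i) (simp_all add: xval_def)

definition TT :: "nat \<Rightarrow> nat \<Rightarrow> ext_gen rep" where
  "TT n m = extend_rep p (base_rep n m) (\<lambda>i. mat_diag (Suc n * Suc m) (\<lambda>_. xval n m i))"

lemma TT_rep_half: "TT_rep p (of_nat n / 2) (of_nat m / 2) = TT n m"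
proof -
  have half: "qpow p (- (of_nat k / 2)) = p powi (- int k)" for k
    using qpow_half[of "- int k"] by simp
  have x: "(\<lambda>i. case i of C1 \<Rightarrow> p powi (- int n) \<cdot>\<^sub>m 1\<^sub>m (Suc n * Suc m)
      | C2 \<Rightarrow> p powi (- int m) \<cdot>\<^sub>m 1\<^sub>m (Suc n * Suc m)) = (\<lambda>i. mat_diag (Suc n * Suc m) (\<lambda>_. xval n m i))"
    by (auto simp: fun_eq_iff xval_def smult_one_mat_diag split: copy.splits)
  show ?thesis
    unfolding TT_rep_def T_rep_half Let_def half TT_def base_rep_def rep.sel x ..
qed

lemma rdim_base_rep [simp]: "rdim (base_rep n m) = Suc n * Suc m" by (simp add: base_rep_def)

lemma rdim_TT [simp]: "rdim (TT n m) = Suc n * Suc m" by (simp add: TT_def extend_rep_def)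

lemma act_base_rep:
  "act (base_rep n m) (C1, g) = kron (Tmat n g) (1\<^sub>m (Suc m))"
  "act (base_rep n m) (C2, g) = kron (1\<^sub>m (Suc n)) (Tmat m g)"
  by (simp_all add: base_rep_def)

lemma base_rep_matrix_rep: "matrix_rep (base_rep n m)"
  unfolding matrix_rep_def
proof
  fix ig :: "copy \<times> sl2_gen"
  obtain i g where "ig = (i, g)" by force
  thus "act (base_rep n m) ig \<in> carrier_mat (rdim (base_rep n m)) (rdim (base_rep n m))"
    by (cases i) (auto simp: act_base_rep intro!: kron_carrier)
qed

lemma base_rep_carrier: "act (base_rep n m) g \<in> carrier_mat (Suc n * Suc m) (Suc n * Suc m)"
  using base_rep_matrix_rep[of n m] unfolding matrix_rep_def by (metis rdim_base_rep)

lemma T_matrix_rep: "matrix_rep (Rep (Suc n) (Tmat n))"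
  by (simp add: matrix_rep_def)

lemma eval_base_rep:
  "eval_term (Rep (Suc n * Suc m) (\<lambda>g. act (base_rep n m) (C1, g))) t =
    kron (eval_term (Rep (Suc n) (Tmat n)) t) (1\<^sub>m (Suc m))"
  "eval_term (Rep (Suc n * Suc m) (\<lambda>g. act (base_rep n m) (C2, g))) t =
    kron (1\<^sub>m (Suc n)) (eval_term (Rep (Suc m) (Tmat m)) t)"
  using eval_term_kron_one_right[OF T_matrix_rep, of n "Suc m" t]
    eval_term_kron_one_left[OF T_matrix_rep, of "Suc n" m t]
  by (simp_all add: act_base_rep)

definition spin :: "nat \<Rightarrow> nat \<Rightarrow> copy \<Rightarrow> nat" where
  "spin n m i = (case i of C1 \<Rightarrow> n | C2 \<Rightarrow> m)"

lemma casimir_base_rep: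
  "eval_term (base_rep n m) (map_alg_term (Pair i) (casimir p)) = cas (int (spin n m i)) \<cdot>\<^sub>m 1\<^sub>m (Suc n * Suc m)"
  by (cases i)
    (simp_all add: eval_map_alg_term eval_base_rep casimir_T_rep kron_smult_left kron_smult_right kron_one spin_def)

definition wp :: "nat \<Rightarrow> nat \<Rightarrow> sign \<Rightarrow> nat \<Rightarrow> int" where
  "wp n m \<sigma> t = (case \<sigma> of Plus \<Rightarrow> wplus (int n) (int m) (int (t div Suc m)) (int (t mod Suc m))
     | Minus \<Rightarrow> wminus (int n) (int m) (int (t div Suc m)) (int (t mod Suc m)))"

lemma act_base_rep_K:
  "act (base_rep n m) (C1, K_gen) = mat_diag (Suc n * Suc m) (\<lambda>t. p powi (2 * int (t div Suc m) - int n))"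
  "act (base_rep n m) (C1, Kinv_gen) = mat_diag (Suc n * Suc m) (\<lambda>t. p powi (int n - 2 * int (t div Suc m)))"
  "act (base_rep n m) (C2, K_gen) = mat_diag (Suc n * Suc m) (\<lambda>t. p powi (2 * int (t mod Suc m) - int m))"
  "act (base_rep n m) (C2, Kinv_gen) = mat_diag (Suc n * Suc m) (\<lambda>t. p powi (int m - 2 * int (t mod Suc m)))"
  using kron_mat_diag[of "Suc n" _ "Suc m" "\<lambda>_. 1"] kron_mat_diag[of "Suc n" "\<lambda>_. 1" "Suc m"]
  by (simp_all add: act_base_rep Kmat_def Lmat_def)

lemma qpow_minus_of_int: "qpow p (- of_int r) = q powi (- r)"
  using qpow_of_int[of "- r"] by simp

lemma eval_denom_base_rep:
  "eval_term (base_rep n m) (denom p \<sigma> r) = mat_diag (Suc n * Suc m) (\<lambda>t. ch (2 * r + wp n m \<sigma> t))"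
proof (cases \<sigma>)
  case Plus
  show ?thesis
    unfolding Plus denom.simps alg_term_ops eval_term.simps act_base_rep_K rdim_base_rep smult_one_mat_diag
      mat_diag_diag mat_diag_add qpow_of_int qpow_minus_of_int powi_even[symmetric] ch_def
    by (rule mat_diag_cong) (simp add: wp_def wplus_def algebra_simps flip: power_int_add)
next
  case Minus
  show ?thesis
    unfolding Minus denom.simps alg_term_ops eval_term.simps act_base_rep_K rdim_base_rep smult_one_mat_diag
      mat_diag_diag mat_diag_add qpow_of_int qpow_minus_of_int powi_even[symmetric] ch_def
    by (rule mat_diag_cong) (simp add: wp_def wminus_def algebra_simps flip: power_int_add)
qed

lemma act_TT [simp]:
  "act (TT n m) (Sl2 i g) = act (base_rep n m) (i, g)"
  "act (TT n m) (X_gen i) = mat_diag (Suc n * Suc m) (\<lambda>_. xval n m i)"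
  "act (TT n m) (Xinv_gen i) = mat_diag (Suc n * Suc m) (\<lambda>_. 1 / xval n m i)"
  "act (TT n m) (Dinv_gen \<sigma> r) = mat_diag (Suc n * Suc m) (\<lambda>t. 1 / ch (2 * r + wp n m \<sigma> t))"
  by (simp_all add: TT_def extend_rep_def eval_denom_base_rep mat_inverse_mat_diag)

lemma TT_matrix_rep: "matrix_rep (TT n m)"
  unfolding matrix_rep_def
proof
  fix g show "act (TT n m) g \<in> carrier_mat (rdim (TT n m)) (rdim (TT n m))"
    using base_rep_matrix_rep[of n m] by (cases g) (auto simp: matrix_rep_def)
qed

lemma eval_TT_base:
  "eval_term (TT n m) (map_alg_term (\<lambda>(i, g). Sl2 i g) t) = eval_term (base_rep n m) t"
proof -
  have "Rep (rdim (TT n m)) (\<lambda>ig. act (TT n m) (case ig of (i, g) \<Rightarrow> Sl2 i g)) = base_rep n m"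
    by (simp add: base_rep_def case_prod_unfold base_rep_def[symmetric])
  thus ?thesis by (simp add: eval_map_alg_term)
qed

lemma alg_term_power4: "t ^ 4 = Mul t (Mul t (Mul t (Mul t (Scal 1))))"
  by (simp add: eval_nat_numeral times_alg_term_def one_alg_term_def)

lemma TT_is_rep: "is_rep (ext_rels p) (TT n m)"
proof -
  let ?N = "Suc n * Suc m"
  have sl2: "eval_term (TT n m) (map_alg_term (Sl2 i) s) = eval_term (TT n m) (map_alg_term (Sl2 i) t)"
    if "(s, t) \<in> sl2_rels p" for i s t
  proof -
    have "eval_term (Rep (Suc k) (Tmat k)) s = eval_term (Rep (Suc k) (Tmat k)) t" for k
      using T_rep_is_rep[of k] that by (auto simp: is_rep_def)
    thus ?thesis by (cases i) (simp_all add: eval_map_alg_term eval_base_rep)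
  qed
  have comm: "act (base_rep n m) (C1, g) * act (base_rep n m) (C2, h) = act (base_rep n m) (C2, h) * act (base_rep n m) (C1, g)"
    for g h by (simp add: act_base_rep kron_mult_dim)
  have Xcomm: "mat_diag ?N (\<lambda>_. x) * A = A * mat_diag ?N (\<lambda>_. x)" if "A \<in> carrier_mat ?N ?N"
    for x :: complex and A
    unfolding smult_one_mat_diag[symmetric] using that by (simp add: smult_one_mult[of _ ?N ?N])
  \<comment> \<open>As a quadratic equation in \<open>x^2\<close> this has the roots
    \<open>q powi (- k)\<close> and \<open>q powi (k + 2)\<close>; the chosen operator belongs to
    the first.\<close>
  have quartic: "inverse q * (x * (x * (x * x))) + - 1 * (cas (int k) * qd ^ 2 * (x * x)) + q = 0"
    if "x = p powi (- int k)" for x k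
  proof -
    have "x * x = q powi (- int k)" unfolding that by (simp flip: power_int_add powi_even)
    hence "inverse q * (x * (x * (x * x))) + - 1 * (cas (int k) * qd ^ 2 * (x * x)) + q =
        inverse q * (q powi (- int k) * q powi (- int k))
          - (q powi (int k + 1) + q powi (- int k - 1)) * q powi (- int k) + q"
      by (simp add: cas_def mult.assoc flip: mult.assoc[of x x])
    also have "\<dots> = 0"
      by (simp add: power_int_add power_int_diff power_int_minus field_simps)
    finally show ?thesis .
  qed
  have cas_eval: "eval_term (TT n m) (map_alg_term (Sl2 i) (casimir p)) =
      mat_diag ?N (\<lambda>_. cas (int (spin n m i)))" for i
    using casimir_base_rep[of n m i] by (simp add: eval_map_alg_term smult_one_mat_diag)
  have quartic': "eval_term (TT n m) (Scal (qpow p (- 1)) * Gen (X_gen i) ^ 4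
         - map_alg_term (Sl2 i) (casimir p) * Scal ((qpow p 1 - qpow p (- 1)) ^ 2) * Gen (X_gen i) ^ 2
         + Scal (qpow p 1)) = eval_term (TT n m) (Scal 0)" for i
    unfolding alg_term_ops alg_term_power4 eval_term.simps cas_eval act_TT rdim_TT smult_one_mat_diag
      mat_diag_diag mat_diag_add qpow_1 qd_def[symmetric] mult_1_right
    by (rule mat_diag_cong, rule quartic) (cases i; simp add: xval_def spin_def)
  show ?thesis
    unfolding is_rep_def
  proof (intro conjI allI ballI)
    show "act (TT n m) g \<in> carrier_mat (rdim (TT n m)) (rdim (TT n m))" for g
      using TT_matrix_rep by (simp add: matrix_rep_def)
    fix st assume "st \<in> ext_rels p"
    thus "case st of (s, t) \<Rightarrow> eval_term (TT n m) s = eval_term (TT n m) t"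
      unfolding ext_rels_def
      apply (elim UnE CollectE exE conjE insertE emptyE; simp only: prod.case)
      subgoal by (rule sl2)
      subgoal by (simp add: times_alg_term_def comm)
      subgoal using base_rep_matrix_rep[of n m] by (simp add: times_alg_term_def Xcomm matrix_rep_def)
      subgoal by (simp add: times_alg_term_def mult.commute)
      subgoal by (rule quartic')
      subgoal by (simp add: times_alg_term_def one_alg_term_def one_smult_mat)
      subgoal by (simp add: times_alg_term_def one_alg_term_def one_smult_mat)
      subgoal by (simp add: times_alg_term_def one_alg_term_def one_smult_mat eval_TT_base eval_denom_base_rep)
      subgoal by (simp add: times_alg_term_def one_alg_term_def one_smult_mat eval_TT_base eval_denom_base_rep)
      done
  qed
qed

end

section \<open>The representations \<open>R\<close> of \<open>U'\<^sub>q(so\<^sub>4)\<close>\<close>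

lemma mat_eq_on_vecs:
  fixes A B :: "complex mat"
  assumes A: "A \<in> carrier_mat n m" and B: "B \<in> carrier_mat n m"
    and eq: "\<And>v. v \<in> carrier_vec m \<Longrightarrow> A *\<^sub>v v = B *\<^sub>v v"
  shows "A = B"
proof (rule eq_matI)
  fix i j assume "i < dim_row B" "j < dim_col B"
  hence ij: "i < n" "j < m" using B by auto
  have "(A *\<^sub>v unit_vec m j) $ i = (B *\<^sub>v unit_vec m j) $ i" using eq[of "unit_vec m j"] by simp
  thus "A $$ (i, j) = B $$ (i, j)" using A B ij by simp
qed (use A B in auto)

context generic_q
begin

text \<open>Coordinate vectors are extended by zero to the whole lattice. There the Serre relations hold
  without boundary terms, because the coefficients leading out of the box vanish.\<close>

definition lfun :: "nat \<Rightarrow> nat \<Rightarrow> complex vec \<Rightarrow> int \<Rightarrow> int \<Rightarrow> complex" where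
  "lfun n m v a c = (if 0 \<le> a \<and> a \<le> int n \<and> 0 \<le> c \<and> c \<le> int m
     then v $ (nat a * Suc m + nat c) else 0)"

lemma lfun_inside: "a < Suc n \<Longrightarrow> c < Suc m \<Longrightarrow> lfun n m v (int a) (int c) = v $ (a * Suc m + c)"
  by (simp add: lfun_def)

lemma lfun_outside: "\<not> (0 \<le> a \<and> a \<le> int n \<and> 0 \<le> c \<and> c \<le> int m) \<Longrightarrow> lfun n m v a c = 0"
  unfolding lfun_def by (rule if_not_P)

lemma pair_index_cases:
  assumes "t < Suc n * Suc m"
  obtains a c where "t = a * Suc m + c" "a < Suc n" "c < Suc m"
  using div_mod_less_of_less_mult[OF assms] by (metis div_mult_mod_eq)

lemma box_cases:
  assumes "0 \<le> a \<and> a \<le> int n \<and> 0 \<le> c \<and> c \<le> int m"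
  obtains a' c' where "a = int a'" "c = int c'" "a' < Suc n" "c' < Suc m"
  using assms that[of "nat a" "nat c"] by auto

lemma lfun_eqI:
  assumes v: "v \<in> carrier_vec (Suc n * Suc m)" and w: "w \<in> carrier_vec (Suc n * Suc m)"
    and eq: "\<And>a c. lfun n m v a c = lfun n m w a c"
  shows "v = w"
proof (rule eq_vecI)
  fix t assume "t < dim_vec w"
  hence "t < Suc n * Suc m" using w by simp
  then obtain a c where "t = a * Suc m + c" "a < Suc n" "c < Suc m" by (rule pair_index_cases)
  thus "v $ t = w $ t" using eq[of "int a" "int c"] by (simp add: lfun_inside)
qed (use v w in auto)

lemma lfun_add:
  assumes "v \<in> carrier_vec (Suc n * Suc m)" "w \<in> carrier_vec (Suc n * Suc m)"
  shows "lfun n m (v + w) = (\<lambda>a c. lfun n m v a c + lfun n m w a c)"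
proof (intro ext)
  fix a c
  show "lfun n m (v + w) a c = lfun n m v a c + lfun n m w a c"
  proof (cases "0 \<le> a \<and> a \<le> int n \<and> 0 \<le> c \<and> c \<le> int m")
    case True
    then obtain a' c' where "a = int a'" "c = int c'" "a' < Suc n" "c' < Suc m" by (rule box_cases)
    thus ?thesis using assms pair_index_less[of a' "Suc n" c' "Suc m"] by (simp add: lfun_inside)
  next
    case False
    show ?thesis by (simp add: lfun_outside[OF False])
  qed
qed

lemma lfun_smult:
  assumes "v \<in> carrier_vec (Suc n * Suc m)"
  shows "lfun n m (x \<cdot>\<^sub>v v) = (\<lambda>a c. x * lfun n m v a c)"
proof (intro ext)
  fix a c
  show "lfun n m (x \<cdot>\<^sub>v v) a c = x * lfun n m v a c"
  proof (cases "0 \<le> a \<and> a \<le> int n \<and> 0 \<le> c \<and> c \<le> int m")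
    case True
    then obtain a' c' where "a = int a'" "c = int c'" "a' < Suc n" "c' < Suc m" by (rule box_cases)
    thus ?thesis using assms pair_index_less[of a' "Suc n" c' "Suc m"] by (simp add: lfun_inside)
  next
    case False
    show ?thesis by (simp add: lfun_outside[OF False])
  qed
qed

lemma shift_mult_vec:
  assumes v: "v \<in> carrier_vec (Suc n * Suc m)" and ac: "a < Suc n" "c < Suc m"
  shows "(act (base_rep n m) (C2, E_gen) *\<^sub>v v) $ (a * Suc m + c) = qn (int m - int c + 1) * lfun n m v (int a) (int c - 1)"
    "(act (base_rep n m) (C2, F_gen) *\<^sub>v v) $ (a * Suc m + c) = qn (int c + 1) * lfun n m v (int a) (int c + 1)"
    "(act (base_rep n m) (C1, E_gen) *\<^sub>v v) $ (a * Suc m + c) = qn (int n - int a + 1) * lfun n m v (int a - 1) (int c)"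
    "(act (base_rep n m) (C1, F_gen) *\<^sub>v v) $ (a * Suc m + c) = qn (int a + 1) * lfun n m v (int a + 1) (int c)"
proof goal_cases
  case 1
  show ?case
  proof (cases c)
    case 0
    thus ?thesis unfolding act_base_rep Tmat_simps kron_one_left_mult_vec[OF Tmat_carrier(1) v ac]
      using ac by (simp add: Emat_def lfun_outside del: sum.lessThan_Suc)
  next
    case (Suc c0)
    have "(\<Sum>c'<Suc m. Emat m $$ (c, c') * v $ (a * Suc m + c')) =
        (\<Sum>c'<Suc m. if c' = c0 then qn (int m - int c0) * v $ (a * Suc m + c') else 0)"
      using ac Suc by (intro sum.cong) (auto simp: Emat_def)
    thus ?thesis unfolding act_base_rep Tmat_simps kron_one_left_mult_vec[OF Tmat_carrier(1) v ac]
      using ac Suc lfun_inside[of a n c0 m v] by (simp del: sum.lessThan_Suc)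
  qed
next
  case 2
  show ?case
  proof -
    have "(\<Sum>c'<Suc m. Fmat m $$ (c, c') * v $ (a * Suc m + c')) =
        (\<Sum>c'<Suc m. if c' = Suc c then qn (int c + 1) * v $ (a * Suc m + c') else 0)"
      using ac by (intro sum.cong) (auto simp: Fmat_def add.commute)
    also have "\<dots> = qn (int c + 1) * lfun n m v (int a) (int c + 1)"
      using ac lfun_inside[of a n "Suc c" m v]
      by (cases "Suc c < Suc m") (simp_all add: lfun_outside add.commute del: sum.lessThan_Suc)
    finally show ?thesis unfolding act_base_rep Tmat_simps kron_one_left_mult_vec[OF Tmat_carrier(2) v ac] .
  qed
next
  case 3
  show ?case
  proof (cases a)
    case 0
    thus ?thesis unfolding act_base_rep Tmat_simps kron_one_right_mult_vec[OF Tmat_carrier(1) v ac]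
      using ac by (simp add: Emat_def lfun_outside del: sum.lessThan_Suc)
  next
    case (Suc a0)
    have "(\<Sum>a'<Suc n. Emat n $$ (a, a') * v $ (a' * Suc m + c)) =
        (\<Sum>a'<Suc n. if a' = a0 then qn (int n - int a0) * v $ (a' * Suc m + c) else 0)"
      using ac Suc by (intro sum.cong) (auto simp: Emat_def)
    thus ?thesis unfolding act_base_rep Tmat_simps kron_one_right_mult_vec[OF Tmat_carrier(1) v ac]
      using ac Suc lfun_inside[of a0 n c m v] by (simp del: sum.lessThan_Suc)
  qed
next
  case 4
  show ?case
  proof -
    have "(\<Sum>a'<Suc n. Fmat n $$ (a, a') * v $ (a' * Suc m + c)) =
        (\<Sum>a'<Suc n. if a' = Suc a then qn (int a + 1) * v $ (a' * Suc m + c) else 0)"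
      using ac by (intro sum.cong) (auto simp: Fmat_def add.commute)
    also have "\<dots> = qn (int a + 1) * lfun n m v (int a + 1) (int c)"
      using ac lfun_inside[of "Suc a" n c m v]
      by (cases "Suc a < Suc n") (simp_all add: lfun_outside add.commute del: sum.lessThan_Suc)
    finally show ?thesis unfolding act_base_rep Tmat_simps kron_one_right_mult_vec[OF Tmat_carrier(2) v ac] .
  qed
qed

definition RR :: "nat \<Rightarrow> nat \<Rightarrow> so4_gen rep" where "RR n m = pullback_rep (phi p) (TT n m)"

lemma R_rep_half: "R_rep p (of_nat n / 2) (of_nat m / 2) = RR n m"
  by (simp add: R_rep_def RR_def TT_rep_half)

lemma rdim_RR [simp]: "rdim (RR n m) = Suc n * Suc m"
  by (simp add: RR_def pullback_rep_def)

lemma RR_matrix_rep: "matrix_rep (RR n m)"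
  unfolding RR_def by (rule pullback_rep_matrix_rep[OF TT_matrix_rep])

lemma RR_carrier [simp]: "act (RR n m) g \<in> carrier_mat (Suc n * Suc m) (Suc n * Suc m)"
  using RR_matrix_rep[of n m] by (simp add: matrix_rep_def)

lemma act_RR_diag:
  "act (RR n m) I21 = mat_diag (Suc n * Suc m) (\<lambda>t. \<i> * sh (wp n m Plus t))"
  "act (RR n m) I43 = mat_diag (Suc n * Suc m) (\<lambda>t. \<i> * sh (wp n m Minus t))"
proof -
  have e: "- wplus n m a c = (n - 2 * a) + (m - 2 * c)" "- wminus n m a c = (n - 2 * a) + (2 * c - m)"
    "wminus n m a c = (2 * a - n) + (m - 2 * c)" for n m a c
    by (simp_all add: wplus_def wminus_def)
  show "act (RR n m) I21 = mat_diag (Suc n * Suc m) (\<lambda>t. \<i> * sh (wp n m Plus t))"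
    unfolding RR_def pullback_rep_def rep.sel phi.simps alg_term_ops eval_term.simps act_TT act_base_rep_K
      rdim_TT smult_one_mat_diag mat_diag_diag mat_diag_add qpow_1 qd_def[symmetric] sh_def wp_def sign.case e
    unfolding wplus_def by (rule mat_diag_cong) (simp add: power_int_add)
  show "act (RR n m) I43 = mat_diag (Suc n * Suc m) (\<lambda>t. \<i> * sh (wp n m Minus t))"
    unfolding RR_def pullback_rep_def rep.sel phi.simps alg_term_ops eval_term.simps act_TT act_base_rep_K
      rdim_TT smult_one_mat_diag mat_diag_diag mat_diag_add qpow_1 qd_def[symmetric] sh_def wp_def sign.case e(2)
    unfolding e(3) by (rule mat_diag_cong) (simp add: power_int_add)
qed

lemma act_RR_I32:
  "act (RR n m) I32 =
     mat_diag (Suc n * Suc m) (\<lambda>t. - (ch (int n + 2 - (2 * int (t mod Suc m) - int m))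
        / (ch (wp n m Plus t - 2) * ch (wp n m Minus t + 2)))) * act (base_rep n m) (C2, E_gen)
   + mat_diag (Suc n * Suc m) (\<lambda>t. ch (int n + 2 + (2 * int (t mod Suc m) - int m))
        / (ch (wp n m Plus t + 2) * ch (wp n m Minus t - 2))) * act (base_rep n m) (C2, F_gen)
   + mat_diag (Suc n * Suc m) (\<lambda>t. ch (int m + 2 - (2 * int (t div Suc m) - int n))
        / (ch (wp n m Plus t - 2) * ch (wp n m Minus t - 2))) * act (base_rep n m) (C1, E_gen)
   + mat_diag (Suc n * Suc m) (\<lambda>t. - (ch (int m + 2 + (2 * int (t div Suc m) - int n))
        / (ch (wp n m Plus t + 2) * ch (wp n m Minus t + 2)))) * act (base_rep n m) (C1, F_gen)"
proof -
  let ?N = "Suc n * Suc m"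
  note T = base_rep_carrier[of n m]
  have neg: "mat_diag ?N (\<lambda>_. - 1) * (mat_diag ?N f * act (base_rep n m) g) = mat_diag ?N (\<lambda>t. - f t) * act (base_rep n m) g"
    for f g
  proof -
    have "mat_diag ?N (\<lambda>_. - 1) * (mat_diag ?N f * act (base_rep n m) g) =
        (mat_diag ?N (\<lambda>_. - 1) * mat_diag ?N f) * act (base_rep n m) g"
      by (rule assoc_mult_mat[symmetric, OF mat_diag_dim mat_diag_dim T])
    thus ?thesis by simp
  qed
  \<comment> \<open>With \<open>x\<close> acting as \<open>p powi (- k)\<close>, a numerator of
    \<open>phi\<close> collapses to a single \<open>ch\<close>. Here \<open>w\<close> is the doubled
    weight in the copy opposite to \<open>x\<close>; the terms with \<open>f\<close> use
    \<open>- w\<close>.\<close>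
  have coef: "1 / p powi (- k) * (q * p powi (- w)) + p powi (- k) * (inverse q * p powi w) = ch (k + 2 - w)" for k w
    by (simp add: ch_def q_def power_int_add power_int_diff power_int_minus field_simps)
  have cc: "ch (2 + z) = ch (z + 2)" "ch (k + 2 - (l - z)) = ch (k + 2 + (z - l))" for k l z
    by (simp_all add: algebra_simps)
  have cong: "A + B + C + D = A' + B' + C' + D'" if "A = A'" "B = B'" "C = C'" "D = D'"
    for A A' B B' C C' D D' :: "complex mat" using that by simp
  have cong2: "mat_diag ?N f * M = mat_diag ?N g * M" if "\<And>t. t < ?N \<Longrightarrow> f t = g t" for f g :: "nat \<Rightarrow> complex" and M
    using that mat_diag_cong[of ?N f g] by simp
  show ?thesis
    unfolding RR_def pullback_rep_def rep.sel phi.simps alg_term_ops eval_term.simps act_TT act_base_rep_K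
      rdim_TT smult_one_mat_diag mat_diag_diag mat_diag_add qpow_1 neg
    apply (intro cong cong2)
    subgoal for t using coef[of "int n" "2 * int (t mod Suc m) - int m"]
      by (simp add: xval_def cc)
    subgoal for t using coef[of "int n" "- (2 * int (t mod Suc m) - int m)"]
      by (simp add: xval_def cc)
    subgoal for t using coef[of "int m" "2 * int (t div Suc m) - int n"]
      by (simp add: xval_def cc)
    subgoal for t using coef[of "int m" "- (2 * int (t div Suc m) - int n)"]
      by (simp add: xval_def cc)
    done
qed

lemma lfun_RR_diag:
  assumes v: "v \<in> carrier_vec (Suc n * Suc m)"
  shows "lfun n m (act (RR n m) I21 *\<^sub>v v) = (\<lambda>a c. (\<i> * sh (wplus (int n) (int m) a c)) * lfun n m v a c)"
    "lfun n m (act (RR n m) I43 *\<^sub>v v) = (\<lambda>a c. (\<i> * sh (wminus (int n) (int m) a c)) * lfun n m v a c)"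
proof -
  have *: "lfun n m (mat_diag (Suc n * Suc m) f *\<^sub>v v) a c = g a c * lfun n m v a c"
    if "\<And>a c. a < Suc n \<Longrightarrow> c < Suc m \<Longrightarrow> f (a * Suc m + c) = g (int a) (int c)" for f g a c
  proof (cases "0 \<le> a \<and> a \<le> int n \<and> 0 \<le> c \<and> c \<le> int m")
    case True
    then obtain a' c' where ac: "a = int a'" "c = int c'" "a' < Suc n" "c' < Suc m" by (rule box_cases)
    show ?thesis
      using mult_mat_diag_vec[OF v pair_index_less[OF ac(3,4)], of f] that[OF ac(3,4)] ac(3,4)
      unfolding ac(1,2) by (simp add: lfun_inside)
  next
    case False
    show ?thesis by (simp add: lfun_outside[OF False])
  qed
  show "lfun n m (act (RR n m) I21 *\<^sub>v v) = (\<lambda>a c. (\<i> * sh (wplus (int n) (int m) a c)) * lfun n m v a c)"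
    "lfun n m (act (RR n m) I43 *\<^sub>v v) = (\<lambda>a c. (\<i> * sh (wminus (int n) (int m) a c)) * lfun n m v a c)"
    unfolding act_RR_diag by (intro ext *; simp add: wp_def)+
qed

lemma lfun_RR_I32:
  assumes v: "v \<in> carrier_vec (Suc n * Suc m)"
  shows "lfun n m (act (RR n m) I32 *\<^sub>v v) = I32_op (int n) (int m) (lfun n m v)"
proof (intro ext)
  fix a c
  let ?N = "Suc n * Suc m"
  show "lfun n m (act (RR n m) I32 *\<^sub>v v) a c = I32_op (int n) (int m) (lfun n m v) a c"
  proof (cases "0 \<le> a \<and> a \<le> int n \<and> 0 \<le> c \<and> c \<le> int m")
    case True
    then obtain a' c' where ac: "a = int a'" "c = int c'" "a' < Suc n" "c' < Suc m" by (rule box_cases)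
    let ?t = "a' * Suc m + c'"
    have t: "?t < ?N" by (rule pair_index_less[OF ac(3,4)])
    have dm: "?t div Suc m = a'" "?t mod Suc m = c'" using ac by simp_all
    note T = base_rep_carrier[of n m]
    have *: "((mat_diag ?N f * act (base_rep n m) g) *\<^sub>v v) $ ?t = f ?t * (act (base_rep n m) g *\<^sub>v v) $ ?t" for f g
      using mult_mat_diag_vec[of "act (base_rep n m) g *\<^sub>v v" ?N ?t f] T[of g] t v
      by (simp add: assoc_mult_mat_vec[OF mat_diag_dim T v])
    have MT: "mat_diag ?N f * act (base_rep n m) g \<in> carrier_mat ?N ?N" for f g
      using mult_carrier_mat[OF mat_diag_dim T] .
    have add: "((A + B) *\<^sub>v v) $ ?t = (A *\<^sub>v v) $ ?t + (B *\<^sub>v v) $ ?t"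
      if "A \<in> carrier_mat ?N ?N" "B \<in> carrier_mat ?N ?N" for A B
      using add_mult_distrib_mat_vec[OF that v] that t by simp
    have **: "((A + B + C + D) *\<^sub>v v) $ ?t = (A *\<^sub>v v) $ ?t + (B *\<^sub>v v) $ ?t + (C *\<^sub>v v) $ ?t + (D *\<^sub>v v) $ ?t"
      if "A \<in> carrier_mat ?N ?N" "B \<in> carrier_mat ?N ?N" "C \<in> carrier_mat ?N ?N" "D \<in> carrier_mat ?N ?N" for A B C D
      using that by (simp only: add add_carrier_mat)
    have qs: "qn (int m - int c' + 1) = sh (int m + 2 - (2 * int c' - int m))"
      "qn (int c' + 1) = sh (int m + 2 + (2 * int c' - int m))"
      "qn (int n - int a' + 1) = sh (int n + 2 - (2 * int a' - int n))"
      "qn (int a' + 1) = sh (int n + 2 + (2 * int a' - int n))"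
      unfolding qn_eq_sh by (simp_all add: algebra_simps)
    have "lfun n m (act (RR n m) I32 *\<^sub>v v) a c = (act (RR n m) I32 *\<^sub>v v) $ ?t"
      using ac by (simp add: lfun_inside)
    also have "\<dots> = I32_op (int n) (int m) (lfun n m v) a c"
      unfolding act_RR_I32 **[OF MT MT MT MT] * shift_mult_vec[OF v ac(3,4)] dm wp_def sign.case
        I32_op_def lattice_op_def G1_def G2_def G3_def G4_def qs ac(1,2) by (simp add: mult.assoc)
    finally show ?thesis .
  next
    case False
    \<comment> \<open>These are the outer points reached by a step from the box. At any other outer
      point the neighbour in the direction considered is again outside, where \<open>lfun\<close>
      vanishes.\<close>
    have 1: "G1 (int n) (int m) a (int m + 1) = 0" "G2 (int n) (int m) a (- 1) = 0"
      "G3 (int n) (int m) (int n + 1) c = 0" "G4 (int n) (int m) (- 1) c = 0" for a c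
      by (simp_all add: G1_def G2_def G3_def G4_def sh_def)
    have "G1 (int n) (int m) a c * lfun n m v a (c - 1) = 0"
      using False 1(1)[of a] by (cases "c = int m + 1") (auto simp: lfun_def)
    moreover have "G2 (int n) (int m) a c * lfun n m v a (c + 1) = 0"
      using False 1(2)[of a] by (cases "c = - 1") (auto simp: lfun_def)
    moreover have "G3 (int n) (int m) a c * lfun n m v (a - 1) c = 0"
      using False 1(3)[of c] by (cases "a = int n + 1") (auto simp: lfun_def)
    moreover have "G4 (int n) (int m) a c * lfun n m v (a + 1) c = 0"
      using False 1(4)[of c] by (cases "a = - 1") (auto simp: lfun_def)
    ultimately show ?thesis
      by (simp only: I32_op_def lattice_op_def add_0_right lfun_outside[OF False])
  qed
qed

text \<open>The relations are tested on vectors and carried by \<open>lfun\<close> to the lattice,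
  where the identities for \<open>I32_op\<close> hold at every point.\<close>

lemma RR_is_rep: "is_rep (so4_rels p) (RR n m)"
proof -
  let ?N = "Suc n * Suc m"
  let ?k = "q + inverse q"
  have serre: "eval_term (RR n m) (Gen g * Gen h ^ 2 - Scal ?k * Gen h * Gen g * Gen h + Gen h ^ 2 * Gen g) =
      eval_term (RR n m) (- Gen g)"
    if *: "\<And>v a c. v \<in> carrier_vec ?N \<Longrightarrow>
      lfun n m (act (RR n m) g *\<^sub>v (act (RR n m) h *\<^sub>v (act (RR n m) h *\<^sub>v v))) a c
      - ?k * lfun n m (act (RR n m) h *\<^sub>v (act (RR n m) g *\<^sub>v (act (RR n m) h *\<^sub>v v))) a c
      + lfun n m (act (RR n m) h *\<^sub>v (act (RR n m) h *\<^sub>v (act (RR n m) g *\<^sub>v v))) a c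
      = - lfun n m (act (RR n m) g *\<^sub>v v) a c" for g h
  proof -
    define X Y where "X = act (RR n m) g" "Y = act (RR n m) h"
    have XY: "X \<in> carrier_mat ?N ?N" "Y \<in> carrier_mat ?N ?N" by (simp_all add: X_Y_def)
    have 1: "X * (Y * Y) + (- 1) \<cdot>\<^sub>m (?k \<cdot>\<^sub>m (Y * X * Y)) + Y * Y * X = (- 1) \<cdot>\<^sub>m X"
    proof (rule mat_eq_on_vecs[of _ ?N ?N])
      fix v :: "complex vec" assume v: "v \<in> carrier_vec ?N"
      have e: "(X * (Y * Y) + (- 1) \<cdot>\<^sub>m (?k \<cdot>\<^sub>m (Y * X * Y)) + Y * Y * X) *\<^sub>v v =
          X *\<^sub>v (Y *\<^sub>v (Y *\<^sub>v v)) + (- 1) \<cdot>\<^sub>v (?k \<cdot>\<^sub>v (Y *\<^sub>v (X *\<^sub>v (Y *\<^sub>v v)))) + Y *\<^sub>v (Y *\<^sub>v (X *\<^sub>v v))"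
        using XY v by (simp add: add_mult_distrib_mat_vec[of _ ?N ?N] smult_mat_mult_vec[of _ ?N ?N]
            assoc_mult_mat_vec[of _ ?N ?N _ ?N])
      show "(X * (Y * Y) + (- 1) \<cdot>\<^sub>m (?k \<cdot>\<^sub>m (Y * X * Y)) + Y * Y * X) *\<^sub>v v = ((- 1) \<cdot>\<^sub>m X) *\<^sub>v v"
        unfolding e smult_mat_mult_vec[OF XY(1) v]
      proof (rule lfun_eqI)
        fix a c
        show "lfun n m (X *\<^sub>v (Y *\<^sub>v (Y *\<^sub>v v)) + (- 1) \<cdot>\<^sub>v (?k \<cdot>\<^sub>v (Y *\<^sub>v (X *\<^sub>v (Y *\<^sub>v v)))) + Y *\<^sub>v (Y *\<^sub>v (X *\<^sub>v v))) a c =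
            lfun n m ((- 1) \<cdot>\<^sub>v (X *\<^sub>v v)) a c"
          using *[OF v, of a c] XY v unfolding X_Y_def[symmetric] by (simp add: lfun_add lfun_smult)
      qed (use XY v in auto)
    qed (use XY in auto)
    have e1: "(x \<cdot>\<^sub>m 1\<^sub>m ?N) * Z = x \<cdot>\<^sub>m Z" "Z * (x \<cdot>\<^sub>m 1\<^sub>m ?N) = x \<cdot>\<^sub>m Z"
      if "Z \<in> carrier_mat ?N ?N" for x and Z :: "complex mat"
      using smult_one_mult[OF that] by auto
    have "eval_term (RR n m) (Gen g * Gen h ^ 2 - Scal ?k * Gen h * Gen g * Gen h + Gen h ^ 2 * Gen g) =
        X * (Y * Y) + (- 1) \<cdot>\<^sub>m (?k \<cdot>\<^sub>m (Y * X * Y)) + Y * Y * X"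
      unfolding alg_term_ops eval_term.simps rdim_RR X_Y_def[symmetric]
      using XY by (simp add: e1 one_smult_mat mult_smult_assoc_mat[of _ ?N ?N _ ?N])
    moreover have "eval_term (RR n m) (- Gen g) = (- 1) \<cdot>\<^sub>m X"
      unfolding alg_term_ops eval_term.simps rdim_RR X_Y_def[symmetric] using XY by (simp add: e1)
    ultimately show ?thesis using 1 by simp
  qed
  have comm: "act (RR n m) I21 * act (RR n m) I43 = act (RR n m) I43 * act (RR n m) I21"
    unfolding act_RR_diag mat_diag_diag by (rule mat_diag_cong) simp
  have vc: "act (RR n m) g *\<^sub>v v \<in> carrier_vec ?N" if "v \<in> carrier_vec ?N" for g v
    using mult_mat_vec_carrier[OF RR_carrier that] .
  have 1: "eval_term (RR n m) (Gen I21 * Gen I32 ^ 2 - Scal ?k * Gen I32 * Gen I21 * Gen I32 + Gen I32 ^ 2 * Gen I21) =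
      eval_term (RR n m) (- Gen I21)"
    by (rule serre) (simp only: lfun_RR_diag lfun_RR_I32 vc I32_op_serre_plus)
  have 2: "eval_term (RR n m) (Gen I32 * Gen I21 ^ 2 - Scal ?k * Gen I21 * Gen I32 * Gen I21 + Gen I21 ^ 2 * Gen I32) =
      eval_term (RR n m) (- Gen I32)"
    by (rule serre) (simp only: lfun_RR_diag lfun_RR_I32 vc I32_op_serre')
  have 3: "eval_term (RR n m) (Gen I43 * Gen I32 ^ 2 - Scal ?k * Gen I32 * Gen I43 * Gen I32 + Gen I32 ^ 2 * Gen I43) =
      eval_term (RR n m) (- Gen I43)"
    by (rule serre) (simp only: lfun_RR_diag lfun_RR_I32 vc I32_op_serre_minus)
  have 4: "eval_term (RR n m) (Gen I32 * Gen I43 ^ 2 - Scal ?k * Gen I43 * Gen I32 * Gen I43 + Gen I43 ^ 2 * Gen I32) =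
      eval_term (RR n m) (- Gen I32)"
    by (rule serre) (simp only: lfun_RR_diag lfun_RR_I32 vc I32_op_serre')
  have 5: "eval_term (RR n m) (Gen I21 * Gen I43) = eval_term (RR n m) (Gen I43 * Gen I21)"
    using comm by (simp add: times_alg_term_def)
  show ?thesis
    unfolding is_rep_def so4_rels_def Let_def qpow_1 using 1 2 3 4 5 by simp
qed

section \<open>Irreducibility of a block\<close>

lemma weights_separate:
  assumes "r < Suc n * Suc m" "s < Suc n * Suc m" "r \<noteq> s"
  shows "wp n m Plus r \<noteq> wp n m Plus s \<or> wp n m Minus r \<noteq> wp n m Minus s"
proof (rule ccontr)
  assume "\<not> ?thesis"
  hence "int (r div Suc m) = int (s div Suc m)" "int (r mod Suc m) = int (s mod Suc m)"
    unfolding wp_def sign.case wplus_def wminus_def by linarith+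
  hence "r = s" by (metis div_mult_mod_eq of_nat_eq_iff)
  with assms show False by simp
qed

lemma lfun_unit_vec:
  assumes "a < Suc n" "c < Suc m"
  shows "lfun n m (unit_vec (Suc n * Suc m) (a * Suc m + c)) x y = (if x = int a \<and> y = int c then 1 else 0)"
proof (cases "0 \<le> x \<and> x \<le> int n \<and> 0 \<le> y \<and> y \<le> int m")
  case True
  then obtain a' c' where ac: "x = int a'" "y = int c'" "a' < Suc n" "c' < Suc m" by (rule box_cases)
  have "(a' * Suc m + c') div Suc m = a'" "(a' * Suc m + c') mod Suc m = c'"
    "(a * Suc m + c) div Suc m = a" "(a * Suc m + c) mod Suc m = c" using ac assms by simp_all
  hence "a' * Suc m + c' = a * Suc m + c \<longleftrightarrow> a' = a \<and> c' = c" by metis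
  thus ?thesis
    using ac pair_index_less[OF ac(3,4)] pair_index_less[OF assms] by (simp add: lfun_inside)
next
  case False
  show ?thesis using assms False unfolding lfun_outside[OF False] by auto
qed

text \<open>The \<open>q\<close>-numbers in these coefficients are those of \<open>m - c\<close>,
  \<open>c + 1\<close>, \<open>n - b\<close> and \<open>b + 1\<close>, all positive, and
  \<open>ch\<close> has no zero.\<close>

lemma G_nonzero:
  "c < m \<Longrightarrow> G1 (int n) (int m) a (int c + 1) \<noteq> 0"
  "G2 (int n) (int m) a (int c) \<noteq> 0"
  "b < n \<Longrightarrow> G3 (int n) (int m) (int b + 1) d \<noteq> 0"
  "G4 (int n) (int m) (int b) d \<noteq> 0"
  using sh_eq_iff[of _ 0] by (simp_all add: G1_def G2_def G3_def G4_def sh_def[of 0])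

lemma RR_irreducible: "irreducible_rep (so4_rels p) (RR n m)"
  unfolding irreducible_rep_def
proof (intro conjI allI impI RR_is_rep)
  show "rdim (RR n m) > 0" by simp
  let ?N = "Suc n * Suc m"
  fix W assume "VectorSpace.subspace class_ring W (module_vec TYPE(complex) (rdim (RR n m))) \<and>
    (\<forall>g. \<forall>w \<in> W. act (RR n m) g *\<^sub>v w \<in> W)"
  hence sub: "VectorSpace.subspace class_ring W (module_vec TYPE(complex) ?N)"
    and inv: "\<And>g w. w \<in> W \<Longrightarrow> act (RR n m) g *\<^sub>v w \<in> W" by auto
  have W: "W \<subseteq> carrier_vec ?N" and W_add: "\<And>v w. v \<in> W \<Longrightarrow> w \<in> W \<Longrightarrow> v + w \<in> W"
    and W_smult: "\<And>x v. v \<in> W \<Longrightarrow> x \<cdot>\<^sub>v v \<in> W" and W_0: "0\<^sub>v ?N \<in> W"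
    using sub unfolding subspace_def submodule_def by (auto simp: module_vec_simps class_ring_simps)
  \<comment> \<open>Subtracting an eigenvalue of a diagonal generator kills one coordinate of \<open>w\<close> and keeps the
    coordinate \<open>r\<close>.\<close>
  have unit: "unit_vec ?N r \<in> W" if "w \<in> W" "r < ?N" "w $ r \<noteq> 0" for w r
    using that
  proof (induction "card {s. s < ?N \<and> s \<noteq> r \<and> w $ s \<noteq> 0}" arbitrary: w rule: less_induct)
    case less
    let ?S = "\<lambda>w. {s. s < ?N \<and> s \<noteq> r \<and> w $ s \<noteq> (0 :: complex)}"
    have w: "w \<in> carrier_vec ?N" using less.prems W by auto
    show ?case
    proof (cases "?S w = {}")
      case True
      have "unit_vec ?N r = (1 / w $ r) \<cdot>\<^sub>v w"
      proof (rule eq_vecI)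
        fix i assume "i < dim_vec ((1 / w $ r) \<cdot>\<^sub>v w)"
        hence i: "i < ?N" using w by simp
        have "i \<noteq> r \<Longrightarrow> w $ i = 0" using True i by blast
        thus "unit_vec ?N r $ i = ((1 / w $ r) \<cdot>\<^sub>v w) $ i"
          using i w less.prems(2,3) by (cases "i = r") auto
      qed (use w in auto)
      thus ?thesis using W_smult[OF less.prems(1)] by simp
    next
      case False
      then obtain s where s: "s < ?N" "s \<noteq> r" "w $ s \<noteq> 0" by auto
      \<comment> \<open>Sum and difference of the weights determine the position and
        \<open>sh\<close> is injective, so one of the two diagonal generators has different
        eigenvalues at \<open>r\<close> and \<open>s\<close>.\<close>
      obtain g f where g: "act (RR n m) g = mat_diag ?N f" "f r \<noteq> f s"
        using weights_separate[OF less.prems(2) s(1)] s(2) act_RR_diag[of n m]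
        by (metis complex_i_not_zero mult_cancel_left sh_eq_iff)
      define w' where "w' = act (RR n m) g *\<^sub>v w + (- f s) \<cdot>\<^sub>v w"
      have w'W: "w' \<in> W" unfolding w'_def by (intro W_add inv W_smult less.prems(1))
      have w': "w' $ t = (f t - f s) * w $ t" if "t < ?N" for t
        using mult_mat_diag_vec[OF w that, of f] w that
        by (simp add: w'_def g(1) left_diff_distrib)
      have "?S w' \<subseteq> ?S w - {s}" using w' by auto
      hence "card (?S w') \<le> card (?S w - {s})" by (rule card_mono[rotated]) simp
      also have "\<dots> < card (?S w)" using s by (intro card_Diff1_less) auto
      finally show ?thesis
        using less.hyps[of w'] w'W less.prems w'[of r] g(2) by simp
    qed
  qed
  show "W = {0\<^sub>v (rdim (RR n m))} \<or> W = carrier_vec (rdim (RR n m))"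
  proof (cases "W = {0\<^sub>v ?N}")
    case False
    then obtain w where w: "w \<in> W" "w \<noteq> 0\<^sub>v ?N" using W_0 by auto
    have "w \<in> carrier_vec ?N" using w W by auto
    then obtain r where r: "r < ?N" "w $ r \<noteq> 0"
      using w(2) by (metis carrier_vecD eq_vecI index_zero_vec)
    define P where "P a c \<longleftrightarrow> unit_vec ?N (a * Suc m + c) \<in> W" for a c
    \<comment> \<open>\<open>I32\<close> sends a basis vector to a combination of its neighbours,
      and \<open>unit\<close> extracts from it every neighbour with nonzero coefficient.\<close>
    have move: "P a' c'" if "P a c" "a < Suc n" "c < Suc m" "a' < Suc n" "c' < Suc m"
      "I32_op (int n) (int m) (\<lambda>x y. if x = int a \<and> y = int c then 1 else 0) (int a') (int c') \<noteq> 0" for a c a' c'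
    proof -
      let ?u = "unit_vec ?N (a * Suc m + c)"
      have "lfun n m ?u = (\<lambda>x y. if x = int a \<and> y = int c then 1 else 0)"
        by (intro ext lfun_unit_vec[OF that(2,3)])
      hence "lfun n m (act (RR n m) I32 *\<^sub>v ?u) (int a') (int c') \<noteq> 0"
        using that(6) lfun_RR_I32[of ?u n m] by simp
      hence "(act (RR n m) I32 *\<^sub>v ?u) $ (a' * Suc m + c') \<noteq> 0"
        using that by (simp add: lfun_inside)
      thus ?thesis
        unfolding P_def using that(1) pair_index_less[OF that(4,5)] unit[OF inv] by (simp add: P_def)
    qed
    have c_step: "P a c \<longleftrightarrow> P a (Suc c)" if "a < Suc n" "Suc c < Suc m" for a c
      using move[of a c a "Suc c"] move[of a "Suc c" a c] that G_nonzero(1)[of c m n "int a"]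
        G_nonzero(2)[of n m "int a" c]
      by (auto simp: I32_op_def lattice_op_def add.commute)
    have a_step: "P a c \<longleftrightarrow> P (Suc a) c" if "Suc a < Suc n" "c < Suc m" for a c
      using move[of a c "Suc a" c] move[of "Suc a" c a c] that G_nonzero(3)[of a n m "int c"]
        G_nonzero(4)[of n m a "int c"]
      by (auto simp: I32_op_def lattice_op_def add.commute)
    have c0: "P a c \<longleftrightarrow> P a 0" if "a < Suc n" "c < Suc m" for a c
      using that by (induction c) (auto simp: c_step[symmetric])
    have a0: "P a 0 \<longleftrightarrow> P 0 0" if "a < Suc n" for a
      using that by (induction a) (auto simp: a_step[symmetric])
    obtain a c where ac: "r = a * Suc m + c" "a < Suc n" "c < Suc m" using r(1) by (rule pair_index_cases)
    have "P a c" unfolding P_def ac(1)[symmetric] by (rule unit[OF w(1) r])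
    hence P: "P a c" if "a < Suc n" "c < Suc m" for a c using that c0 a0 ac by blast
    have all: "unit_vec ?N t \<in> W" if "t < ?N" for t
      using pair_index_cases[OF that] P unfolding P_def by metis
    have "v \<in> W" if v: "v \<in> carrier_vec ?N" for v
    proof -
      \<comment> \<open>The coordinates of \<open>v\<close> are filled in one at a time, each by
        adding a multiple of a unit vector.\<close>
      have "vec ?N (\<lambda>i. if i < k then v $ i else 0) \<in> W" if "k \<le> ?N" for k
        using that
      proof (induction k)
        case 0
        have "vec ?N (\<lambda>i. if i < 0 then v $ i else 0) = 0\<^sub>v ?N" by (intro eq_vecI) auto
        thus ?case using W_0 by simp
      next
        case (Suc k)
        have "vec ?N (\<lambda>i. if i < Suc k then v $ i else 0) =
            vec ?N (\<lambda>i. if i < k then v $ i else 0) + v $ k \<cdot>\<^sub>v unit_vec ?N k"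
          using Suc.prems by (intro eq_vecI) (auto simp: less_Suc_eq)
        thus ?case using Suc W_add W_smult all[of k] by simp
      qed
      from this[of ?N] have "vec ?N (\<lambda>i. if i < ?N then v $ i else 0) \<in> W" by simp
      moreover have "vec ?N (\<lambda>i. if i < ?N then v $ i else 0) = v" using v by (intro eq_vecI) auto
      ultimately show ?thesis by simp
    qed
    thus ?thesis using W by auto
  qed simp
qed

end

section \<open>The decomposition\<close>

text \<open>After multiplication by the invertible matrix of all intertwiners, both sides of a
  relation become the same block diagonal expression.\<close>

lemma is_rep_of_blocks:
  fixes V :: "'g rep" and W :: "'i \<Rightarrow> 'g rep"
  assumes V: "matrix_rep V"
    and W: "\<And>x. x \<in> set xs \<Longrightarrow> is_rep rels (W x)"
    and B: "\<And>x. x \<in> set xs \<Longrightarrow> intertwines V (W x) (B x)"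
    and dims: "sum_list (map (\<lambda>x. rdim (W x)) xs) = rdim V"
    and Q': "Q' \<in> carrier_mat (rdim V) (rdim V)" "hcat (rdim V) (map B xs) * Q' = 1\<^sub>m (rdim V)"
  shows "is_rep rels V"
  unfolding is_rep_def
proof (intro conjI allI ballI)
  let ?N = "rdim V" and ?Q = "hcat (rdim V) (map B xs)"
  show "act V g \<in> carrier_mat ?N ?N" for g using V by (simp add: matrix_rep_def)
  have Bc: "B x \<in> carrier_mat ?N (rdim (W x))" if "x \<in> set xs" for x
    using B[OF that] by (simp add: intertwines_def)
  have Wm: "matrix_rep (W x)" if "x \<in> set xs" for x
    using W[OF that] by (simp add: is_rep_def matrix_rep_def)
  have Q: "?Q \<in> carrier_mat ?N ?N"
    using hcat_carrier[of xs B ?N "\<lambda>x. rdim (W x)"] Bc dims by simp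
  have ev: "eval_term V t * ?Q = ?Q * diag_block_mat (map (\<lambda>x. eval_term (W x) t) xs)" for t
    using eval_term_carrier[OF V] Bc eval_term_carrier[OF Wm] eval_term_intertwines[OF V Wm B]
    by (intro mult_hcat[where d = "\<lambda>x. rdim (W x)"]) auto
  fix st assume "st \<in> rels"
  moreover obtain s t where st: "st = (s, t)" by force
  ultimately have "map (\<lambda>x. eval_term (W x) s) xs = map (\<lambda>x. eval_term (W x) t) xs"
    using W by (fastforce simp: is_rep_def)
  hence "eval_term V s * ?Q = eval_term V t * ?Q" by (simp only: ev)
  hence "eval_term V s * ?Q * Q' = eval_term V t * ?Q * Q'" by simp
  hence "eval_term V s = eval_term V t"
    using Q Q' eval_term_carrier[OF V] right_mult_one_mat[OF eval_term_carrier[OF V]]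
    by (simp add: assoc_mult_mat[of _ ?N ?N _ ?N _ ?N])
  thus "case st of (s, t) \<Rightarrow> eval_term V s = eval_term V t" by (simp add: st)
qed

text \<open>\<open>rep_iso\<close> asks for a map from \<open>V\<close> to the direct sum, whereas
  the concatenated intertwiners go the other way; the witness is therefore the inverse
  \<open>Q'\<close>.\<close>

lemma rep_iso_of_blocks:
  fixes V :: "'g rep" and W :: "'i \<Rightarrow> 'g rep"
  assumes V: "matrix_rep V"
    and W: "\<And>x. x \<in> set xs \<Longrightarrow> matrix_rep (W x)"
    and B: "\<And>x. x \<in> set xs \<Longrightarrow> intertwines V (W x) (B x)"
    and dims: "sum_list (map (\<lambda>x. rdim (W x)) xs) = rdim V"
    and Q': "Q' \<in> carrier_mat (rdim V) (rdim V)" "hcat (rdim V) (map B xs) * Q' = 1\<^sub>m (rdim V)"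
      "Q' * hcat (rdim V) (map B xs) = 1\<^sub>m (rdim V)"
  shows "rep_iso V (direct_sum_rep (map W xs))"
proof -
  let ?N = "rdim V" and ?Q = "hcat (rdim V) (map B xs)"
  let ?D = "\<lambda>g. diag_block_mat (map (\<lambda>x. act (W x) g) xs)"
  have Bc: "B x \<in> carrier_mat ?N (rdim (W x))" if "x \<in> set xs" for x
    using B[OF that] by (simp add: intertwines_def)
  have Q: "?Q \<in> carrier_mat ?N ?N"
    using hcat_carrier[of xs B ?N "\<lambda>x. rdim (W x)"] Bc dims by simp
  have Vc: "act V g \<in> carrier_mat ?N ?N" for g using V by (simp add: matrix_rep_def)
  have ev: "act V g * ?Q = ?Q * ?D g" for g
    using Vc Bc W B by (intro mult_hcat[where d = "\<lambda>x. rdim (W x)"]) (auto simp: intertwines_def matrix_rep_def)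
  have Wc: "act (W x) g \<in> carrier_mat (rdim (W x)) (rdim (W x))" if "x \<in> set xs" for x g
    using W[OF that] by (simp add: matrix_rep_def)
  have dimW: "map dim_row (map (\<lambda>x. act (W x) g) xs) = map (\<lambda>x. rdim (W x)) xs"
    "map dim_col (map (\<lambda>x. act (W x) g) xs) = map (\<lambda>x. rdim (W x)) xs" for g
    using carrier_matD[OF Wc] by simp_all
  have D: "?D g \<in> carrier_mat ?N ?N" for g
    by (intro carrier_matI) (simp_all only: dim_diag_block_mat dimW dims)
  have "Q' * act V g = ?D g * Q'" for g
  proof -
    have "Q' * act V g = Q' * act V g * (?Q * Q')"
      unfolding Q'(2) by (rule right_mult_one_mat[OF mult_carrier_mat[OF Q'(1) Vc], symmetric])
    also have "\<dots> = Q' * (act V g * ?Q * Q')"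
      using Q Q'(1) Vc by (simp add: assoc_mult_mat[of _ ?N ?N _ ?N _ ?N])
    also have "\<dots> = Q' * ?Q * (?D g * Q')"
      unfolding ev assoc_mult_mat[OF Q D Q'(1)]
      by (rule assoc_mult_mat[OF Q'(1) Q mult_carrier_mat[OF D Q'(1)], symmetric])
    also have "\<dots> = ?D g * Q'"
      unfolding Q'(3) by (rule left_mult_one_mat[OF mult_carrier_mat[OF D Q'(1)]])
    finally show ?thesis .
  qed
  moreover have "invertible_mat Q'"
    using Q Q' unfolding invertible_mat_def inverts_mat_def by (auto intro!: exI[of _ ?Q])
  ultimately show ?thesis
    unfolding rep_iso_def direct_sum_rep_def using Q' dims by (auto simp: o_def)
qed

lemma sum_list_product:
  fixes f :: "'a \<Rightarrow> nat"
  shows "(\<Sum>(x, y) \<leftarrow> List.product xs ys. f x * g y) = (\<Sum>x \<leftarrow> xs. f x) * (\<Sum>y \<leftarrow> ys. g y)"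
  by (induction xs) (simp_all add: o_def distrib_right sum_list_const_mult)

text \<open>The doubled Clebsch-Gordan range. Writing the absolute difference as maximum minus
  minimum keeps the subtraction of naturals exact.\<close>

definition spin_list :: "nat \<Rightarrow> nat \<Rightarrow> nat list" where
  "spin_list n m = map (\<lambda>i. (max n m - min n m) + 2 * i) [0..<Suc (min n m)]"

lemma spin_range_half: "spin_range (of_nat n / 2) (of_nat m / 2) = map (\<lambda>k. of_nat k / 2) (spin_list n m)"
proof -
  have a: "\<bar>of_nat n / 2 - of_nat m / 2 :: rat\<bar> = of_nat (max n m - min n m) / 2"
    by (cases "n \<le> m") (simp_all add: of_nat_diff abs_if field_simps max_def min_def)
  have "of_nat n / 2 + of_nat m / 2 - of_nat (max n m - min n m) / 2 = (of_nat (min n m) :: rat)"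
    by (cases "n \<le> m") (simp_all add: of_nat_diff field_simps max_def min_def)
  hence "nat \<lfloor>of_nat n / 2 + of_nat m / 2 - of_nat (max n m - min n m) / 2 :: rat\<rfloor> + 1 = Suc (min n m)" by simp
  thus ?thesis
    unfolding spin_range_def a spin_list_def by (simp add: add_divide_distrib del: upt_Suc)
qed

lemma distinct_spin_list: "distinct (spin_list n m)"
  unfolding spin_list_def by (auto simp: distinct_map inj_on_def simp del: upt_Suc)

text \<open>An arithmetic progression of step 2 with \<open>k\<close> terms, the first being
  \<open>a + 1\<close>, has sum \<open>k * (a + k)\<close>. Here \<open>k\<close> is the minimum
  plus 1, so that \<open>a + k\<close> is the maximum plus 1.\<close>

lemma sum_spin_list: "(\<Sum>k \<leftarrow> spin_list n m. Suc k) = Suc n * Suc m"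
proof -
  have "(\<Sum>i \<leftarrow> [0..<k]. Suc (a + 2 * i)) = k * (a + k)" for k a :: nat
    by (induction k) (auto simp: algebra_simps mult_Suc mult_Suc_right)
  from this[of "max n m - min n m" "Suc (min n m)"]
  have "(\<Sum>k \<leftarrow> spin_list n m. Suc k) = Suc (min n m) * (max n m - min n m + Suc (min n m))"
    by (simp add: spin_list_def o_def del: upt_Suc)
  also have "\<dots> = Suc (min n m) * Suc (max n m)" by simp
  also have "\<dots> = Suc n * Suc m" by (cases "n \<le> m") (simp_all add: max_def min_def)
  finally show ?thesis .
qed

context generic_q
begin

lemma spin_list_intertwiner:
  assumes "k \<in> set (spin_list n m)"
  shows "\<exists>P \<in> carrier_mat (Suc n * Suc m) (Suc k). separated_columns P \<and>
    (\<forall>g. Dmat n m g * P = P * Tmat k g)"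
proof -
  obtain i where i: "i \<le> min n m" "k = max n m - min n m + 2 * i"
    using assms by (auto simp: spin_list_def less_Suc_eq_le simp del: upt_Suc)
  \<comment> \<open>The spin with index \<open>i\<close> comes from the lowest weight vector with
    \<open>d = min n m - i\<close>.\<close>
  have "n + m - 2 * (min n m - i) = k" using i by auto
  thus ?thesis using tensor_intertwiner[of "min n m - i" n m] by auto
qed

section \<open>The tensor product as a representation of the two copies of \<open>sl_2\<close>
  alone\<close>

definition tensor_base :: "nat \<Rightarrow> nat \<Rightarrow> nat \<Rightarrow> nat \<Rightarrow> (copy \<times> sl2_gen) rep" where
  "tensor_base n n' m m' = Rep (Suc n * Suc n' * (Suc m * Suc m')) (\<lambda>(i, g).
     foldr (\<lambda>(a, b) M. kron (act (base_rep n n') (i, a)) (act (base_rep m m') (i, b)) + M) (comult g)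
       (0\<^sub>m (Suc n * Suc n' * (Suc m * Suc m')) (Suc n * Suc n' * (Suc m * Suc m'))))"

lemma tensor_rep_eq:
  "tensor_rep p (TT n n') (TT m m') = extend_rep p (tensor_base n n' m m')
    (\<lambda>i. casimir_root p (Suc n * Suc n' * (Suc m * Suc m'))
      (eval_term (tensor_base n n' m m') (map_alg_term (Pair i) (casimir p))))"
  unfolding tensor_rep_def Let_def tensor_base_def by simp

lemma rdim_tensor_base [simp]: "rdim (tensor_base n n' m m') = Suc n * Suc n' * (Suc m * Suc m')"
  by (simp add: tensor_base_def)

lemma tensor_base_matrix_rep: "matrix_rep (tensor_base n n' m m')"
proof -
  have k: "kron (act (base_rep n n') (i, a)) (act (base_rep m m') (i, b)) \<in>
      carrier_mat (Suc n * Suc n' * (Suc m * Suc m')) (Suc n * Suc n' * (Suc m * Suc m'))" for i a b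
    by (rule kron_carrier[OF base_rep_carrier base_rep_carrier])
  have "act (tensor_base n n' m m') (i, g) \<in>
      carrier_mat (Suc n * Suc n' * (Suc m * Suc m')) (Suc n * Suc n' * (Suc m * Suc m'))" for i g
    by (cases g) (auto simp: tensor_base_def intro!: add_carrier_mat k zero_carrier_mat)
  thus ?thesis unfolding matrix_rep_def by (metis rdim_tensor_base surj_pair)
qed

text \<open>After regrouping, each copy acts through \<open>Dmat\<close> on its own pair of factors
  and as the identity on the other pair.\<close>

lemma tensor_base_middle_swap:
  fixes n n' m m' :: nat
  defines "S \<equiv> middle_swap_mat (Suc n) (Suc n') (Suc m) (Suc m')"
  shows "act (tensor_base n n' m m') (C1, g) * S = S * kron (Dmat n m g) (1\<^sub>m (Suc n' * Suc m'))"
    "act (tensor_base n n' m m') (C2, g) * S = S * kron (1\<^sub>m (Suc n * Suc m)) (Dmat n' m' g)"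
proof -
  let ?N = "Suc n * Suc n' * (Suc m * Suc m')" and ?M = "Suc n * Suc m * (Suc n' * Suc m')"
  have S: "S \<in> carrier_mat ?N ?M" unfolding S_def by (rule middle_swap_mat_carrier)
  let ?X = "\<lambda>i a b. kron (act (base_rep n n') (i, a)) (act (base_rep m m') (i, b))"
  have X: "?X i a b \<in> carrier_mat ?N ?N" for i a b
    by (rule kron_carrier[OF base_rep_carrier base_rep_carrier])
  have X1: "?X C1 a b * S = S * kron (kron (Tmat n a) (Tmat m b)) (1\<^sub>m (Suc n' * Suc m'))" for a b
    unfolding act_base_rep S_def
    using kron_middle_swap[OF Tmat_carrier(5) one_carrier_mat Tmat_carrier(5) one_carrier_mat, of n a "Suc n'" m b "Suc m'"]
    by (simp add: kron_one)
  have X2: "?X C2 a b * S = S * kron (1\<^sub>m (Suc n * Suc m)) (kron (Tmat n' a) (Tmat m' b))" for a b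
    unfolding act_base_rep S_def
    using kron_middle_swap[OF one_carrier_mat Tmat_carrier(5) one_carrier_mat Tmat_carrier(5), of "Suc n" n' a "Suc m" m' b]
    by (simp add: kron_one)
  have kT: "kron (Tmat a x) (Tmat b y) \<in> carrier_mat (Suc a * Suc b) (Suc a * Suc b)" for a b x y
    by (rule kron_carrier) auto
  have k1: "kron (kron (Tmat n a) (Tmat m b)) (1\<^sub>m (Suc n' * Suc m')) \<in> carrier_mat ?M ?M" for a b
    by (rule kron_carrier[OF kT one_carrier_mat])
  have k2: "kron (1\<^sub>m (Suc n * Suc m)) (kron (Tmat n' a) (Tmat m' b)) \<in> carrier_mat ?M ?M" for a b
    by (rule kron_carrier[OF one_carrier_mat kT])
  have two: "(Y1 + (Y2 + 0\<^sub>m ?N ?N)) * S = S * (Z1 + Z2)"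
    if "Y1 \<in> carrier_mat ?N ?N" "Y2 \<in> carrier_mat ?N ?N" "Z1 \<in> carrier_mat ?M ?M" "Z2 \<in> carrier_mat ?M ?M"
      "Y1 * S = S * Z1" "Y2 * S = S * Z2" for Y1 Y2 Z1 Z2
    using that add_mult_distrib_mat[OF that(1,2) S] mult_add_distrib_mat[OF S that(3,4)] by simp
  have one: "(Y1 + 0\<^sub>m ?N ?N) * S = S * Z1" if "Y1 \<in> carrier_mat ?N ?N" "Y1 * S = S * Z1" for Y1 Z1
    using that by simp
  note two1 = two[OF X X k1 k1 X1 X1] and two2 = two[OF X X k2 k2 X2 X2]
  note add1 = kron_add_left[OF kT kT one_carrier_mat, symmetric] and add2 = kron_add_right[OF one_carrier_mat kT kT, symmetric]
  show "act (tensor_base n n' m m') (C1, g) * S = S * kron (Dmat n m g) (1\<^sub>m (Suc n' * Suc m'))"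
  proof (cases g)
    case E_gen
    show ?thesis using two1[of E_gen K_gen Kinv_gen E_gen] unfolding E_gen add1 by (simp add: tensor_base_def)
  next
    case F_gen
    show ?thesis using two1[of F_gen K_gen Kinv_gen F_gen] unfolding F_gen add1 by (simp add: tensor_base_def)
  next
    case K_gen
    show ?thesis using one[OF X X1, of K_gen K_gen] unfolding K_gen by (simp add: tensor_base_def)
  next
    case Kinv_gen
    show ?thesis using one[OF X X1, of Kinv_gen Kinv_gen] unfolding Kinv_gen by (simp add: tensor_base_def)
  qed
  show "act (tensor_base n n' m m') (C2, g) * S = S * kron (1\<^sub>m (Suc n * Suc m)) (Dmat n' m' g)"
  proof (cases g)
    case E_gen
    show ?thesis using two2[of E_gen K_gen Kinv_gen E_gen] unfolding E_gen add2 by (simp add: tensor_base_def)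
  next
    case F_gen
    show ?thesis using two2[of F_gen K_gen Kinv_gen F_gen] unfolding F_gen add2 by (simp add: tensor_base_def)
  next
    case K_gen
    show ?thesis using one[OF X X2, of K_gen K_gen] unfolding K_gen by (simp add: tensor_base_def)
  next
    case Kinv_gen
    show ?thesis using one[OF X X2, of Kinv_gen Kinv_gen] unfolding Kinv_gen by (simp add: tensor_base_def)
  qed
qed

lemma tensor_base_intertwiner:
  assumes k: "k \<in> set (spin_list n m)" and k': "k' \<in> set (spin_list n' m')"
  shows "\<exists>B. intertwines (tensor_base n n' m m') (base_rep k k') B \<and> separated_columns B"
proof -
  let ?N = "Suc n * Suc n' * (Suc m * Suc m')" and ?M = "Suc n * Suc m * (Suc n' * Suc m')"
  define S where "S = middle_swap_mat (Suc n) (Suc n') (Suc m) (Suc m')"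
  have S: "S \<in> carrier_mat ?N ?M" unfolding S_def by (rule middle_swap_mat_carrier)
  obtain P where P: "P \<in> carrier_mat (Suc n * Suc m) (Suc k)" "separated_columns P"
    "\<And>g. Dmat n m g * P = P * Tmat k g" using spin_list_intertwiner[OF k] by auto
  obtain P' where P': "P' \<in> carrier_mat (Suc n' * Suc m') (Suc k')" "separated_columns P'"
    "\<And>g. Dmat n' m' g * P' = P' * Tmat k' g" using spin_list_intertwiner[OF k'] by auto
  define B where "B = S * kron P P'"
  have PP: "kron P P' \<in> carrier_mat ?M (Suc k * Suc k')" by (rule kron_carrier[OF P(1) P'(1)])
  have B: "B \<in> carrier_mat ?N (Suc k * Suc k')" unfolding B_def using S PP by simp
  have U: "act (tensor_base n n' m m') g \<in> carrier_mat ?N ?N" for g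
    using tensor_base_matrix_rep[of n n' m m'] unfolding matrix_rep_def by (metis rdim_tensor_base)
  have *: "act (tensor_base n n' m m') ig * B = B * Z"
    if "act (tensor_base n n' m m') ig * S = S * Y" "Y * kron P P' = kron P P' * Z"
      "Y \<in> carrier_mat ?M ?M" "Z \<in> carrier_mat (Suc k * Suc k') (Suc k * Suc k')" for ig Y Z
  proof -
    have "act (tensor_base n n' m m') ig * B = (S * Y) * kron P P'"
      unfolding B_def that(1)[symmetric] by (rule assoc_mult_mat[OF U S PP, symmetric])
    also have "\<dots> = S * (kron P P' * Z)" unfolding that(2)[symmetric] by (rule assoc_mult_mat[OF S that(3) PP])
    also have "\<dots> = B * Z" unfolding B_def by (rule assoc_mult_mat[OF S PP that(4), symmetric])
    finally show ?thesis .
  qed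
  have "act (tensor_base n n' m m') (C1, g) * B = B * act (base_rep k k') (C1, g)" for g
  proof (rule *[OF tensor_base_middle_swap(1)[of n n' m m' g, folded S_def]])
    show "kron (Dmat n m g) (1\<^sub>m (Suc n' * Suc m')) * kron P P' = kron P P' * act (base_rep k k') (C1, g)"
      unfolding act_base_rep
      using kron_mult[OF Dmat_carrier[of n m g] one_carrier_mat P(1) P'(1)]
        kron_mult[OF P(1) P'(1) Tmat_carrier(5)[of k g] one_carrier_mat] P P' by simp
    show "kron (Dmat n m g) (1\<^sub>m (Suc n' * Suc m')) \<in> carrier_mat ?M ?M"
      by (rule kron_carrier[OF Dmat_carrier one_carrier_mat])
    show "act (base_rep k k') (C1, g) \<in> carrier_mat (Suc k * Suc k') (Suc k * Suc k')" by (rule base_rep_carrier)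
  qed
  moreover have "act (tensor_base n n' m m') (C2, g) * B = B * act (base_rep k k') (C2, g)" for g
  proof (rule *[OF tensor_base_middle_swap(2)[of n n' m m' g, folded S_def]])
    show "kron (1\<^sub>m (Suc n * Suc m)) (Dmat n' m' g) * kron P P' = kron P P' * act (base_rep k k') (C2, g)"
      unfolding act_base_rep
      using kron_mult[OF one_carrier_mat Dmat_carrier[of n' m' g] P(1) P'(1)]
        kron_mult[OF P(1) P'(1) one_carrier_mat Tmat_carrier(5)[of k' g]] P P' by simp
    show "kron (1\<^sub>m (Suc n * Suc m)) (Dmat n' m' g) \<in> carrier_mat ?M ?M"
      by (rule kron_carrier[OF one_carrier_mat Dmat_carrier])
    show "act (base_rep k k') (C2, g) \<in> carrier_mat (Suc k * Suc k') (Suc k * Suc k')" by (rule base_rep_carrier)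
  qed
  ultimately have "act (tensor_base n n' m m') (i, g) * B = B * act (base_rep k k') (i, g)" for i g
    by (cases i) auto
  moreover have "separated_columns B"
    unfolding B_def S_def
    by (rule middle_swap_mat_mult_separated_columns[OF PP kron_separated_columns[OF P(1,2) P'(1,2)]])
  ultimately show ?thesis using B by (auto simp: intertwines_def)
qed

lemma mult_col_eigen:
  fixes M :: "complex mat"
  assumes M: "M \<in> carrier_mat N N" and B: "B \<in> carrier_mat N d" and eq: "M * B = B * mat_diag d f" and c: "c < d"
  shows "M *\<^sub>v col B c = f c \<cdot>\<^sub>v col B c"
proof (rule eq_vecI)
  fix r assume "r < dim_vec (f c \<cdot>\<^sub>v col B c)"
  hence r: "r < N" using B by simp
  have "(M *\<^sub>v col B c) $ r = (M * B) $$ (r, c)" using M B r c by simp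
  also have "\<dots> = B $$ (r, c) * f c" unfolding eq mat_diag_mult_right[OF B] using r c by simp
  finally show "(M *\<^sub>v col B c) $ r = (f c \<cdot>\<^sub>v col B c) $ r" using B r c by simp
qed (use M B in auto)

lemma tensor_decomposition:
  fixes n n' m m' :: nat
  defines "V \<equiv> tensor_rep p (TT n n') (TT m m')"
    and "xs \<equiv> List.product (spin_list n m) (spin_list n' m')"
  shows "\<exists>B Q'. matrix_rep V \<and> (\<forall>x \<in> set xs. intertwines V (TT (fst x) (snd x)) (B x)) \<and>
    sum_list (map (\<lambda>x. Suc (fst x) * Suc (snd x)) xs) = rdim V \<and>
    Q' \<in> carrier_mat (rdim V) (rdim V) \<and> hcat (rdim V) (map B xs) * Q' = 1\<^sub>m (rdim V) \<and>
    Q' * hcat (rdim V) (map B xs) = 1\<^sub>m (rdim V)"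
proof -
  define N where "N = Suc n * Suc n' * (Suc m * Suc m')"
  define U where "U = tensor_base n n' m m'"
  have U: "matrix_rep U" and rU: "rdim U = N"
    by (simp_all add: U_def tensor_base_matrix_rep N_def)
  define d where "d x = Suc (fst x) * Suc (snd x)" for x :: "nat \<times> nat"
  have "\<forall>x. \<exists>B. x \<in> set xs \<longrightarrow> intertwines U (base_rep (fst x) (snd x)) B \<and> separated_columns B"
    using tensor_base_intertwiner unfolding xs_def U_def by auto
  then obtain B where B: "\<And>x. x \<in> set xs \<Longrightarrow> intertwines U (base_rep (fst x) (snd x)) (B x)"
    "\<And>x. x \<in> set xs \<Longrightarrow> separated_columns (B x)" by metis
  have Bc: "B x \<in> carrier_mat N (d x)" if "x \<in> set xs" for x
    using B(1)[OF that] by (simp add: intertwines_def rU d_def)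
  have evB: "eval_term U t * B x = B x * eval_term (base_rep (fst x) (snd x)) t" if "x \<in> set xs" for x t
    by (rule eval_term_intertwines[OF U base_rep_matrix_rep B(1)[OF that]])
  have dims: "sum_list (map d xs) = N"
    using sum_list_product[of Suc Suc "spin_list n m" "spin_list n' m'"]
    unfolding xs_def d_def sum_spin_list N_def by (simp add: case_prod_unfold mult_ac)
  define Q where "Q = hcat N (map B xs)"
  have Q: "Q \<in> carrier_mat N N"
    using hcat_carrier[of xs B N d] Bc dims by (simp add: Q_def)
  define C where "C i = eval_term U (map_alg_term (Pair i) (casimir p))" for i
  have C: "C i \<in> carrier_mat N N" for i
    unfolding C_def using eval_term_carrier[OF U] by (simp add: rU)
  have CB: "C i * B x = B x * mat_diag (d x) (\<lambda>_. cas (int (spin (fst x) (snd x) i)))" if "x \<in> set xs" for i x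
    unfolding C_def evB[OF that] casimir_base_rep smult_one_mat_diag d_def ..
  have dist: "distinct xs" unfolding xs_def by (intro distinct_product distinct_spin_list)
  have setxs: "set xs = set (spin_list n m) \<times> set (spin_list n' m')" by (simp add: xs_def)
  obtain Q' where Q': "Q' \<in> carrier_mat N N" "Q * Q' = 1\<^sub>m N" "Q' * Q = 1\<^sub>m N"
  proof (rule injective_mat_inverse[OF Q])
    fix v assume v: "v \<in> carrier_vec N" and Qv: "Q *\<^sub>v v = 0\<^sub>v N"
    obtain y where y: "\<forall>x \<in> set xs. y x \<in> carrier_vec (d x)"
      "\<forall>r<N. (Q *\<^sub>v v) $ r = (\<Sum>x \<in> set xs. (B x *\<^sub>v y x) $ r)"
      "(\<forall>x \<in> set xs. y x = 0\<^sub>v (d x)) \<longrightarrow> v = 0\<^sub>v N"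
      using hcat_mult_vec[of xs B N d v, OF dist Bc] v dims unfolding Q_def by auto
    have w: "B x *\<^sub>v y x \<in> carrier_vec N" if "x \<in> set xs" for x
      using mult_mat_vec_carrier[OF Bc[OF that]] y(1) that by blast
    have Cw: "(\<Sum>c<N. C i $$ (r, c) * (B x *\<^sub>v y x) $ c) =
        cas (int (spin (fst x) (snd x) i)) * (B x *\<^sub>v y x) $ r" if "x \<in> set xs" "r < N" for x i r
    proof -
      have yx: "y x \<in> carrier_vec (d x)" using y(1) that by blast
      have "C i *\<^sub>v (B x *\<^sub>v y x) = (C i * B x) *\<^sub>v y x"
        by (rule assoc_mult_mat_vec[OF C Bc[OF that(1)] yx, symmetric])
      also have "\<dots> = cas (int (spin (fst x) (snd x) i)) \<cdot>\<^sub>v (B x *\<^sub>v y x)"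
        unfolding CB[OF that(1)] smult_one_mat_diag[symmetric] smult_one_mult(2)[OF Bc[OF that(1)]]
        by (rule smult_mat_mult_vec[OF Bc[OF that(1)] yx])
      finally show ?thesis
        using index_mult_mat_vec_sum[OF C w[OF that(1)] that(2), of i] carrier_matD(1)[OF Bc[OF that(1)]] that(2)
        by simp
    qed
    have sum0: "(\<Sum>k \<in> set (spin_list n m). \<Sum>k' \<in> set (spin_list n' m'). (B (k, k') *\<^sub>v y (k, k')) $ r) = 0"
      if "r < N" for r
      using y(2) Qv that unfolding setxs sum.cartesian_product by (simp add: case_prod_unfold)
    \<comment> \<open>The Casimir element of one copy sees only one label. That of copy 1 separates
      the values of \<open>k\<close> while all \<open>k'\<close> stay summed; that of copy 2 then
      separates the \<open>k'\<close> for fixed \<open>k\<close>.\<close>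
    have "\<forall>k \<in> set (spin_list n m). \<forall>r<N.
        (\<Sum>k' \<in> set (spin_list n' m'). (B (k, k') *\<^sub>v y (k, k')) $ r) = 0"
    proof (rule eigenvectors_independent[where Z = "\<lambda>r c. C C1 $$ (r, c)" and z = "\<lambda>k. cas (int k)"])
      fix k r assume k: "k \<in> set (spin_list n m)" and r: "r < N"
      have "(\<Sum>c<N. C C1 $$ (r, c) * (\<Sum>k' \<in> set (spin_list n' m'). (B (k, k') *\<^sub>v y (k, k')) $ c)) =
          (\<Sum>k' \<in> set (spin_list n' m'). \<Sum>c<N. C C1 $$ (r, c) * (B (k, k') *\<^sub>v y (k, k')) $ c)"
        unfolding sum_distrib_left by (rule sum.swap)
      also have "\<dots> = (\<Sum>k' \<in> set (spin_list n' m'). cas (int k) * (B (k, k') *\<^sub>v y (k, k')) $ r)"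
        using Cw[of "(k, _)" r C1] k r by (intro sum.cong refl) (auto simp: setxs spin_def)
      finally show "(\<Sum>c<N. C C1 $$ (r, c) * (\<Sum>k' \<in> set (spin_list n' m'). (B (k, k') *\<^sub>v y (k, k')) $ c)) =
          cas (int k) * (\<Sum>k' \<in> set (spin_list n' m'). (B (k, k') *\<^sub>v y (k, k')) $ r)"
        by (simp add: sum_distrib_left)
    qed (use sum0 in \<open>auto simp: inj_on_def cas_eq_iff\<close>)
    hence sum1: "(\<Sum>k' \<in> set (spin_list n' m'). (B (k, k') *\<^sub>v y (k, k')) $ r) = 0"
      if "k \<in> set (spin_list n m)" "r < N" for k r using that by blast
    have "\<forall>k' \<in> set (spin_list n' m'). \<forall>r<N. (B (k, k') *\<^sub>v y (k, k')) $ r = 0"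
      if k: "k \<in> set (spin_list n m)" for k
    proof (rule eigenvectors_independent[where Z = "\<lambda>r c. C C2 $$ (r, c)" and z = "\<lambda>k. cas (int k)"])
      fix k' r assume "k' \<in> set (spin_list n' m')" "r < N"
      thus "(\<Sum>c<N. C C2 $$ (r, c) * (B (k, k') *\<^sub>v y (k, k')) $ c) = cas (int k') * (B (k, k') *\<^sub>v y (k, k')) $ r"
        using Cw[of "(k, k')" r C2] k by (auto simp: setxs spin_def)
    qed (use sum1 k in \<open>auto simp: inj_on_def cas_eq_iff\<close>)
    hence zero: "(B x *\<^sub>v y x) $ r = 0" if "x \<in> set xs" "r < N" for x r
      using that unfolding setxs by auto
    have "B x *\<^sub>v y x = 0\<^sub>v N" if "x \<in> set xs" for x
      using zero[OF that] carrier_matD(1)[OF Bc[OF that]] by (intro eq_vecI) auto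
    hence "\<forall>x \<in> set xs. y x = 0\<^sub>v (d x)"
      using separated_columns_injective[OF Bc B(2)] y(1) by blast
    thus "v = 0\<^sub>v N" using y(3) by blast
  qed auto
  have colQ: "\<exists>x \<in> set xs. \<exists>c' < d x. col Q c = col (B x) c'" if "c < N" for c
    unfolding Q_def using that dims by (intro col_hcat[of xs B N d, OF Bc]) auto
  have C_ev: "\<exists>k. C i *\<^sub>v col Q c = cas (int k) \<cdot>\<^sub>v col Q c" if "c < N" for i c
    using colQ[OF that] mult_col_eigen[OF C Bc CB] by metis
  \<comment> \<open>Only now, with \<open>Q\<close> known to be an eigenbasis of both Casimir
    elements, is \<open>casimir_root\<close> determined. On each block it gives the scalar by which
    \<open>x_i\<close> acts in \<open>TT\<close>.\<close>
  define X where "X i = casimir_root p N (C i)" for i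
  have root: "X i \<in> carrier_mat N N"
    "v \<in> carrier_vec N \<Longrightarrow> C i *\<^sub>v v = cas (int k) \<cdot>\<^sub>v v \<Longrightarrow> X i *\<^sub>v v = p powi (- int k) \<cdot>\<^sub>v v" for i v k
    unfolding X_def
    by (rule casimir_root_eigenvector(1)[OF C Q Q' C_ev], assumption,
        rule casimir_root_eigenvector(2)[OF C Q Q' C_ev])
  have XB: "X i * B x = B x * mat_diag (d x) (\<lambda>_. xval (fst x) (snd x) i)" if x: "x \<in> set xs" for i x
  proof (rule mult_eigenbasis[OF root(1) Bc[OF x]])
    fix c assume c: "c < d x"
    have "X i *\<^sub>v col (B x) c = p powi (- int (spin (fst x) (snd x) i)) \<cdot>\<^sub>v col (B x) c"
      by (rule root(2)[OF _ mult_col_eigen[OF C Bc[OF x] CB[OF x] c]]) (use Bc[OF x] c in auto)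
    thus "X i *\<^sub>v col (B x) c = xval (fst x) (snd x) i \<cdot>\<^sub>v col (B x) c"
      by (cases i) (simp_all add: xval_def spin_def)
  qed
  have X_ev: "\<exists>z. z \<noteq> 0 \<and> X i *\<^sub>v col Q c = z \<cdot>\<^sub>v col Q c" if "c < N" for i c
    using colQ[OF that] mult_col_eigen[OF root(1) Bc XB] xval_nonzero by metis
  have Xinv: "the (mat_inverse (X i)) \<in> carrier_mat N N" "the (mat_inverse (X i)) * X i = 1\<^sub>m N" for i
    using mat_inverse_eigenbasis[OF root(1) Q Q' X_ev] by blast+
  define D where "D \<sigma> r = eval_term U (denom p \<sigma> r)" for \<sigma> r
  have D: "D \<sigma> r \<in> carrier_mat N N" for \<sigma> r
    unfolding D_def using eval_term_carrier[OF U] by (simp add: rU)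
  have DB: "D \<sigma> r * B x = B x * mat_diag (d x) (\<lambda>t. ch (2 * r + wp (fst x) (snd x) \<sigma> t))" if "x \<in> set xs" for \<sigma> r x
    unfolding D_def evB[OF that] eval_denom_base_rep d_def ..
  have D_ev: "\<exists>z. z \<noteq> 0 \<and> D \<sigma> r *\<^sub>v col Q c = z \<cdot>\<^sub>v col Q c" if "c < N" for \<sigma> r c
    using colQ[OF that] mult_col_eigen[OF D Bc DB] ch_nonzero by metis
  have Dinv: "the (mat_inverse (D \<sigma> r)) \<in> carrier_mat N N" "the (mat_inverse (D \<sigma> r)) * D \<sigma> r = 1\<^sub>m N" for \<sigma> r
    using mat_inverse_eigenbasis[OF D Q Q' D_ev] by blast+
  have V: "V = extend_rep p U X"
    unfolding V_def tensor_rep_eq U_def X_def C_def N_def ..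
  have rV: "rdim V = N" by (simp add: V extend_rep_def rU)
  have act_V: "act V (Sl2 i g) = act U (i, g)" "act V (X_gen i) = X i"
    "act V (Xinv_gen i) = the (mat_inverse (X i))" "act V (Dinv_gen \<sigma> r) = the (mat_inverse (D \<sigma> r))"
    for i g \<sigma> r by (simp_all add: V extend_rep_def D_def)
  have mV: "matrix_rep V"
    unfolding matrix_rep_def rV
  proof
    fix g show "act V g \<in> carrier_mat N N"
      using U root(1) Xinv(1) Dinv(1) by (cases g) (auto simp: act_V matrix_rep_def rU)
  qed
  have diag_inv: "mat_diag k f * mat_diag k (\<lambda>i. 1 / f i) = 1\<^sub>m k" if "\<And>i. f i \<noteq> 0" for k and f :: "nat \<Rightarrow> complex"
    using that by simp
  have BV: "intertwines V (TT (fst x) (snd x)) (B x)" if x: "x \<in> set xs" for x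
    unfolding intertwines_def rV rdim_TT
  proof (intro conjI allI)
    show "B x \<in> carrier_mat N (Suc (fst x) * Suc (snd x))" using Bc[OF x] by (simp add: d_def)
    fix g
    show "act V g * B x = B x * act (TT (fst x) (snd x)) g"
    proof (cases g)
      case (Sl2 i h)
      thus ?thesis using B(1)[OF x] by (simp add: act_V intertwines_def)
    next
      case (X_gen i)
      thus ?thesis using XB[OF x] by (simp add: act_V d_def)
    next
      case (Xinv_gen i)
      have "the (mat_inverse (X i)) * B x = B x * mat_diag (d x) (\<lambda>_. 1 / xval (fst x) (snd x) i)"
        by (rule inverse_intertwines[OF root(1) Xinv(1,2) mat_diag_dim mat_diag_dim diag_inv Bc[OF x] XB[OF x]]) simp_all
      thus ?thesis unfolding Xinv_gen by (simp add: act_V d_def)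
    next
      case (Dinv_gen \<sigma> r)
      have "the (mat_inverse (D \<sigma> r)) * B x = B x * mat_diag (d x) (\<lambda>t. 1 / ch (2 * r + wp (fst x) (snd x) \<sigma> t))"
        by (rule inverse_intertwines[OF D Dinv(1,2) mat_diag_dim mat_diag_dim diag_inv Bc[OF x] DB[OF x]]) simp_all
      thus ?thesis unfolding Dinv_gen by (simp add: act_V d_def)
    qed
  qed
  show ?thesis
    using mV BV dims Q' unfolding rV Q_def d_def by blast
qed

lemma tensor_rep_decomposes:
  fixes n n' m m' :: nat
  defines "V \<equiv> tensor_rep p (TT n n') (TT m m')"
    and "xs \<equiv> List.product (spin_list n m) (spin_list n' m')"
  shows "is_rep (ext_rels p) V" "is_rep (so4_rels p) (pullback_rep (phi p) V)"
    "rep_iso (pullback_rep (phi p) V) (direct_sum_rep (map (\<lambda>x. RR (fst x) (snd x)) xs))"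
proof -
  obtain B Q' where V: "matrix_rep V"
    and B: "\<And>x. x \<in> set xs \<Longrightarrow> intertwines V (TT (fst x) (snd x)) (B x)"
    and dims: "sum_list (map (\<lambda>x. Suc (fst x) * Suc (snd x)) xs) = rdim V"
    and Q': "Q' \<in> carrier_mat (rdim V) (rdim V)" "hcat (rdim V) (map B xs) * Q' = 1\<^sub>m (rdim V)"
      "Q' * hcat (rdim V) (map B xs) = 1\<^sub>m (rdim V)"
    using tensor_decomposition[of n n' m m'] unfolding V_def xs_def by blast
  show "is_rep (ext_rels p) V"
    by (rule is_rep_of_blocks[OF V TT_is_rep B _ Q'(1,2)]) (use dims in auto)
  let ?R = "pullback_rep (phi p) V"
  have R: "matrix_rep ?R" by (rule pullback_rep_matrix_rep[OF V])
  have rR: "rdim ?R = rdim V" by (simp add: pullback_rep_def)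
  have BR: "intertwines ?R (RR (fst x) (snd x)) (B x)" if "x \<in> set xs" for x
    unfolding RR_def by (rule pullback_rep_intertwines[OF V TT_matrix_rep B[OF that]])
  show "is_rep (so4_rels p) ?R"
    by (rule is_rep_of_blocks[OF R RR_is_rep BR, where Q' = Q']) (use dims Q' rR in auto)
  show "rep_iso ?R (direct_sum_rep (map (\<lambda>x. RR (fst x) (snd x)) xs))"
    by (rule rep_iso_of_blocks[OF R RR_matrix_rep BR, where Q' = Q']) (use dims Q' rR in auto)
qed

end

text \<open>\<open>rep_iso\<close> only compares matrices, and the operators of
  \<open>tensor_rep\<close> come from a description and a total inverse. That they satisfy the
  relations of the extended algebra and of \<open>so4_rels\<close> is therefore asserted separately,
  and so is the irreducibility of the summands.\<close>

theorem mainTheorem6: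
  fixes q p :: complex and j j' s s' :: rat
  assumes "q \<noteq> 0"
    and "\<forall>n :: nat. n > 0 \<longrightarrow> q ^ n \<noteq> 1"
    and "p ^ 2 = q"
    and "j \<in> half_nats" and "j' \<in> half_nats" and "s \<in> half_nats" and "s' \<in> half_nats"
  shows "is_rep (ext_rels p) (tensor_rep p (TT_rep p j j') (TT_rep p s s')) \<and>
    is_rep (so4_rels p) (R_tensor_rep p j j' s s') \<and>
    (\<forall>k \<in> set (spin_range j s). \<forall>k' \<in> set (spin_range j' s').
       irreducible_rep (so4_rels p) (R_rep p k k')) \<and>
    rep_iso (R_tensor_rep p j j' s s')
      (direct_sum_rep [R_rep p k k'. k \<leftarrow> spin_range j s, k' \<leftarrow> spin_range j' s'])"
proof -
  \<comment> \<open>An equation \<open>p ^ n = 1\<close> would give \<open>q ^ n = 1\<close>, so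
    \<open>p\<close> inherits the genericity of \<open>q\<close>.\<close>
  interpret generic_q p
  proof
    show "p \<noteq> 0" using assms(1,3) by auto
    show "p ^ n \<noteq> 1" if "n > 0" for n
    proof
      assume "p ^ n = 1"
      hence "q ^ n = 1" using assms(3) by (metis power_commutes power_mult mult.commute power_one)
      thus False using assms(2) that by blast
    qed
  qed
  obtain n n' m m' where nm: "j = of_nat n / 2" "j' = of_nat n' / 2" "s = of_nat m / 2" "s' = of_nat m' / 2"
    using assms(4-7) unfolding half_nats_def by blast
  have list: "[R_rep p k k'. k \<leftarrow> spin_range j s, k' \<leftarrow> spin_range j' s'] =
      map (\<lambda>x. RR (fst x) (snd x)) (List.product (spin_list n m) (spin_list n' m'))"
    unfolding nm spin_range_half
    by (simp add: product_concat_map map_concat o_def R_rep_half)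
  have "irreducible_rep (so4_rels p) (R_rep p k k')"
    if "k \<in> set (spin_range j s)" "k' \<in> set (spin_range j' s')" for k k'
    using that RR_irreducible unfolding nm spin_range_half by (auto simp: R_rep_half)
  moreover have "R_tensor_rep p j j' s s' = pullback_rep (phi p) (tensor_rep p (TT n n') (TT m m'))"
    by (simp add: R_tensor_rep_def nm TT_rep_half)
  moreover have "tensor_rep p (TT_rep p j j') (TT_rep p s s') = tensor_rep p (TT n n') (TT m m')"
    by (simp add: nm TT_rep_half)
  ultimately show ?thesis
    using tensor_rep_decomposes[of n n' m m'] unfolding list by simp
qed


end
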